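(* Let $\mu>0$, $\delta<0$, $a_0>0$, $b:=\sqrt{2|\delta|}$, and let $\bar\rho$ be the solution of $(\bar\rho^{1/3})''+\frac{2}{y}(\bar\rho^{1/3})'+\frac14\bar\rho+\frac34\delta=0$, $\bar\rho(0)=1$, $\bar\rho'(0)=0$, with first zero $R_0\in(0,\infty)$ (positive on $[0,R_0)$). Set $\bar\alpha(s):=a_0e^{bs}$. Let $\phi(x,s)$, $x\in[0,R_0]$, $\phi>-1$, be a smooth solution of $$\frac{1}{(1+\phi)^2}\Big(x\bar\rho\phi_{ss}+\frac b2x\bar\rho\phi_s\Big)+\Big(\frac{1}{(1+\phi)^4}-\frac{1}{1+\phi}\Big)|\delta|x\bar\rho+\Big[\Big(\frac{\bar\rho}{(1+\phi)^2(1+\phi+x\phi_x)}\Big)^{4/3}\Big]_x-\frac{(\bar\rho^{4/3})_x}{(1+\phi)^4}=a_0^{5/2}e^{\frac52bs}\Big(\bar{\mathfrak B}_x+4\mu\Big(\frac{\phi_s}{1+\phi}\Big)_x\Big),$$ where $\bar{\mathfrak B}:=\frac43\mu\big(\frac{\phi_s+x\phi_{xs}}{1+\phi+x\phi_x}-\frac{\phi_s}{1+\phi}\big)$, with boundary condition $\bar{\mathfrak B}(R_0,s)=0$ and initial data $(\phi,\phi_s)|_{s=0}=(\phi_0,\phi_1)$, $\phi_0>-1$. Define the energy $$E(\phi,\phi_s):=\bar\alpha^{-1}\!\int_0^{R_0}\!x^4\bar\rho\Big(\tfrac12\phi_s^2+\sqrt{2|\delta|}(1+\phi)\phi_s-\delta(1+\phi)^2+\frac{\delta}{1+\phi}\Big)dx+\bar\alpha^{-1}\!\int_0^{R_0}\!x^2\bar\rho^{4/3}\Big\{\frac{3}{((1+\phi)^2(1+\phi+x\phi_x))^{1/3}}-\frac{3}{1+\phi}+\frac{x\phi_x}{(1+\phi)^2}\Big\}dx,$$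 and write $E(\phi_0,\phi_1)$ for its value at $s=0$. Suppose one of the following holds: (1) the perturbation is homogeneous, i.e. $\phi_0,\phi_1$ are constants (so $\phi=\phi(s)$), and $\phi_1\neq-\sqrt{2|\delta|}(1+\phi_0)+\sqrt{2|\delta|}(1+\phi_0)^{-1/2}$; (2) $E(\phi_0,\phi_1)\le0$ and the perturbation is inhomogeneous (not spatially constant). Then for any $0<\bar\varepsilon_0<0.5$, no matter how small the initial perturbation is, there exists $\bar T>0$ such that $\max\{\|\phi(s)\|_{L^\infty_x},\|x\phi_x(s)\|_{L^\infty_x}\}>\bar\varepsilon_0$ for $t>\bar T$, where $s=s(t)$.
   Context: This describes perturbations of the self-similarly expanding homogeneous solution of the spherically symmetric isentropic radiation gaseous star system (pressure $p=\rho^{4/3}$, monatomic viscosity $\mu>0$, $2\mu+3\lambda=0$): $\rho_\alpha=\alpha^{-3}(t)\bar\rho(r/\alpha)$, $u_\alpha=\alpha'(t)r/\alpha$, with $\alpha(t)=(a_0^{3/2}+\frac32a_0^{1/2}a_1t)^{2/3}$ and $a_1=\sqrt{2|\delta|/a_0}$ (escape velocity). In Lagrangian coordinates the particle path is $r(x,t)=\alpha(t)x(1+\phi(x,s(t)))$ with the self-similar time $s(t)=\int_0^t\alpha(\sigma)^{-3/2}d\sigma$, so that $\alpha(t)=\bar\alpha(s(t))$. The zero perturbation $\phi\equiv0$ is the self-similarly expanding solution; the curve $\phi_s=-\sqrt{2|\delta|}(1+\phi)+\sqrt{2|\delta|}(1+\phi)^{-1/2}$ is the set of homogeneous data with zero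 energy containing $(0,0)$. *)

theory Defs
  imports "HOL-Analysis.Analysis"
begin

definition pdx :: "(real \<Rightarrow> real \<Rightarrow> real) \<Rightarrow> real \<Rightarrow> real \<Rightarrow> real" where
  "pdx f x s = deriv (\<lambda>y. f y s) x"

definition pds :: "(real \<Rightarrow> real \<Rightarrow> real) \<Rightarrow> real \<Rightarrow> real \<Rightarrow> real" where
  "pds f x s = deriv (\<lambda>\<sigma>. f x \<sigma>) s"

fun ck_on :: "nat \<Rightarrow> (real \<times> real) set \<Rightarrow> (real \<times> real \<Rightarrow> real) \<Rightarrow> bool" where
  "ck_on 0 U f = continuous_on U f"
| "ck_on (Suc k) U f =
     (\<exists>f1 f2. (\<forall>z\<in>U. (f has_derivative (\<lambda>h. fst h * f1 z + snd h * f2 z)) (at z))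
             \<and> ck_on k U f1 \<and> ck_on k U f2)"

definition smooth2_on :: "(real \<times> real) set \<Rightarrow> (real \<times> real \<Rightarrow> real) \<Rightarrow> bool" where
  "smooth2_on U f \<longleftrightarrow> open U \<and> (\<forall>k. ck_on k U f)"

definition alpha_bar :: "real \<Rightarrow> real \<Rightarrow> real \<Rightarrow> real" where
  "alpha_bar a0 \<delta> s = a0 * exp (sqrt (2 * \<bar>\<delta>\<bar>) * s)"

definition alpha_t :: "real \<Rightarrow> real \<Rightarrow> real \<Rightarrow> real" where
  "alpha_t a0 \<delta> t = (a0 powr (3/2) + 3/2 * a0 powr (1/2) * sqrt (2 * \<bar>\<delta>\<bar> / a0) * t) powr (2/3)"

definition ss_time :: "real \<Rightarrow> real \<Rightarrow> real \<Rightarrow> real" where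
  "ss_time a0 \<delta> t = integral {0..t} (\<lambda>\<sigma>. alpha_t a0 \<delta> \<sigma> powr (-3/2))"

definition Bbar :: "real \<Rightarrow> (real \<Rightarrow> real \<Rightarrow> real) \<Rightarrow> real \<Rightarrow> real \<Rightarrow> real" where
  "Bbar \<mu> \<phi> x s = 4/3 * \<mu> *
     ((pds \<phi> x s + x * pdx (pds \<phi>) x s) / (1 + \<phi> x s + x * pdx \<phi> x s)
      - pds \<phi> x s / (1 + \<phi> x s))"

definition pert_lhs :: "real \<Rightarrow> real \<Rightarrow> (real \<Rightarrow> real) \<Rightarrow> (real \<Rightarrow> real \<Rightarrow> real) \<Rightarrow> real \<Rightarrow> real \<Rightarrow> real" where
  "pert_lhs a0 \<delta> \<rho> \<phi> x s =
     1 / (1 + \<phi> x s)^2 * (x * \<rho> x * pds (pds \<phi>) x s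
                          + sqrt (2 * \<bar>\<delta>\<bar>) / 2 * x * \<rho> x * pds \<phi> x s)
     + (1 / (1 + \<phi> x s)^4 - 1 / (1 + \<phi> x s)) * \<bar>\<delta>\<bar> * x * \<rho> x
     + deriv (\<lambda>y. (\<rho> y / ((1 + \<phi> y s)^2 * (1 + \<phi> y s + y * pdx \<phi> y s))) powr (4/3)) x
     - deriv (\<lambda>y. \<rho> y powr (4/3)) x / (1 + \<phi> x s)^4"

definition pert_rhs :: "real \<Rightarrow> real \<Rightarrow> real \<Rightarrow> (real \<Rightarrow> real \<Rightarrow> real) \<Rightarrow> real \<Rightarrow> real \<Rightarrow> real" where
  "pert_rhs \<mu> a0 \<delta> \<phi> x s =
     a0 powr (5/2) * exp (5/2 * sqrt (2 * \<bar>\<delta>\<bar>) * s) *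
     (deriv (\<lambda>y. Bbar \<mu> \<phi> y s) x + 4 * \<mu> * deriv (\<lambda>y. pds \<phi> y s / (1 + \<phi> y s)) x)"

definition energy :: "real \<Rightarrow> real \<Rightarrow> real \<Rightarrow> (real \<Rightarrow> real) \<Rightarrow> (real \<Rightarrow> real \<Rightarrow> real) \<Rightarrow> real \<Rightarrow> real" where
  "energy a0 \<delta> R0 \<rho> \<phi> s =
     inverse (alpha_bar a0 \<delta> s) * integral {0..R0} (\<lambda>x. x^4 * \<rho> x *
        (1/2 * (pds \<phi> x s)^2 + sqrt (2 * \<bar>\<delta>\<bar>) * (1 + \<phi> x s) * pds \<phi> x s
         - \<delta> * (1 + \<phi> x s)^2 + \<delta> / (1 + \<phi> x s)))
   + inverse (alpha_bar a0 \<delta> s) * integral {0..R0} (\<lambda>x. x^2 * \<rho> x powr (4/3) *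
        (3 / ((1 + \<phi> x s)^2 * (1 + \<phi> x s + x * pdx \<phi> x s)) powr (1/3)
         - 3 / (1 + \<phi> x s) + x * pdx \<phi> x s / (1 + \<phi> x s)^2))"

end

theory Submission
  imports Defs
begin

text \<open>
  With \<open>\<eta> = 1 + \<phi>\<close>, testing the equation with \<open>\<eta>\<^sub>s\<close> and with \<open>\<eta>\<close> yields the energy law
  \<open>E' = - (dissipation) \<le> 0\<close> and a virial identity from which the viscosity drops out. As long as
  \<open>\<bar>\<phi>\<bar> \<le> 1/2\<close> the energy is at least \<open>- C / \<alpha>\<close> with \<open>\<alpha> \<longlonglongrightarrow> \<infinity>\<close>, so data whose energy ever becomes negative
  must leave this neighbourhood for good.

  If \<open>E \<le> 0\<close> and the energy never becomes negative, there is no dissipation, which forces \<open>\<eta> = c(s) h(x)\<close>, and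
  \<open>h\<close> deforms \<open>\<rho>\<close> into another Lane-Emden profile of the same mass. Profiles with a larger \<open>|\<delta>|\<close> are
  pointwise denser, hence heavier, so \<open>h\<close> is constant and the data are homogeneous.

  Homogeneous data stay homogeneous: compare with the homogeneous motion that has the same moment of inertia
  and apply Gronwall's inequality to the excess energy plus the variance of \<open>\<eta>\<close>. What remains is the
  equation of a radial Kepler orbit of energy \<open>e0 \<ge> 0\<close>, which either collapses in finite time, or has escape
  velocity exactly (the excluded curve), or grows faster than \<open>\<alpha>\<close>.
\<close>

section \<open>Smooth functions of two variables\<close>

text \<open>The hypotheses constrain a given global smooth solution only through its equation and
  its data, so that homogeneous data force a homogeneous solution is itself something to prove. The
  comparison motion is tied to the moment of inertia because that quantity evolves without a viscous
  term. The excess energy alone does not control the deviation: its gravitational part has the wrong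
  sign, but it is quadratic in the deviation, and this is what the variance absorbs.

  The exponent 4/3 makes the steady problem mass-critical: rescaling a star changes its central
  density but not its total mass. Mass alone therefore cannot identify a profile, and two stars are
  compared only after their central values have been matched.

  \<open>\<rho>\<close> vanishes at \<open>R0\<close> and the equations are assumed only in the open
  interval, so they are integrated against test functions and only continuity is used at the two
  ends. The size 1/2 of the neighbourhood matches the range of \<open>\<epsilon>0\<close> and keeps
  \<open>\<eta>\<close> away from 0, as the lower energy bound requires.\<close>

lemma ck_on_cong:
  assumes "open U" "\<And>z. z \<in> U \<Longrightarrow> f z = g z" "ck_on k U f"
  shows "ck_on k U g"
proof (cases k)
  case 0
  then show ?thesis
    using assms continuous_on_cong[of U U f g] by simp
next
  case (Suc m)
  then obtain f1 f2 where
    "\<forall>z\<in>U. (f has_derivative (\<lambda>h. fst h * f1 z + snd h * f2 z)) (at z)" "ck_on m U f1" "ck_on m U f2"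
    using assms by auto
  moreover have "(g has_derivative D) (at z)" if "(f has_derivative D) (at z)" "z \<in> U" for D z
    using has_derivative_transform_within_open[OF that(1) assms(1) that(2)] assms(2) by blast
  ultimately have "(\<forall>z\<in>U. (g has_derivative (\<lambda>h. fst h * f1 z + snd h * f2 z)) (at z))
      \<and> ck_on m U f1 \<and> ck_on m U f2"
    by blast
  then show ?thesis
    unfolding Suc ck_on.simps by blast
qed

lemma has_partial_derivatives:
  fixes f :: "real \<Rightarrow> real \<Rightarrow> real"
  assumes "((\<lambda>(x, s). f x s) has_derivative (\<lambda>h. fst h * c + snd h * d)) (at (x, s))"
  shows "((\<lambda>y. f y s) has_real_derivative c) (at x)"
    and "((\<lambda>\<sigma>. f x \<sigma>) has_real_derivative d) (at s)"
proof -
  have comm: "(\<lambda>h. h * a) = (*) a" for a :: real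
    by (simp add: fun_eq_iff mult.commute)
  have 1: "((\<lambda>y. (y, s)) has_derivative (\<lambda>h. (h, 0))) (at x)"
    by (auto intro!: derivative_eq_intros)
  have 2: "((\<lambda>\<sigma>. (x, \<sigma>)) has_derivative (\<lambda>h. (0, h))) (at s)"
    by (auto intro!: derivative_eq_intros)
  show "((\<lambda>y. f y s) has_real_derivative c) (at x)"
    using has_derivative_compose[OF 1 assms] by (simp add: has_field_derivative_def comm)
  show "((\<lambda>\<sigma>. f x \<sigma>) has_real_derivative d) (at s)"
    using has_derivative_compose[OF 2 assms] by (simp add: has_field_derivative_def comm)
qed

lemma smooth2_partial_derivatives:
  assumes "smooth2_on U (\<lambda>(x, s). f x s)" "(x, s) \<in> U"
  shows "((\<lambda>y. f y s) has_real_derivative pdx f x s) (at x)"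
    and "((\<lambda>\<sigma>. f x \<sigma>) has_real_derivative pds f x s) (at s)"
proof -
  have "ck_on (Suc 0) U (\<lambda>(x, s). f x s)"
    using assms unfolding smooth2_on_def by blast
  then obtain f1 f2 where
    D: "\<forall>z\<in>U. ((\<lambda>(x, s). f x s) has_derivative (\<lambda>h. fst h * f1 z + snd h * f2 z)) (at z)"
    by auto
  note d = has_partial_derivatives[OF D[rule_format, OF assms(2)]]
  show "((\<lambda>y. f y s) has_real_derivative pdx f x s) (at x)"
    using d(1) DERIV_imp_deriv[OF d(1)] unfolding pdx_def by simp
  show "((\<lambda>\<sigma>. f x \<sigma>) has_real_derivative pds f x s) (at s)"
    using d(2) DERIV_imp_deriv[OF d(2)] unfolding pds_def by simp
qed

text \<open>The witnesses \<open>f1\<close>, \<open>f2\<close> in \<open>ck_on\<close> are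
  anonymous, but uniqueness of derivatives identifies them on \<open>U\<close> with
  \<open>pdx f\<close> and \<open>pds f\<close>; \<open>ck_on_cong\<close> then transfers their
  regularity.\<close>

lemma smooth2_on_partials:
  assumes "smooth2_on U (\<lambda>(x, s). f x s)"
  shows "smooth2_on U (\<lambda>(x, s). pdx f x s)" and "smooth2_on U (\<lambda>(x, s). pds f x s)"
proof -
  have U: "open U"
    using assms by (simp add: smooth2_on_def)
  have "ck_on k U (\<lambda>(x, s). pdx f x s) \<and> ck_on k U (\<lambda>(x, s). pds f x s)" for k
  proof -
    have "ck_on (Suc k) U (\<lambda>(x, s). f x s)"
      using assms unfolding smooth2_on_def by blast
    then obtain f1 f2 where
      D: "\<forall>z\<in>U. ((\<lambda>(x, s). f x s) has_derivative (\<lambda>h. fst h * f1 z + snd h * f2 z)) (at z)"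
      and c: "ck_on k U f1" "ck_on k U f2"
      by auto
    have e: "f1 z = (\<lambda>(x, s). pdx f x s) z" "f2 z = (\<lambda>(x, s). pds f x s) z" if z: "z \<in> U" for z
    proof -
      obtain x s where xs: "z = (x, s)" by (cases z)
      note d = has_partial_derivatives[OF D[rule_format, OF z, unfolded xs]]
      show "f1 z = (\<lambda>(x, s). pdx f x s) z" "f2 z = (\<lambda>(x, s). pds f x s) z"
        unfolding xs using DERIV_imp_deriv[OF d(1)] DERIV_imp_deriv[OF d(2)]
        by (simp_all add: pdx_def pds_def)
    qed
    show ?thesis
      using ck_on_cong[OF U e(1) c(1)] ck_on_cong[OF U e(2) c(2)] by blast
  qed
  then show "smooth2_on U (\<lambda>(x, s). pdx f x s)" and "smooth2_on U (\<lambda>(x, s). pds f x s)"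
    using U by (auto simp: smooth2_on_def)
qed

lemma smooth2_on_continuous:
  assumes "smooth2_on U f" shows "continuous_on U f"
  using assms ck_on.simps(1) unfolding smooth2_on_def by blast

lemma at_within_Icc_nontrivial:
  fixes a b :: real
  assumes "a < b" "x \<in> {a..b}"
  shows "at x within {a..b} \<noteq> bot"
proof -
  have "x islimpt {a..b}"
    using assms by (intro connected_imp_perfect) auto
  then show ?thesis
    by (simp add: trivial_limit_within)
qed

text \<open>Symmetry of the mixed partials: differentiate \<open>f x s = f x 0 + \<integral>\<^sub>0\<^sup>s f\<^sub>s x\<close> under the
  integral sign, then apply the fundamental theorem of calculus.\<close>
lemma smooth2_mixed_partials:
  assumes sm: "smooth2_on U (\<lambda>(x, s). f x s)" and sub: "{0..R} \<times> {0..} \<subseteq> U"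
    and R: "R > 0" and x: "x \<in> {0..R}" and s: "s \<ge> 0"
  shows "pds (pdx f) x s = pdx (pds f) x s"
proof -
  \<comment> \<open>Room to the right of \<open>s\<close>, so that \<open>{0..S}\<close> is a
    nontrivial interval even for \<open>s = 0\<close>.\<close>
  define S where "S = s + 1"
  have sms: "smooth2_on U (\<lambda>(x, s). pds f x s)" and smx: "smooth2_on U (\<lambda>(x, s). pdx f x s)"
    using smooth2_on_partials[OF sm] by auto
  have smsx: "smooth2_on U (\<lambda>(x, s). pdx (pds f) x s)"
    using smooth2_on_partials[OF sms] by auto
  have inU: "(y, \<sigma>) \<in> U" if "y \<in> {0..R}" "\<sigma> \<ge> 0" for y \<sigma>
    using that sub by auto
  have contt: "continuous_on {0..S} (\<lambda>t. g y t)"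
    if "smooth2_on U (\<lambda>(x, s). g x s)" "y \<in> {0..R}" for g y
  proof -
    have "continuous_on {0..S} ((\<lambda>(x, s). g x s) \<circ> (\<lambda>t. (y, t)))"
      by (rule continuous_on_compose)
        (use that inU in \<open>auto intro!: continuous_intros continuous_on_subset[OF smooth2_on_continuous[OF that(1)]]\<close>)
    then show ?thesis by (simp add: o_def)
  qed
  have ftc: "integral {0..t} (\<lambda>\<sigma>. pds f y \<sigma>) = f y t - f y 0" if "y \<in> {0..R}" "t \<ge> 0" for y t
  proof (rule integral_unique, rule fundamental_theorem_of_calculus)
    show "0 \<le> t" by fact
    show "(f y has_vector_derivative pds f y \<sigma>) (at \<sigma> within {0..t})" if "\<sigma> \<in> {0..t}" for \<sigma>
      using smooth2_partial_derivatives(2)[OF sm inU, of y \<sigma>] that \<open>y \<in> {0..R}\<close>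
      by (simp add: has_real_derivative_iff_has_vector_derivative has_vector_derivative_at_within)
  qed
  have key: "pdx f x t = pdx f x 0 + integral {0..t} (\<lambda>\<sigma>. pdx (pds f) x \<sigma>)" if t: "t \<in> {0..S}" for t
  proof -
    have "((\<lambda>y. integral (cbox 0 t) (\<lambda>\<sigma>. pds f y \<sigma>)) has_field_derivative
            integral (cbox 0 t) (\<lambda>\<sigma>. pdx (pds f) x \<sigma>)) (at x within {0..R})"
    proof (rule leibniz_rule_field_derivative)
      show "((\<lambda>y. pds f y \<sigma>) has_field_derivative pdx (pds f) y \<sigma>) (at y within {0..R})"
        if "y \<in> {0..R}" "\<sigma> \<in> cbox 0 t" for y \<sigma>
        using smooth2_partial_derivatives(1)[OF sms inU, of y \<sigma>] that
        by (intro has_field_derivative_at_within[where s = "{0..R}"]) auto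
      show "(\<lambda>\<sigma>. pds f y \<sigma>) integrable_on cbox 0 t" if "y \<in> {0..R}" for y
        using contt[OF sms that] t
        by (auto intro!: integrable_continuous_real elim: continuous_on_subset)
      show "continuous_on ({0..R} \<times> cbox 0 t) (\<lambda>(x, t). pdx (pds f) x t)"
        using smooth2_on_continuous[OF smsx] sub by (auto elim!: continuous_on_subset)
    qed (use x in auto)
    then have A: "((\<lambda>y. integral {0..t} (\<lambda>\<sigma>. pds f y \<sigma>)) has_field_derivative
            integral {0..t} (\<lambda>\<sigma>. pdx (pds f) x \<sigma>)) (at x within {0..R})"
      by simp
    have "((\<lambda>y. f y t - f y 0) has_field_derivative pdx f x t - pdx f x 0) (at x within {0..R})"
      using smooth2_partial_derivatives(1)[OF sm inU, of x t]
        smooth2_partial_derivatives(1)[OF sm inU, of x 0] x t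
      by (intro DERIV_diff; intro has_field_derivative_at_within[where s = "{0..R}"]) auto
    then have B: "((\<lambda>y. integral {0..t} (\<lambda>\<sigma>. pds f y \<sigma>)) has_field_derivative
            pdx f x t - pdx f x 0) (at x within {0..R})"
      using ftc t x by (elim has_field_derivative_transform_within[where d = 1]) auto
    show ?thesis
      using has_field_derivative_unique[OF A B at_within_Icc_nontrivial[OF R x]] by simp
  qed
  have D1: "((\<lambda>t. pdx f x 0 + integral {0..t} (\<lambda>\<sigma>. pdx (pds f) x \<sigma>)) has_real_derivative
      pdx (pds f) x s) (at s within {0..S})"
  proof -
    have "((\<lambda>t. integral {0..t} (\<lambda>\<sigma>. pdx (pds f) x \<sigma>)) has_real_derivative
      pdx (pds f) x s) (at s within {0..S})"
      by (rule integral_has_real_derivative[OF contt[OF smsx x]]) (use s in \<open>simp add: S_def\<close>)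
    from DERIV_add[OF DERIV_const this] show ?thesis by simp
  qed
  have D2: "(pdx f x has_real_derivative pdx (pds f) x s) (at s within {0..S})"
    by (rule has_field_derivative_transform_within[OF D1 zero_less_one])
      (use s in \<open>auto simp: S_def intro: key[unfolded S_def, symmetric]\<close>)
  have D3: "(pdx f x has_real_derivative pds (pdx f) x s) (at s within {0..S})"
    using smooth2_partial_derivatives(2)[OF smx inU[OF x s]] by (rule has_field_derivative_at_within)
  have "at s within {0..S} \<noteq> bot"
    using s by (intro at_within_Icc_nontrivial) (auto simp: S_def)
  then show ?thesis
    by (rule has_field_derivative_unique[OF D3 D2])
qed


section \<open>Lane-Emden profiles of equal mass\<close>

text \<open>\<open>w\<close> is the cube root of the density of a star with \<open>\<Delta>w + w\<^sup>3/4 = 3\<kappa>/4\<close>, written as a first-order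
  system with the mass \<open>m\<close> enclosed in the ball of radius \<open>r\<close>.\<close>
definition lane_emden :: "real \<Rightarrow> real \<Rightarrow> real \<Rightarrow> (real \<Rightarrow> real) \<Rightarrow> (real \<Rightarrow> real) \<Rightarrow> bool" where
  "lane_emden \<kappa> c R w m \<longleftrightarrow>
     R > 0 \<and> c > 0 \<and> continuous_on {0..R} w \<and> continuous_on {0..R} m
     \<and> w 0 = c \<and> m 0 = 0 \<and> w R = 0 \<and> (\<forall>r\<in>{0..<R}. w r > 0)
     \<and> (\<forall>r\<in>{0<..<R}. (w has_real_derivative (\<kappa> * r - m r / r^2) / 4) (at r))
     \<and> (\<forall>r\<in>{0<..<R}. (m has_real_derivative r^2 * w r ^ 3) (at r))"

text \<open>At \<open>r = 0\<close> the junk value \<open>0 / 0 = 0\<close> happens to be the correct slope.\<close>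
definition le_slope :: "real \<Rightarrow> (real \<Rightarrow> real) \<Rightarrow> real \<Rightarrow> real" where
  "le_slope \<kappa> m r = (\<kappa> * r - m r / r^2) / 4"

text \<open>\<open>w\<close> is bounded by some \<open>B\<close> on the compact interval, so
  \<open>m\<close> grows at rate at most \<open>B ^ 3 * r^2\<close>. A cubic bound, with any
  constant, is what tames \<open>m r / r^2\<close> at the centre.\<close>

lemma lane_emden_mass_bound:
  assumes "lane_emden \<kappa> c R w m"
  obtains K where "K \<ge> 0" "\<And>r. r \<in> {0..R} \<Longrightarrow> 0 \<le> m r \<and> m r \<le> K * r^3"
proof -
  have R: "R > 0" and cw: "continuous_on {0..R} w" and cm: "continuous_on {0..R} m"
    and m0: "m 0 = 0" and wR: "w R = 0" and wp: "\<And>r. r \<in> {0..<R} \<Longrightarrow> w r > 0"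
    and dm: "\<And>r. r \<in> {0<..<R} \<Longrightarrow> (m has_real_derivative r^2 * w r ^ 3) (at r)"
    using assms by (auto simp: lane_emden_def)
  have "compact (w ` {0..R})"
    using cw by (rule compact_continuous_image) simp
  then obtain B where B: "B > 0" "\<And>r. r \<in> {0..R} \<Longrightarrow> norm (w r) \<le> B"
    using compact_imp_bounded[of "w ` {0..R}"] by (auto simp: bounded_pos)
  have w3: "w r ^ 3 \<le> B ^ 3" "0 \<le> w r ^ 3" if "r \<in> {0<..<R}" for r
    using B(2)[of r] wp[of r] that by (auto intro!: power_mono)
  have "0 \<le> m r \<and> m r \<le> B ^ 3 * r^3" if r: "r \<in> {0..R}" for r
  proof
    have "m 0 \<le> m r"
    proof (rule DERIV_nonneg_imp_increasing_open[where f = m])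
      show "\<exists>y. (m has_real_derivative y) (at x) \<and> 0 \<le> y" if "0 < x" "x < r" for x
        using dm[of x] w3[of x] that r by (intro exI[of _ "x^2 * w x ^ 3"]) auto
    qed (use r cm in \<open>auto elim: continuous_on_subset\<close>)
    then show "0 \<le> m r" by (simp add: m0)
    have "B ^ 3 * 0^3 - m 0 \<le> B ^ 3 * r^3 - m r"
    proof (rule DERIV_nonneg_imp_increasing_open[where f = "\<lambda>r. B ^ 3 * r^3 - m r"])
      show "\<exists>y. ((\<lambda>r. B ^ 3 * r^3 - m r) has_real_derivative y) (at x) \<and> 0 \<le> y" if "0 < x" "x < r" for x
      proof (intro exI conjI)
        show "((\<lambda>r. B ^ 3 * r^3 - m r) has_real_derivative 3 * B^3 * x^2 - x^2 * w x ^ 3) (at x)"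
          using dm[of x] that r by (auto intro!: derivative_eq_intros simp: power2_eq_square)
        have "w x ^ 3 \<le> 3 * B^3"
        proof -
          have "w x ^ 3 \<le> B ^ 3" "0 \<le> B ^ 3" using w3(1)[of x] that r B(1) by auto
          then show ?thesis by linarith
        qed
        then have "x^2 * w x ^ 3 \<le> x^2 * (3 * B^3)" by (intro mult_left_mono) auto
        then show "0 \<le> 3 * B^3 * x^2 - x^2 * w x ^ 3" by (simp add: algebra_simps)
      qed
    qed (use r cm in \<open>auto intro!: continuous_intros elim: continuous_on_subset\<close>)
    then show "m r \<le> B ^ 3 * r^3" by (simp add: m0)
  qed
  then show ?thesis using B(1) by (intro that[of "B ^ 3"]) auto
qed

text \<open>The delicate point is the centre, where the cubic mass bound gives
  \<open>m r / r^2 \<le> K * r\<close>. Continuity there lets the monotonicity arguments below start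
  at \<open>r = 0\<close>.\<close>

lemma le_slope_continuous:
  assumes "lane_emden \<kappa> c R w m"
  shows "continuous_on {0..R} (le_slope \<kappa> m)"
proof -
  obtain K where K: "K \<ge> 0" "\<And>r. r \<in> {0..R} \<Longrightarrow> 0 \<le> m r \<and> m r \<le> K * r^3"
    using lane_emden_mass_bound[OF assms] by blast
  have cm: "continuous_on {0..R} m" using assms by (simp add: lane_emden_def)
  have "(le_slope \<kappa> m \<longlongrightarrow> le_slope \<kappa> m x) (at x within {0..R})" if x: "x \<in> {0..R}" for x
  proof (cases "x = 0")
    case False
    have "(m \<longlongrightarrow> m x) (at x within {0..R})" using cm x by (simp add: continuous_on_def)
    then show ?thesis unfolding le_slope_def using False by (auto intro!: tendsto_eq_intros)
  next
    case True
    have "(le_slope \<kappa> m \<longlongrightarrow> 0) (at 0 within {0..R})"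
    proof (rule Lim_null_comparison)
      show "\<forall>\<^sub>F r in at 0 within {0..R}. norm (le_slope \<kappa> m r) \<le> (\<bar>\<kappa>\<bar> + K) * \<bar>r\<bar>"
        unfolding eventually_at
      proof (intro exI[of _ 1] conjI ballI impI)
        fix r assume r: "r \<in> {0..R}" "r \<noteq> 0 \<and> dist r 0 < 1"
        then have rp: "r > 0" by auto
        have "m r / r^2 \<le> K * r" "0 \<le> m r / r^2"
          using K(2)[OF r(1)] rp by (auto simp: field_simps power2_eq_square power3_eq_cube)
        moreover have "\<bar>\<kappa> * r\<bar> = \<bar>\<kappa>\<bar> * r" using rp by (simp add: abs_mult)
        ultimately show "norm (le_slope \<kappa> m r) \<le> (\<bar>\<kappa>\<bar> + K) * \<bar>r\<bar>"
          unfolding le_slope_def using rp abs_triangle_ineq4[of "\<kappa> * r" "m r / r^2"]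
          by (simp add: distrib_right)
      qed simp
      show "((\<lambda>r. (\<bar>\<kappa>\<bar> + K) * \<bar>r\<bar>) \<longlongrightarrow> 0) (at 0 within {0..R})"
        by (auto intro!: tendsto_eq_intros)
    qed
    then show ?thesis using True by (simp add: le_slope_def)
  qed
  then show ?thesis by (simp add: continuous_on_def)
qed

text \<open>Differentiating the slope recovers the second-order radial equation
  \<open>w'' + 2 / r * w' = (3 * \<kappa> - w ^ 3) / 4\<close> from the first-order system.\<close>

lemma le_slope_DERIV:
  assumes "lane_emden \<kappa> c R w m" "r \<in> {0<..<R}"
  shows "(le_slope \<kappa> m has_real_derivative (3 * \<kappa> - w r ^ 3) / 4 - 2 / r * le_slope \<kappa> m r) (at r)"
proof -
  have dm: "(m has_real_derivative r^2 * w r ^ 3) (at r)"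
    using assms by (simp add: lane_emden_def)
  show ?thesis
    unfolding le_slope_def using assms(2)
    by (auto intro!: derivative_eq_intros dm simp: field_simps power2_eq_square)
qed

text \<open>If \<open>w\<close> increased at \<open>r0\<close>, then the value \<open>min w\<close> over \<open>[0, r0]\<close> would be attained again to the right of \<open>r0\<close>;
  there the nonincreasing energy \<open>w'\<^sup>2/2 + w\<^sup>4/16 - 3\<kappa>w/4\<close> is at least its value at the minimum, where \<open>w' = 0\<close>,
  so it is constant in between and \<open>w'\<close> vanishes on that interval.\<close>
lemma le_slope_nonpos:
  assumes LE: "lane_emden \<kappa> c R w m" and r0: "r0 \<in> {0<..<R}"
  shows "le_slope \<kappa> m r0 \<le> 0"
proof (rule ccontr)
  assume neg: "\<not> le_slope \<kappa> m r0 \<le> 0"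
  let ?g = "le_slope \<kappa> m"
  have R: "R > 0" and cw: "continuous_on {0..R} w"
    and wR: "w R = 0" and wp: "\<And>r. r \<in> {0..<R} \<Longrightarrow> w r > 0"
    and dw: "\<And>r. r \<in> {0<..<R} \<Longrightarrow> (w has_real_derivative ?g r) (at r)"
    using LE by (auto simp: lane_emden_def le_slope_def)
  note cg = le_slope_continuous[OF LE]
  define e where "e r = ?g r ^ 2 / 2 + w r ^ 4 / 16 - 3/4 * \<kappa> * w r" for r
  have ce: "continuous_on {0..R} e"
    unfolding e_def by (intro continuous_intros cg cw) auto
  have de: "(e has_real_derivative - 2 / r * ?g r ^ 2) (at r)" if "r \<in> {0<..<R}" for r
    unfolding e_def using that
    by (auto intro!: derivative_eq_intros dw le_slope_DERIV[OF LE] simp: field_simps power2_eq_square power3_eq_cube)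
  obtain rm where rm: "rm \<in> {0..r0}" "\<And>r. r \<in> {0..r0} \<Longrightarrow> w rm \<le> w r"
    using continuous_attains_inf[of "{0..r0}" w] r0 continuous_on_subset[OF cw] by auto
  have "rm \<noteq> r0"
  proof
    assume eq: "rm = r0"
    obtain d where d: "d > 0" "\<And>h. h > 0 \<Longrightarrow> h < d \<Longrightarrow> w (r0 - h) < w r0"
      using DERIV_pos_inc_left[OF dw[OF r0]] neg by auto
    define h where "h = min (d/2) r0"
    have "w (r0 - h) < w r0" using d r0 by (auto simp: h_def)
    moreover have "w r0 \<le> w (r0 - h)"
      using rm(2)[of "r0 - h"] d r0 eq by (auto simp: h_def)
    ultimately show False by simp
  qed
  then have rmlt: "rm < r0" using rm(1) by auto
  \<comment> \<open>An interior minimum is critical; at the centre the slope is 0 by the value that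
    \<open>le_slope\<close> takes there.\<close>
  have grm: "?g rm = 0"
  proof (cases "rm = 0")
    case False
    then have "rm \<in> {0<..<R}" using rm r0 by auto
    moreover have "\<forall>y. \<bar>rm - y\<bar> < min rm (r0 - rm) \<longrightarrow> w rm \<le> w y"
      by (auto intro!: rm(2))
    ultimately show ?thesis
      using DERIV_local_min[OF dw, of rm "min rm (r0 - rm)"] rmlt False rm(1) by auto
  qed (simp add: le_slope_def)
  have wrm: "w rm > 0" using wp rm r0 by auto
  obtain r2 where r2: "r0 \<le> r2" "r2 \<le> R" "w r2 = w rm"
    using IVT2'[of w R "w rm" r0] rm(2)[of r0] wrm wR r0 continuous_on_subset[OF cw, of "{r0..R}"] by auto
  have dec: "e y \<le> e x" if "0 \<le> x" "x \<le> y" "y \<le> R" for x y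
  proof (rule DERIV_nonpos_imp_decreasing_open[OF that(2), where f = e])
    show "\<exists>d. (e has_real_derivative d) (at z) \<and> d \<le> 0" if "x < z" "z < y" for z
      using de[of z] that \<open>0 \<le> x\<close> \<open>y \<le> R\<close> by (intro exI[of _ "- 2 / z * ?g z ^ 2"]) (auto simp: divide_nonpos_pos)
  qed (use ce that in \<open>auto elim: continuous_on_subset\<close>)
  have "e rm \<le> e r2" unfolding e_def using r2 grm by simp
  then have const: "e y = e rm" if "y \<in> {rm..r2}" for y
    using dec[of rm y] dec[of y r2] that rm(1) r2(2) by fastforce
  have "r0 < r2"
  proof (rule ccontr)
    assume "\<not> r0 < r2"
    then have "r2 = r0" using r2 by simp
    then have "e r0 > e rm" unfolding e_def using r2 grm neg by auto
    then show False using const[of r0] rmlt r2 by auto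
  qed
  then have r0i: "r0 \<in> {rm<..<r2}" using rmlt by simp
  have "(e has_real_derivative 0) (at r0)"
    by (rule has_field_derivative_transform_within_open[OF DERIV_const open_greaterThanLessThan r0i])
      (rule const[symmetric], auto)
  then have "- 2 / r0 * ?g r0 ^ 2 = 0"
    using DERIV_unique[OF de[OF r0]] by simp
  then show False using neg r0 by auto
qed

text \<open>With \<open>u = r (w2 - w1)\<close>, \<open>U = \<integral>u\<close> and \<open>Q = (w1\<^sup>2 + w1 w2 + w2\<^sup>2)/4\<close> one has \<open>u'' + Q u = 3/4 (\<kappa>2 - \<kappa>1) r\<close>. As \<open>Q\<close> is
  nonincreasing, \<open>u'\<^sup>2/2 + Q u\<^sup>2/2 \<le> 3/4 (\<kappa>2 - \<kappa>1) (r u - U)\<close>; hence \<open>U/r\<close> is nondecreasing and \<open>r u \<ge> U \<ge> 0\<close>.\<close>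
lemma lane_emden_comparison:
  assumes LE1: "lane_emden \<kappa>1 c R1 w1 m1" and LE2: "lane_emden \<kappa>2 c R2 w2 m2"
    and \<kappa>: "\<kappa>1 \<le> \<kappa>2" and r: "0 < r" "r \<le> R1" "r \<le> R2"
  shows "w1 r \<le> w2 r"
proof -
  define R where "R = min R1 R2"
  define g1 where "g1 = le_slope \<kappa>1 m1"
  define g2 where "g2 = le_slope \<kappa>2 m2"
  have R: "R > 0" and w0: "w1 0 = c" "w2 0 = c"
    and wp: "\<And>r. r \<in> {0..<R} \<Longrightarrow> w1 r > 0" "\<And>r. r \<in> {0..<R} \<Longrightarrow> w2 r > 0"
    and dw: "\<And>r. r \<in> {0<..<R} \<Longrightarrow> (w1 has_real_derivative g1 r) (at r)"
      "\<And>r. r \<in> {0<..<R} \<Longrightarrow> (w2 has_real_derivative g2 r) (at r)"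
    using LE1 LE2 by (auto simp: lane_emden_def le_slope_def g1_def g2_def R_def)
  have cw: "continuous_on {0..R} w1" "continuous_on {0..R} w2"
    using LE1 LE2 by (auto simp: lane_emden_def R_def elim!: continuous_on_subset)
  have cg: "continuous_on {0..R} g1" "continuous_on {0..R} g2"
    using le_slope_continuous[OF LE1] le_slope_continuous[OF LE2]
    by (auto simp: g1_def g2_def R_def elim!: continuous_on_subset)
  have dg: "\<And>r. r \<in> {0<..<R} \<Longrightarrow> (g1 has_real_derivative (3 * \<kappa>1 - w1 r ^ 3) / 4 - 2 / r * g1 r) (at r)"
    "\<And>r. r \<in> {0<..<R} \<Longrightarrow> (g2 has_real_derivative (3 * \<kappa>2 - w2 r ^ 3) / 4 - 2 / r * g2 r) (at r)"
    using le_slope_DERIV[OF LE1] le_slope_DERIV[OF LE2] by (auto simp: g1_def g2_def R_def)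
  have gn: "\<And>r. r \<in> {0<..<R} \<Longrightarrow> g1 r \<le> 0" "\<And>r. r \<in> {0<..<R} \<Longrightarrow> g2 r \<le> 0"
    using le_slope_nonpos[OF LE1] le_slope_nonpos[OF LE2] by (auto simp: g1_def g2_def R_def)
  define u where "u r = r * (w2 r - w1 r)" for r
  define u' where "u' r = (w2 r - w1 r) + r * (g2 r - g1 r)" for r
  define Q where "Q r = (w1 r ^ 2 + w1 r * w2 r + w2 r ^ 2) / 4" for r
  define Q' where "Q' r = (2 * w1 r * g1 r + w1 r * g2 r + g1 r * w2 r + 2 * w2 r * g2 r) / 4" for r
  define U where "U r = integral {0..r} u" for r
  define k where "k = 3/4 * (\<kappa>2 - \<kappa>1)"
  define S where "S r = u' r ^ 2 / 2 + Q r * u r ^ 2 / 2 - k * (r * u r - U r)" for r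
  have k: "k \<ge> 0" using \<kappa> by (simp add: k_def)
  have cu: "continuous_on {0..R} u" unfolding u_def by (intro continuous_intros cw)
  have cu': "continuous_on {0..R} u'" unfolding u'_def by (intro continuous_intros cw cg)
  have dUw: "(U has_real_derivative u x) (at x within {0..R})" if "x \<in> {0..R}" for x
    unfolding U_def using integral_has_real_derivative[OF cu that] .
  then have cU: "continuous_on {0..R} U"
    by (meson DERIV_continuous continuous_on_eq_continuous_within)
  have dU: "(U has_real_derivative u x) (at x)" if "x \<in> {0<..<R}" for x
    using dUw[of x] that at_within_Icc_at[of 0 x R] by auto
  have du: "(u has_real_derivative u' x) (at x)" if "x \<in> {0<..<R}" for x
    unfolding u_def u'_def using that by (auto intro!: derivative_eq_intros dw)
  have du': "(u' has_real_derivative k * x - Q x * u x) (at x)" if "x \<in> {0<..<R}" for x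
    unfolding u'_def Q_def u_def k_def using that
    by (auto intro!: derivative_eq_intros dw dg simp: field_simps power2_eq_square power3_eq_cube)
  have dQ: "(Q has_real_derivative Q' x) (at x)" if "x \<in> {0<..<R}" for x
    unfolding Q_def Q'_def using that
    by (auto intro!: derivative_eq_intros dw simp: field_simps power2_eq_square)
  have Q'n: "Q' x \<le> 0" if x: "x \<in> {0<..<R}" for x
  proof -
    have "w1 x * g1 x \<le> 0" "w1 x * g2 x \<le> 0" "g1 x * w2 x \<le> 0" "w2 x * g2 x \<le> 0"
      using wp[of x] gn[OF x] x by (auto simp: mult_le_0_iff)
    then show ?thesis by (simp add: Q'_def)
  qed
  have cS: "continuous_on {0..R} S"
    unfolding S_def Q_def by (intro continuous_intros cw cu cu' cU) auto
  have dS: "(S has_real_derivative Q' x * u x ^ 2 / 2) (at x)" if "x \<in> {0<..<R}" for x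
    unfolding S_def using that
    by (auto intro!: derivative_eq_intros dU du du' dQ simp: field_simps power2_eq_square)
  have "S x \<le> S 0" if x: "x \<in> {0..R}" for x
  proof (rule DERIV_nonpos_imp_decreasing_open[where f = S])
    show "\<exists>d. (S has_real_derivative d) (at z) \<and> d \<le> 0" if "0 < z" "z < x" for z
      using dS[of z] Q'n[of z] that x by (intro exI[of _ "Q' z * u z ^ 2 / 2"]) (auto simp: mult_le_0_iff)
  qed (use cS x in \<open>auto elim: continuous_on_subset\<close>)
  moreover have "S 0 = 0" by (simp add: S_def u'_def u_def w0 U_def)
  ultimately have S: "S x \<le> 0" if "x \<in> {0..R}" for x using that by fastforce
  have Qp: "Q x > 0" if "x \<in> {0..<R}" for x
    unfolding Q_def using wp[of x] that by (auto intro!: add_pos_pos)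
  have Qn: "Q x \<ge> 0" if "x \<in> {0..R}" for x
  proof -
    have "Q x = ((w1 x + w2 x / 2)^2 + 3/4 * w2 x ^ 2) / 4"
      by (simp add: Q_def power2_eq_square field_simps)
    also have "\<dots> \<ge> 0" by simp
    finally show ?thesis .
  qed
  have key: "u x \<ge> 0" if x: "x \<in> {0<..<R}" for x
  \<comment> \<open>For \<open>k = 0\<close> the inequality \<open>S x \<le> 0\<close> cannot be
    divided by \<open>k\<close>, but then it forces \<open>u x = 0\<close> outright.\<close>
  proof (cases "k = 0")
    case True
    then have "u' x ^ 2 / 2 + Q x * u x ^ 2 / 2 \<le> 0"
      using S[of x] x by (simp add: S_def)
    then have "Q x * u x ^ 2 \<le> 0"
      using zero_le_power2[of "u' x"] by linarith
    then have "u x = 0" using Qp[of x] x by (auto simp: mult_le_0_iff)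
    then show ?thesis by simp
  next
    case False
    have uU: "y * u y - U y \<ge> 0" if y: "y \<in> {0..R}" for y
    proof -
      have "0 \<le> Q y * u y ^ 2" using Qn[OF y] by auto
      moreover have "u' y ^ 2 / 2 + Q y * u y ^ 2 / 2 - k * (y * u y - U y) \<le> 0"
        using S[OF y] by (simp add: S_def)
      ultimately have "k * (y * u y - U y) \<ge> 0"
        using zero_le_power2[of "u' y"] by linarith
      then show ?thesis using k False by (simp add: zero_le_mult_iff)
    qed
    define V where "V y = U y / y" for y
    have cV: "continuous_on {0..x} V"
      unfolding continuous_on_def
    proof
      fix y assume y: "y \<in> {0..x}"
      show "(V \<longlongrightarrow> V y) (at y within {0..x})"
      proof (cases "y = 0")
        case False
        have "(U \<longlongrightarrow> U y) (at y within {0..x})"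
          using continuous_on_subset[OF cU, of "{0..x}"] x y by (simp add: continuous_on_def)
        then show ?thesis unfolding V_def using False by (auto intro!: tendsto_intros)
      next
        \<comment> \<open>As \<open>U 0 = 0\<close>, the quotient \<open>U y / y\<close> is a
          difference quotient and tends to \<open>u 0 = 0\<close>. This agrees with the default
          value \<open>V 0 = 0 / 0 = 0\<close>.\<close>
        case True
        have "(U has_real_derivative 0) (at 0 within {0..x})"
          using DERIV_subset[OF dUw[of 0], of "{0..x}"] x R by (simp add: u_def)
        moreover have U0: "U 0 = 0" by (simp add: U_def)
        ultimately have "((\<lambda>y. U y / y) \<longlongrightarrow> 0) (at 0 within {0..x})"
          by (simp add: has_field_derivative_iff)
        moreover have "V = (\<lambda>y. U y / y)" by (simp add: fun_eq_iff V_def)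
        ultimately show ?thesis using True U0 by simp
      qed
    qed
    have "V 0 \<le> V x"
    proof (rule DERIV_nonneg_imp_increasing_open[OF _ _ cV])
      show "\<exists>d. (V has_real_derivative d) (at z) \<and> 0 \<le> d" if "0 < z" "z < x" for z
      proof (intro exI conjI)
        show "(V has_real_derivative (z * u z - U z) / z^2) (at z)"
          unfolding V_def using dU[of z] that x
          by (auto intro!: derivative_eq_intros simp: power2_eq_square)
        show "0 \<le> (z * u z - U z) / z^2" using uU[of z] that x by auto
      qed
    qed (use x in auto)
    then have "U x \<ge> 0" using x by (simp add: V_def U_def zero_le_divide_iff)
    then have "x * u x \<ge> 0" using uU[of x] x by auto
    then show ?thesis using x by (simp add: zero_le_mult_iff)
  qed
  have int: "w1 x \<le> w2 x" if "x \<in> {0<..<R}" for x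
    using key[OF that] that by (simp add: u_def zero_le_mult_iff)
  show ?thesis
  proof (cases "r < R")
    case True
    then show ?thesis using int r by auto
  next
    case False
    then have [simp]: "r = R" using r by (auto simp: R_def)
    have "((\<lambda>x. w2 x - w1 x) \<longlongrightarrow> w2 R - w1 R) (at_left R)"
    proof -
      have "((\<lambda>x. w2 x - w1 x) \<longlongrightarrow> w2 R - w1 R) (at R within {0..R})"
        using continuous_on_diff[OF cw(2) cw(1)] R by (auto simp: continuous_on_def)
      then show ?thesis using R by (simp add: at_within_Icc_at_left)
    qed
    moreover have "\<forall>\<^sub>F x in at_left R. 0 \<le> w2 x - w1 x"
      unfolding eventually_at_left_field using R int by (intro exI[of _ 0]) auto
    ultimately have "0 \<le> w2 R - w1 R"
      by (rule tendsto_lowerbound) simp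
    then show ?thesis by simp
  qed
qed

text \<open>A star with larger \<open>\<kappa>\<close> is pointwise denser, so equality of the total masses forces equality.\<close>
lemma lane_emden_same_mass_ordered:
  assumes LE1: "lane_emden \<kappa>1 c R1 w1 m1" and LE2: "lane_emden \<kappa>2 c R2 w2 m2"
    and \<kappa>: "\<kappa>1 \<le> \<kappa>2" and mass: "m1 R1 = m2 R2"
  shows "R1 = R2 \<and> (\<forall>r\<in>{0..R1}. m1 r = m2 r)"
proof -
  note cmp = lane_emden_comparison[OF LE1 LE2 \<kappa>]
  have R: "R1 > 0" "R2 > 0" and wR: "w1 R1 = 0" "w2 R2 = 0" and m0: "m1 0 = 0" "m2 0 = 0"
    and wp: "\<And>r. r \<in> {0..<R1} \<Longrightarrow> w1 r > 0" "\<And>r. r \<in> {0..<R2} \<Longrightarrow> w2 r > 0"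
    and dm: "\<And>r. r \<in> {0<..<R1} \<Longrightarrow> (m1 has_real_derivative r^2 * w1 r ^ 3) (at r)"
      "\<And>r. r \<in> {0<..<R2} \<Longrightarrow> (m2 has_real_derivative r^2 * w2 r ^ 3) (at r)"
    and cm: "continuous_on {0..R1} m1" "continuous_on {0..R2} m2"
    using LE1 LE2 by (auto simp: lane_emden_def)
  have le: "R1 \<le> R2"
  proof (rule ccontr)
    assume "\<not> R1 \<le> R2"
    then have "w1 R2 > 0" "w1 R2 \<le> 0" using wp(1)[of R2] cmp[of R2] R wR by auto
    then show False by simp
  qed
  have incr: "m2 x - m1 x \<le> m2 y - m1 y" if "0 \<le> x" "x \<le> y" "y \<le> R1" for x y
  proof (rule DERIV_nonneg_imp_increasing_open[OF that(2), where f = "\<lambda>x. m2 x - m1 x"])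
    show "\<exists>d. ((\<lambda>x. m2 x - m1 x) has_real_derivative d) (at z) \<and> 0 \<le> d" if z: "x < z" "z < y" for z
    proof (intro exI conjI)
      show "((\<lambda>x. m2 x - m1 x) has_real_derivative z^2 * w2 z ^ 3 - z^2 * w1 z ^ 3) (at z)"
        using dm(1)[of z] dm(2)[of z] z \<open>0 \<le> x\<close> \<open>y \<le> R1\<close> le
        by (auto intro!: derivative_eq_intros)
      have "w1 z ^ 3 \<le> w2 z ^ 3"
        using cmp[of z] wp(1)[of z] z \<open>0 \<le> x\<close> \<open>y \<le> R1\<close> le by (intro power_mono) auto
      then show "0 \<le> z^2 * w2 z ^ 3 - z^2 * w1 z ^ 3" by (simp add: mult_left_mono)
    qed
    show "continuous_on {x..y} (\<lambda>x. m2 x - m1 x)"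
      using continuous_on_subset[OF cm(1), of "{x..y}"] continuous_on_subset[OF cm(2), of "{x..y}"] that le
      by (auto intro!: continuous_on_diff)
  qed
  have strict: "m2 x < m2 y" if "0 \<le> x" "x < y" "y \<le> R2" for x y
  proof (rule DERIV_pos_imp_increasing_open[OF that(2), where f = m2])
    show "\<exists>d. (m2 has_real_derivative d) (at z) \<and> 0 < d" if z: "x < z" "z < y" for z
      using dm(2)[of z] wp(2)[of z] z that \<open>0 \<le> x\<close> \<open>y \<le> R2\<close> by (intro exI[of _ "z^2 * w2 z ^ 3"]) auto
    show "continuous_on {x..y} m2"
      using cm(2) that by (auto elim: continuous_on_subset)
  qed
  have "R1 = R2"
  proof (rule ccontr)
    assume "R1 \<noteq> R2"
    then have "m2 R1 < m2 R2" using strict[of R1 R2] le R by auto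
    then show False using incr[of 0 R1] R m0 mass by auto
  qed
  \<comment> \<open>\<open>m2 - m1\<close> is nondecreasing and vanishes at both ends.\<close>
  moreover have "m1 r = m2 r" if "r \<in> {0..R1}" for r
    using incr[of 0 r] incr[of r R1] that R m0 mass \<open>R1 = R2\<close> by auto
  ultimately show ?thesis by blast
qed

lemma lane_emden_same_mass:
  assumes LE1: "lane_emden \<kappa>1 c R1 w1 m1" and LE2: "lane_emden \<kappa>2 c R2 w2 m2"
    and mass: "m1 R1 = m2 R2"
  shows "R1 = R2" and "r \<in> {0..R1} \<Longrightarrow> m1 r = m2 r"
proof -
  have "R1 = R2 \<and> (\<forall>r\<in>{0..R1}. m1 r = m2 r)"
  proof (cases "\<kappa>1 \<le> \<kappa>2")
    case True
    then show ?thesis using lane_emden_same_mass_ordered[OF LE1 LE2] mass by blast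
  next
    case False
    then show ?thesis using lane_emden_same_mass_ordered[OF LE2 LE1] mass by auto
  qed
  then show "R1 = R2" and "r \<in> {0..R1} \<Longrightarrow> m1 r = m2 r" by auto
qed


section \<open>Weak form of the perturbation equation\<close>

text \<open>The weight \<open>g\<close> is kept apart because it will contain \<open>\<rho>\<close>,
  of which only continuity is available up to the boundary. Differentiating within
  \<open>{0..}\<close> includes the initial time.\<close>

lemma param_integral_DERIV:
  fixes f f' :: "real \<Rightarrow> real \<Rightarrow> real"
  assumes D: "\<And>x s. x \<in> {0..R} \<Longrightarrow> s \<ge> 0 \<Longrightarrow> ((\<lambda>\<sigma>. f x \<sigma>) has_real_derivative f' x s) (at s)"
    and g: "continuous_on {0..R} g"
    and cf: "continuous_on ({0..} \<times> {0..R}) (\<lambda>z. f (snd z) (fst z))"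
    and cf': "continuous_on ({0..} \<times> {0..R}) (\<lambda>z. f' (snd z) (fst z))"
    and s: "s \<ge> 0"
  shows "((\<lambda>s. integral {0..R} (\<lambda>x. g x * f x s)) has_real_derivative
           integral {0..R} (\<lambda>x. g x * f' x s)) (at s within {0..})"
proof -
  have g2: "continuous_on ({0..} \<times> {0..R}) (\<lambda>z. g (snd z))"
    by (rule continuous_on_compose2[OF g]) (auto intro!: continuous_intros)
  have "((\<lambda>s. integral (cbox 0 R) (\<lambda>x. g x * f x s)) has_real_derivative
           integral (cbox 0 R) (\<lambda>x. g x * f' x s)) (at s within {0..})"
  proof (rule leibniz_rule_field_derivative)
    show "((\<lambda>s. g x * f x s) has_real_derivative g x * f' x s) (at s within {0..})"
      if "s \<in> {0..}" "x \<in> cbox 0 R" for s x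
      using D[of x s] that
      by (intro DERIV_cmult has_field_derivative_at_within[where s = "{0..}"]) auto
    show "(\<lambda>x. g x * f x s) integrable_on cbox 0 R" if "s \<in> {0..}" for s
    proof -
      have "continuous_on {0..R} (\<lambda>x. f x s)"
      proof -
        have c: "continuous_on {0..R} (\<lambda>x. (s, x))" by (intro continuous_intros)
        have "(\<lambda>x. (s, x)) ` {0..R} \<subseteq> {0..} \<times> {0..R}" using that by auto
        then show ?thesis using continuous_on_compose2[OF cf c] by simp
      qed
      then show ?thesis
        using g by (auto intro!: integrable_continuous_real continuous_intros)
    qed
    show "continuous_on ({0..} \<times> cbox 0 R) (\<lambda>(s, x). g x * f' x s)"
      unfolding split_def using g2 cf' by (auto intro!: continuous_intros)
  qed (use s in auto)
  then show ?thesis by simp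
qed

locale perturbed_star =
  fixes \<mu> \<delta> a0 R0 :: real and \<rho> :: "real \<Rightarrow> real" and \<phi> :: "real \<Rightarrow> real \<Rightarrow> real"
  assumes mu_pos: "\<mu> > 0" and delta_neg: "\<delta> < 0" and a0_pos: "a0 > 0" and R0_pos: "R0 > 0"
    and rho_cont: "continuous_on {0..R0} \<rho>"
    and rho_0: "\<rho> 0 = 1"
    and rho_pos: "\<forall>y\<in>{0..<R0}. \<rho> y > 0"
    and rho_R0: "\<rho> R0 = 0"
    and rho_C2: "\<forall>y\<in>{0<..<R0}. (\<lambda>z. \<rho> z powr (1/3)) differentiable (at y)
                   \<and> deriv (\<lambda>z. \<rho> z powr (1/3)) differentiable (at y)"
    and rho_ode: "\<forall>y\<in>{0<..<R0}.
                    deriv (deriv (\<lambda>z. \<rho> z powr (1/3))) y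
                    + 2 / y * deriv (\<lambda>z. \<rho> z powr (1/3)) y + 1/4 * \<rho> y + 3/4 * \<delta> = 0"
    and phi_smooth: "\<exists>U. {0..R0} \<times> {0..} \<subseteq> U \<and> smooth2_on U (\<lambda>(x, s). \<phi> x s)"
    and phi_gt: "\<forall>x\<in>{0..R0}. \<forall>s\<ge>0. \<phi> x s > -1"
    and jac_pos: "\<forall>x\<in>{0..R0}. \<forall>s\<ge>0. 1 + \<phi> x s + x * pdx \<phi> x s > 0"
    and eqn: "\<forall>x\<in>{0<..<R0}. \<forall>s>0. pert_lhs a0 \<delta> \<rho> \<phi> x s = pert_rhs \<mu> a0 \<delta> \<phi> x s"
    and bc: "\<forall>s\<ge>0. Bbar \<mu> \<phi> R0 s = 0"
begin

section \<open>Kinematic quantities and their regularity\<close>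

definition "b = sqrt (2 * \<bar>\<delta>\<bar>)"
definition "\<eta> x s = 1 + \<phi> x s"
definition "\<eta>x = pdx \<phi>"
definition "\<eta>s = pds \<phi>"
definition "\<eta>xs = pdx (pds \<phi>)"
definition "\<eta>ss = pds (pds \<phi>)"
text \<open>\<open>x * \<eta>\<close> is the Eulerian radius divided by the expansion factor,
  \<open>j\<close> is its derivative in \<open>x\<close>, and \<open>q\<close> is the local volume
  ratio, so \<open>\<rho> / q\<close> is the rescaled density. \<open>qs\<close> is the time
  derivative of \<open>q\<close>.\<close>

definition "j x s = \<eta> x s + x * \<eta>x x s"
definition "q x s = \<eta> x s ^ 2 * j x s"
definition "qs x s = 2 * \<eta> x s * \<eta>s x s * j x s + \<eta> x s ^ 2 * (\<eta>s x s + x * \<eta>xs x s)"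
definition "w x = \<rho> x powr (1/3)"
definition "B = Bbar \<mu> \<phi>"
definition "A s = a0 powr (5/2) * exp (5/2 * b * s)"

text \<open>Time comes first in the pair, which is the order of parameter and integration variable
  in the Leibniz rule.\<close>

definition cont2 :: "(real \<Rightarrow> real \<Rightarrow> real) \<Rightarrow> bool" where
  "cont2 f \<longleftrightarrow> continuous_on ({0..} \<times> {0..R0}) (\<lambda>z. f (snd z) (fst z))"

lemma b_pos: "b > 0" and b_sq: "b * b = - 2 * \<delta>"
  using delta_neg by (auto simp: b_def)

lemma smooth_phi:
  obtains U where "{0..R0} \<times> {0..} \<subseteq> U" "smooth2_on U (\<lambda>(x, s). \<phi> x s)"
  using phi_smooth by blast

lemma smooth_cont2:
  assumes "{0..R0} \<times> {0..} \<subseteq> U" "smooth2_on U (\<lambda>(x, s). f x s)"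
  shows "cont2 f"
proof -
  have "continuous_on ({0..} \<times> {0..R0}) ((\<lambda>(x, s). f x s) \<circ> (\<lambda>z. (snd z, fst z)))"
    using assms(1) by (intro continuous_on_compose continuous_on_subset[OF smooth2_on_continuous[OF assms(2)]])
      (auto intro!: continuous_intros)
  then show ?thesis by (simp add: cont2_def o_def)
qed

lemma cont2_base: "cont2 \<eta>" "cont2 \<eta>x" "cont2 \<eta>s" "cont2 \<eta>xs" "cont2 \<eta>ss"
proof -
  obtain U where U: "{0..R0} \<times> {0..} \<subseteq> U" "smooth2_on U (\<lambda>(x, s). \<phi> x s)" by (rule smooth_phi)
  note s1 = smooth2_on_partials[OF U(2)]
  note s2 = smooth2_on_partials[OF s1(2)]
  show "cont2 \<eta>"
    using smooth_cont2[OF U] by (auto simp: cont2_def \<eta>_def intro!: continuous_intros)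
  show "cont2 \<eta>x" "cont2 \<eta>s" "cont2 \<eta>xs" "cont2 \<eta>ss"
    unfolding \<eta>x_def \<eta>s_def \<eta>xs_def \<eta>ss_def
    by (rule smooth_cont2[OF U(1)], rule s1 s2)+
qed

lemmas c\<eta> [continuous_intros] = cont2_base[unfolded cont2_def]

lemma cont2_j: "cont2 j" and cont2_q: "cont2 q" and cont2_qs: "cont2 qs"
  unfolding cont2_def j_def q_def qs_def by (intro continuous_intros)+

lemmas cj [continuous_intros] = cont2_j[unfolded cont2_def] cont2_q[unfolded cont2_def] cont2_qs[unfolded cont2_def]

lemma \<eta>_pos: "x \<in> {0..R0} \<Longrightarrow> s \<ge> 0 \<Longrightarrow> \<eta> x s > 0"
  using phi_gt by (fastforce simp: \<eta>_def)

lemma j_pos: "x \<in> {0..R0} \<Longrightarrow> s \<ge> 0 \<Longrightarrow> j x s > 0"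
  using jac_pos by (simp add: j_def \<eta>_def \<eta>x_def)

lemma q_pos: "x \<in> {0..R0} \<Longrightarrow> s \<ge> 0 \<Longrightarrow> q x s > 0"
  using \<eta>_pos[of x s] j_pos[of x s] by (simp add: q_def)

lemma cont2_slice:
  assumes "cont2 f" "s \<ge> 0"
  shows "continuous_on {0..R0} (\<lambda>x. f x s)"
proof -
  have c: "continuous_on {0..R0} (\<lambda>x. (s, x))" by (intro continuous_intros)
  have "(\<lambda>x. (s, x)) ` {0..R0} \<subseteq> {0..} \<times> {0..R0}" using assms(2) by auto
  then show ?thesis using continuous_on_compose2[OF assms(1)[unfolded cont2_def] c] by simp
qed

lemma cont2_slice_time:
  assumes "cont2 f" "x \<in> {0..R0}"
  shows "continuous_on {0..} (\<lambda>s. f x s)"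
proof -
  have c: "continuous_on {0..} (\<lambda>s. (s, x))" by (intro continuous_intros)
  have "(\<lambda>s. (s, x)) ` {0..} \<subseteq> {0..} \<times> {0..R0}" using assms(2) by auto
  then show ?thesis using continuous_on_compose2[OF assms(1)[unfolded cont2_def] c] by simp
qed

lemma partials:
  assumes "x \<in> {0..R0}" "s \<ge> 0"
  shows "((\<lambda>y. \<eta> y s) has_real_derivative \<eta>x x s) (at x)"
    and "((\<lambda>\<sigma>. \<eta> x \<sigma>) has_real_derivative \<eta>s x s) (at s)"
    and "((\<lambda>y. \<eta>s y s) has_real_derivative \<eta>xs x s) (at x)"
    and "((\<lambda>\<sigma>. \<eta>s x \<sigma>) has_real_derivative \<eta>ss x s) (at s)"
    and "((\<lambda>\<sigma>. \<eta>x x \<sigma>) has_real_derivative \<eta>xs x s) (at s)"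
    and "((\<lambda>y. \<eta>x y s) has_real_derivative pdx \<eta>x x s) (at x)"
    and "((\<lambda>y. \<eta>xs y s) has_real_derivative pdx \<eta>xs x s) (at x)"
proof -
  obtain U where U: "{0..R0} \<times> {0..} \<subseteq> U" "smooth2_on U (\<lambda>(x, s). \<phi> x s)" by (rule smooth_phi)
  have xs: "(x, s) \<in> U" using U(1) assms by auto
  note s1 = smooth2_on_partials[OF U(2)]
  note s2 = smooth2_on_partials[OF s1(2)]
  note p0 = smooth2_partial_derivatives[OF U(2) xs]
  show "((\<lambda>y. \<eta> y s) has_real_derivative \<eta>x x s) (at x)"
    "((\<lambda>\<sigma>. \<eta> x \<sigma>) has_real_derivative \<eta>s x s) (at s)"
    unfolding \<eta>_def \<eta>x_def \<eta>s_def using DERIV_add[OF DERIV_const p0(1)] DERIV_add[OF DERIV_const p0(2)]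
    by simp_all
  show "((\<lambda>y. \<eta>s y s) has_real_derivative \<eta>xs x s) (at x)"
    "((\<lambda>\<sigma>. \<eta>s x \<sigma>) has_real_derivative \<eta>ss x s) (at s)"
    unfolding \<eta>s_def \<eta>xs_def \<eta>ss_def by (rule smooth2_partial_derivatives[OF s1(2) xs])+
  show "((\<lambda>\<sigma>. \<eta>x x \<sigma>) has_real_derivative \<eta>xs x s) (at s)"
    using smooth2_partial_derivatives(2)[OF s1(1) xs] smooth2_mixed_partials[OF U(2,1) R0_pos assms]
    by (simp add: \<eta>x_def \<eta>xs_def)
  show "((\<lambda>y. \<eta>x y s) has_real_derivative pdx \<eta>x x s) (at x)"
    unfolding \<eta>x_def by (rule smooth2_partial_derivatives(1)[OF s1(1) xs])
  show "((\<lambda>y. \<eta>xs y s) has_real_derivative pdx \<eta>xs x s) (at x)"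
    unfolding \<eta>xs_def by (rule smooth2_partial_derivatives(1)[OF s2(1) xs])
qed

lemma rho_nonneg: "x \<in> {0..R0} \<Longrightarrow> \<rho> x \<ge> 0"
  using rho_pos rho_R0 by (cases "x = R0") (auto simp: less_imp_le)

lemma rho_w: "x \<in> {0..R0} \<Longrightarrow> \<rho> x = w x ^ 3"
  using rho_nonneg[of x] by (cases "\<rho> x = 0") (auto simp: w_def powr_powr simp flip: powr_numeral)

lemma rho_w4: "x \<in> {0..R0} \<Longrightarrow> \<rho> x powr (4/3) = w x ^ 4"
  using rho_nonneg[of x] by (cases "\<rho> x = 0") (auto simp: w_def powr_powr simp flip: powr_numeral)

lemma w_pos: "x \<in> {0..<R0} \<Longrightarrow> w x > 0"
  using rho_pos by (force simp: w_def)

lemma w_0: "w 0 = 1" and w_R0: "w R0 = 0"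
  by (auto simp: w_def rho_0 rho_R0)

lemma w_nonneg: "w x \<ge> 0"
  by (simp add: w_def)

lemma w_cont: "continuous_on {0..R0} w"
  unfolding w_def using rho_cont rho_nonneg by (intro continuous_on_powr') (auto intro!: continuous_intros)

lemma w_DERIV: "x \<in> {0<..<R0} \<Longrightarrow> (w has_real_derivative deriv w x) (at x)"
  using rho_C2 unfolding w_def[abs_def] by (simp add: DERIV_deriv_iff_real_differentiable)

lemma B_eq: "B x s = 4/3 * \<mu> * ((\<eta>s x s + x * \<eta>xs x s) / j x s - \<eta>s x s / \<eta> x s)"
  by (simp add: B_def Bbar_def j_def \<eta>_def \<eta>x_def \<eta>s_def \<eta>xs_def)

text \<open>Over a common denominator \<open>B\<close> is a multiple of \<open>x\<close> times the
  \<open>x\<close>-derivative of \<open>\<eta>s / \<eta>\<close>. This makes the viscous power a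
  square, and makes vanishing stress mean that \<open>\<eta>s / \<eta>\<close> is constant in
  space.\<close>

lemma B_eq':
  assumes "x \<in> {0..R0}" "s \<ge> 0"
  shows "3 * B x s * (\<eta> x s * j x s) = 4 * \<mu> * x * (\<eta>xs x s * \<eta> x s - \<eta>s x s * \<eta>x x s)"
  using \<eta>_pos[OF assms] j_pos[OF assms]
  by (simp add: B_eq field_simps) (simp add: j_def algebra_simps)

lemma cont2_B: "cont2 B"
  unfolding cont2_def B_eq
  by (intro continuous_intros) (use \<eta>_pos j_pos in \<open>force\<close>)+

lemma pressure_eq:
  assumes "x \<in> {0..R0}" "s \<ge> 0"
  shows "(\<rho> x / q x s) powr (4/3) = w x ^ 4 * q x s powr (-4/3)"
  using q_pos[OF assms] rho_nonneg[of x] assms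
  by (simp add: powr_divide rho_w4 powr_minus_divide)

lemma q_powr_DERIV:
  assumes "x \<in> {0..R0}" "s \<ge> 0"
  shows "((\<lambda>\<sigma>. q x \<sigma> powr a) has_real_derivative a * q x s powr (a - 1) * qs x s) (at s)"
proof -
  have "((\<lambda>\<sigma>. q x \<sigma>) has_real_derivative qs x s) (at s)"
    unfolding q_def j_def qs_def
    by (auto intro!: derivative_eq_intros partials[OF assms] simp: algebra_simps)
  from DERIV_powr[OF this q_pos[OF assms] DERIV_const[of a]] show ?thesis
    using q_pos[OF assms] by (simp add: powr_diff field_simps)
qed

lemma cont2_q_powr: "continuous_on ({0..} \<times> {0..R0}) (\<lambda>z. q (snd z) (fst z) powr a)"
  by (intro continuous_on_powr continuous_intros) (use q_pos in force)

text \<open>The equation is solved for the pressure gradient. The three derivatives enter as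
  hypotheses, which ties each \<open>deriv\<close> in the equation to a genuine derivative.\<close>

lemma eqn':
  assumes x: "x \<in> {0<..<R0}" and s: "s > 0"
    and dP: "((\<lambda>y. (\<rho> y / q y s) powr (4/3)) has_real_derivative P') (at x)"
    and dp: "((\<lambda>y. \<rho> y powr (4/3)) has_real_derivative p') (at x)"
    and dB: "((\<lambda>y. B y s) has_real_derivative B') (at x)"
  shows "P' = - (1 / \<eta> x s ^ 2) * (x * \<rho> x * \<eta>ss x s + b / 2 * x * \<rho> x * \<eta>s x s)
     - (1 / \<eta> x s ^ 4 - 1 / \<eta> x s) * \<bar>\<delta>\<bar> * x * \<rho> x + p' / \<eta> x s ^ 4
     + A s * (B' + 4 * \<mu> * ((\<eta>xs x s * \<eta> x s - \<eta>s x s * \<eta>x x s) / \<eta> x s ^ 2))"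
proof -
  have xs: "x \<in> {0..R0}" "s \<ge> 0" using x s by auto
  have e: "pert_lhs a0 \<delta> \<rho> \<phi> x s = pert_rhs \<mu> a0 \<delta> \<phi> x s" using eqn x s by blast
  have "((\<lambda>y. \<eta>s y s / \<eta> y s) has_real_derivative
      (\<eta>xs x s * \<eta> x s - \<eta>s x s * \<eta>x x s) / \<eta> x s ^ 2) (at x)"
    using \<eta>_pos[OF xs]
    by (auto intro!: derivative_eq_intros partials[OF xs] simp: power2_eq_square)
  then have 1: "deriv (\<lambda>y. pds \<phi> y s / (1 + \<phi> y s)) x = (\<eta>xs x s * \<eta> x s - \<eta>s x s * \<eta>x x s) / \<eta> x s ^ 2"
    by (intro DERIV_imp_deriv) (simp add: \<eta>s_def \<eta>_def)
  have 2: "deriv (\<lambda>y. (\<rho> y / ((1 + \<phi> y s)^2 * (1 + \<phi> y s + y * pdx \<phi> y s))) powr (4/3)) x = P'"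
    using DERIV_imp_deriv[OF dP] by (simp add: q_def j_def \<eta>_def \<eta>x_def)
  have 3: "deriv (\<lambda>y. Bbar \<mu> \<phi> y s) x = B'"
    using DERIV_imp_deriv[OF dB] by (simp add: B_def)
  show ?thesis
    using e unfolding pert_lhs_def pert_rhs_def 1 2 3 DERIV_imp_deriv[OF dp]
    by (simp add: A_def b_def \<eta>_def \<eta>s_def \<eta>x_def \<eta>xs_def \<eta>ss_def) 
qed

text \<open>\<open>deriv\<close> carries information only at points of differentiability. No
  formulas for \<open>P'\<close> and \<open>B'\<close> are needed: \<open>P'\<close> is supplied by
  the equation, and \<open>B'\<close> either cancels in the weak form or is zero.\<close>

lemma spatial_DERIVs:
  assumes x: "x \<in> {0<..<R0}" and s: "s \<ge> 0"
  obtains P' B' where "((\<lambda>y. (\<rho> y / q y s) powr (4/3)) has_real_derivative P') (at x)"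
    "((\<lambda>y. \<rho> y powr (4/3)) has_real_derivative 4 * w x ^ 3 * deriv w x) (at x)"
    "((\<lambda>y. B y s) has_real_derivative B') (at x)"
proof -
  have xs: "x \<in> {0..R0}" "s \<ge> 0" using x s by auto
  note d [derivative_intros] = partials[OF xs]
  have dp: "((\<lambda>y. \<rho> y powr (4/3)) has_real_derivative 4 * w x ^ 3 * deriv w x) (at x)"
  proof (rule has_field_derivative_transform_within_open[OF _ open_greaterThanLessThan x])
    show "((\<lambda>y. w y ^ 4) has_real_derivative 4 * w x ^ 3 * deriv w x) (at x)"
      using w_DERIV[OF x] by (auto intro!: derivative_eq_intros)
  qed (use rho_w4 in auto)
  have dq: "\<exists>D. ((\<lambda>y. q y s) has_real_derivative D) (at x)"
    unfolding q_def j_def by (rule exI) (rule derivative_intros d)+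
  then obtain D where D: "((\<lambda>y. q y s) has_real_derivative D) (at x)" by blast
  have dP: "\<exists>P'. ((\<lambda>y. (\<rho> y / q y s) powr (4/3)) has_real_derivative P') (at x)"
  proof (rule exI, rule has_field_derivative_transform_within_open)
    show "((\<lambda>y. w y ^ 4 * q y s powr (-4/3)) has_real_derivative
      4 * w x ^ 3 * deriv w x * q x s powr (-4/3)
        + q x s powr (-4/3) * (0 * ln (q x s) + D * (-4/3) / q x s) * w x ^ 4) (at x)"
      by (intro DERIV_mult DERIV_powr D q_pos[OF xs] DERIV_const)
        (use w_DERIV[OF x] in \<open>auto intro!: derivative_eq_intros\<close>)
    show "open {0<..<R0}" "x \<in> {0<..<R0}" using x by auto
    show "\<And>y. y \<in> {0<..<R0} \<Longrightarrow> w y ^ 4 * q y s powr (-4/3) = (\<rho> y / q y s) powr (4/3)"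
      using pressure_eq s by simp
  qed
  have dB: "\<exists>B'. ((\<lambda>y. B y s) has_real_derivative B') (at x)"
  proof -
    have n: "((\<lambda>y. \<eta>s y s + y * \<eta>xs y s) has_real_derivative
        \<eta>xs x s + (1 * \<eta>xs x s + pdx \<eta>xs x s * x)) (at x)"
      by (intro DERIV_add DERIV_mult DERIV_ident d)
    have dj: "((\<lambda>y. j y s) has_real_derivative \<eta>x x s + (1 * \<eta>x x s + pdx \<eta>x x s * x)) (at x)"
      unfolding j_def by (intro DERIV_add DERIV_mult DERIV_ident d)
    show ?thesis
      unfolding B_eq
      using DERIV_cmult[OF DERIV_diff[OF DERIV_divide[OF n dj] DERIV_divide[OF d(3) d(1)]], of "4/3 * \<mu>"]
        \<eta>_pos[OF xs] j_pos[OF xs] by auto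
  qed
  show ?thesis using that dp dP dB by blast
qed

text \<open>Since \<open>3 B (\<eta> + x \<eta>\<^sub>x) / (x \<eta>) = 4 \<mu> (\<eta>\<^sub>s / \<eta>)\<^sub>x\<close>, the viscous term tested with \<open>\<zeta>\<close> is
  \<open>x\<^sup>3 \<eta>\<^sup>2 \<zeta> (B\<^sub>x + 4 \<mu> (\<eta>\<^sub>s / \<eta>)\<^sub>x) = (\<zeta> / \<eta>) (x\<^sup>3 \<eta>\<^sup>3 B)\<^sub>x\<close>, which only produces \<open>(\<zeta> / \<eta>)\<^sub>x\<close> on integration by parts.\<close>
lemma weak_form:
  assumes s: "s > 0" and c\<zeta>: "continuous_on {0..R0} \<zeta>"
    and d\<zeta>: "\<And>x. x \<in> {0<..<R0} \<Longrightarrow> (\<zeta> has_real_derivative \<zeta>' x) (at x)"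
  shows "((\<lambda>x. - (x^4 * \<rho> x) * (\<zeta> x * (\<eta>ss x s + b / 2 * \<eta>s x s))
      + \<bar>\<delta>\<bar> * ((x^4 * \<rho> x) * (\<zeta> x * (\<eta> x s - 1 / \<eta> x s ^ 2)))
      + (x^2 * \<rho> x powr (4/3)) * (q x s powr (-4/3) * (2 * \<eta> x s * \<zeta> x * j x s + \<eta> x s ^ 2 * (\<zeta> x + x * \<zeta>' x))
          - (3 * \<zeta> x / \<eta> x s ^ 2 + x * \<zeta>' x / \<eta> x s ^ 2 - 2 * x * \<zeta> x * \<eta>x x s / \<eta> x s ^ 3))
      + A s * (x^3 * B x s * \<eta> x s * (\<zeta> x * \<eta>x x s - \<eta> x s * \<zeta>' x))) has_integral 0) {0..R0}"
    (is "(?f has_integral 0) _")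
proof -
  \<comment> \<open>\<open>F\<close> collects everything that is a spatial derivative. It vanishes
    at \<open>0\<close> through \<open>x^3\<close>, and at \<open>R0\<close> because
    \<open>\<rho>\<close> and, by the boundary condition, \<open>B\<close> vanish there.\<close>
  define F where "F x = x^3 * \<eta> x s ^ 2 * \<zeta> x * (\<rho> x / q x s) powr (4/3)
    - x^3 * \<zeta> x / \<eta> x s ^ 2 * \<rho> x powr (4/3) - A s * (x^3 * \<eta> x s ^ 2 * \<zeta> x * B x s)" for x
  have s0: "s \<ge> 0" using s by simp
  note cs [continuous_intros] = cont2_slice[OF cont2_base(1) s0] cont2_slice[OF cont2_q s0]
    cont2_slice[OF cont2_B s0]
  have "(?f has_integral F R0 - F 0) {0..R0}"
  proof (rule fundamental_theorem_of_calculus_interior)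
    show "0 \<le> R0" using R0_pos by simp
    have cp: "continuous_on {0..R0} (\<lambda>x. \<rho> x powr (4/3))"
      using rho_cont rho_nonneg by (intro continuous_on_powr') (auto intro!: continuous_intros)
    have cP: "continuous_on {0..R0} (\<lambda>x. (\<rho> x / q x s) powr (4/3))"
      using rho_cont rho_nonneg q_pos[OF _ s0]
      by (intro continuous_on_powr' continuous_on_divide cs continuous_on_const) (force simp: less_imp_le)+
    show "continuous_on {0..R0} F"
      unfolding F_def by (intro continuous_intros cp cP c\<zeta>) (use \<eta>_pos[OF _ s0] in force)
    fix x assume x: "x \<in> {0<..<R0}"
    then have xs: "x \<in> {0..R0}" by auto
    obtain P' B' where dP: "((\<lambda>y. (\<rho> y / q y s) powr (4/3)) has_real_derivative P') (at x)"
      and dp: "((\<lambda>y. \<rho> y powr (4/3)) has_real_derivative 4 * w x ^ 3 * deriv w x) (at x)"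
      and dB: "((\<lambda>y. B y s) has_real_derivative B') (at x)"
      using spatial_DERIVs[OF x s0] .
    define p' where "p' = 4 * w x ^ 3 * deriv w x"
    note dp = dp[folded p'_def]
    note P' = eqn'[OF x s dP dp dB]
    have e: "\<eta> x s > 0" "j x s > 0" using \<eta>_pos[OF xs s0] j_pos[OF xs s0] by auto
    have "(F has_real_derivative
       (3 * x^2 * \<eta> x s ^ 2 * \<zeta> x + 2 * x^3 * \<eta> x s * \<eta>x x s * \<zeta> x + x^3 * \<eta> x s ^ 2 * \<zeta>' x) * (\<rho> x / q x s) powr (4/3)
       + x^3 * \<eta> x s ^ 2 * \<zeta> x * P'
       - ((3 * x^2 * \<zeta> x + x^3 * \<zeta>' x) / \<eta> x s ^ 2 - 2 * x^3 * \<zeta> x * \<eta>x x s / \<eta> x s ^ 3) * \<rho> x powr (4/3)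
       - x^3 * \<zeta> x / \<eta> x s ^ 2 * p'
       - A s * ((3 * x^2 * \<eta> x s ^ 2 * \<zeta> x + 2 * x^3 * \<eta> x s * \<eta>x x s * \<zeta> x + x^3 * \<eta> x s ^ 2 * \<zeta>' x) * B x s
          + x^3 * \<eta> x s ^ 2 * \<zeta> x * B')) (at x)" (is "(F has_real_derivative ?D) _")
    proof -
      have d1: "((\<lambda>x. x^3 * \<eta> x s ^ 2 * \<zeta> x) has_real_derivative
        3 * x^2 * \<eta> x s ^ 2 * \<zeta> x + 2 * x^3 * \<eta> x s * \<eta>x x s * \<zeta> x + x^3 * \<eta> x s ^ 2 * \<zeta>' x) (at x)"
        by (auto intro!: derivative_eq_intros partials(1)[OF xs s0] d\<zeta>[OF x] simp: algebra_simps)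
      have d2: "((\<lambda>x. x^3 * \<zeta> x / \<eta> x s ^ 2) has_real_derivative
        (3 * x^2 * \<zeta> x + x^3 * \<zeta>' x) / \<eta> x s ^ 2 - 2 * x^3 * \<zeta> x * \<eta>x x s / \<eta> x s ^ 3) (at x)"
        using e by (auto intro!: derivative_eq_intros partials(1)[OF xs s0] d\<zeta>[OF x]
            simp: field_simps power2_eq_square power3_eq_cube)
      show ?thesis unfolding F_def
        using DERIV_diff[OF DERIV_diff[OF DERIV_mult[OF d1 dP] DERIV_mult[OF d2 dp]]
            DERIV_cmult[OF DERIV_mult[OF d1 dB], of "A s"]]
        by (rule DERIV_cong) (simp add: algebra_simps)
    qed
    moreover have "?D = ?f x"
    proof -
      define Bq where "Bq = B x s"
      have Bx: "4 * \<mu> * x * (\<eta>xs x s * \<eta> x s - \<eta>s x s * \<eta>x x s) = 3 * Bq * (\<eta> x s * j x s)"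
        using B_eq'[OF xs s0] by (simp add: Bq_def)
      have P1: "(\<rho> x / q x s) powr (4/3) = \<rho> x powr (4/3) * q x s powr (-4/3)"
        using pressure_eq[OF xs s0] rho_w4[OF xs] by simp
      have v: "x^3 * \<eta> x s ^ 2 * \<zeta> x * (4 * \<mu> * ((\<eta>xs x s * \<eta> x s - \<eta>s x s * \<eta>x x s) / \<eta> x s ^ 2))
        = 3 * x^2 * \<zeta> x * \<eta> x s * j x s * Bq"
      proof -
        have "x^3 * \<eta> x s ^ 2 * \<zeta> x * (4 * \<mu> * ((\<eta>xs x s * \<eta> x s - \<eta>s x s * \<eta>x x s) / \<eta> x s ^ 2))
          = x^2 * \<zeta> x * (4 * \<mu> * x * (\<eta>xs x s * \<eta> x s - \<eta>s x s * \<eta>x x s))"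
          using e by (simp add: field_simps power2_eq_square power3_eq_cube)
        then show ?thesis unfolding Bx by simp
      qed
      define G where "G = 3 * x^2 * \<eta> x s ^ 2 * \<zeta> x + 2 * x^3 * \<eta> x s * \<eta>x x s * \<zeta> x + x^3 * \<eta> x s ^ 2 * \<zeta>' x"
      define H where "H = (3 * x^2 * \<zeta> x + x^3 * \<zeta>' x) / \<eta> x s ^ 2 - 2 * x^3 * \<zeta> x * \<eta>x x s / \<eta> x s ^ 3"
      define C where "C = x^3 * \<zeta> x / \<eta> x s ^ 2 * p'"
      define V where "V = 4 * \<mu> * ((\<eta>xs x s * \<eta> x s - \<eta>s x s * \<eta>x x s) / \<eta> x s ^ 2)"
      have T: "x^3 * \<eta> x s ^ 2 * \<zeta> x * P' = - (x^4 * \<rho> x) * (\<zeta> x * (\<eta>ss x s + b / 2 * \<eta>s x s))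
        + \<bar>\<delta>\<bar> * ((x^4 * \<rho> x) * (\<zeta> x * (\<eta> x s - 1 / \<eta> x s ^ 2))) + C
        + A s * (x^3 * \<eta> x s ^ 2 * \<zeta> x * B' + 3 * x^2 * \<zeta> x * \<eta> x s * j x s * Bq)"
        unfolding v[symmetric] C_def P' V_def[symmetric] using e
        by (simp add: field_simps power2_eq_square power3_eq_cube power4_eq_xxxx)
      have E1: "G = x^2 * (2 * \<eta> x s * \<zeta> x * j x s + \<eta> x s ^ 2 * (\<zeta> x + x * \<zeta>' x))"
        by (simp add: G_def j_def algebra_simps power2_eq_square power3_eq_cube)
      have E2: "H = x^2 * (3 * \<zeta> x / \<eta> x s ^ 2 + x * \<zeta>' x / \<eta> x s ^ 2 - 2 * x * \<zeta> x * \<eta>x x s / \<eta> x s ^ 3)"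
        using e by (simp add: H_def field_simps power2_eq_square power3_eq_cube)
      have E3: "3 * x^2 * \<zeta> x * \<eta> x s * j x s * Bq - G * Bq
          = x^3 * Bq * \<eta> x s * (\<zeta> x * \<eta>x x s - \<eta> x s * \<zeta>' x)"
        by (simp add: G_def j_def algebra_simps power2_eq_square power3_eq_cube)
      have "?D = G * (\<rho> x powr (4/3) * q x s powr (-4/3)) + x^3 * \<eta> x s ^ 2 * \<zeta> x * P' - H * \<rho> x powr (4/3)
          - C - A s * (G * Bq + x^3 * \<eta> x s ^ 2 * \<zeta> x * B')"
        unfolding P1 Bq_def[symmetric] G_def[symmetric] H_def[symmetric] C_def[symmetric] ..
      also have "\<dots> = - (x^4 * \<rho> x) * (\<zeta> x * (\<eta>ss x s + b / 2 * \<eta>s x s))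
        + \<bar>\<delta>\<bar> * ((x^4 * \<rho> x) * (\<zeta> x * (\<eta> x s - 1 / \<eta> x s ^ 2)))
        + (G * q x s powr (-4/3) - H) * \<rho> x powr (4/3)
        + A s * (3 * x^2 * \<zeta> x * \<eta> x s * j x s * Bq - G * Bq)"
        unfolding T by (simp only: algebra_simps)
      also have "\<dots> = ?f x"
        unfolding E3 unfolding E1 E2 Bq_def by (simp only: algebra_simps)
      finally show ?thesis .
    qed
    ultimately show "(F has_vector_derivative ?f x) (at x)"
      by (simp add: has_real_derivative_iff_has_vector_derivative)
  qed
  moreover have "F R0 = 0" using bc s by (simp add: F_def rho_R0 B_def)
  moreover have "F 0 = 0" by (simp add: F_def)
  ultimately show ?thesis by simp
qed

end


section \<open>Energy and virial identities\<close>

context perturbed_star begin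

text \<open>\<open>x^4 * \<rho>\<close> is the mass element \<open>x^2 * \<rho>\<close> times the
  squared label. Up to angular factors and powers of the expansion factor, \<open>N\<close> below is
  therefore the moment of inertia.\<close>

definition mom :: "(real \<Rightarrow> real \<Rightarrow> real) \<Rightarrow> real \<Rightarrow> real" where
  "mom f s = integral {0..R0} (\<lambda>x. (x^4 * \<rho> x) * f x s)"
text \<open>\<open>3 * q powr (-1/3)\<close> is the internal energy for the exponent 4/3; the other
  terms stem from the pressure gradient of the profile. They cancel where
  \<open>\<eta>x = 0\<close>. \<open>pint'\<close> is the time derivative.\<close>

definition "pint x s = 3 * q x s powr (-1/3) - 3 / \<eta> x s + x * \<eta>x x s / \<eta> x s ^ 2"
definition "pint' x s = - (q x s powr (-4/3) * qs x s) + 3 * \<eta>s x s / \<eta> x s ^ 2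
  + (x * \<eta>xs x s / \<eta> x s ^ 2 - 2 * x * \<eta>x x s * \<eta>s x s / \<eta> x s ^ 3)"
definition "PI s = integral {0..R0} (\<lambda>x. (x^2 * \<rho> x powr (4/3)) * pint x s)"
definition "PI' s = integral {0..R0} (\<lambda>x. (x^2 * \<rho> x powr (4/3)) * pint' x s)"
text \<open>The time \<open>0\<close> is a dummy: the integrand does not depend on it.\<close>

definition "M = mom (\<lambda>x s. 1) 0"
definition "N = mom (\<lambda>x s. \<eta> x s ^ 2)"
definition "n = mom (\<lambda>x s. \<eta> x s * \<eta>s x s)"
definition "K = mom (\<lambda>x s. \<eta>s x s ^ 2)"
definition "L = mom (\<lambda>x s. 1 / \<eta> x s)"
definition "diss s = integral {0..R0} (\<lambda>x. x^2 * q x s * B x s ^ 2)"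
text \<open>This is the energy without its factor \<open>1 / alpha_bar\<close>. Since
  \<open>alpha_bar\<close> is a multiple of \<open>exp (b * s)\<close>, the decaying quantity is
  \<open>exp (- b * s) * calE s\<close>.\<close>

definition "calE s = K s / 2 + b * n s + \<bar>\<delta>\<bar> * N s - \<bar>\<delta>\<bar> * L s + PI s"

lemma weight_cont: "continuous_on {0..R0} (\<lambda>x. x^4 * \<rho> x)"
  by (intro continuous_intros rho_cont)

lemma pweight_cont: "continuous_on {0..R0} (\<lambda>x. x^2 * \<rho> x powr (4/3))"
  using rho_cont rho_nonneg
  by (intro continuous_intros continuous_on_powr') auto

lemma weight_nonneg: "x \<in> {0..R0} \<Longrightarrow> x^4 * \<rho> x \<ge> 0"
  using rho_nonneg by simp

lemma cont2_pint: "cont2 pint" "cont2 pint'"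
  unfolding cont2_def pint_def pint'_def
  by (intro continuous_intros cont2_q_powr; use \<eta>_pos in force)+

lemma cont2_mono: "cont2 (\<lambda>x s. 1 / \<eta> x s)" "cont2 (\<lambda>x s. \<eta>s x s / \<eta> x s ^ 2)"
  "cont2 (\<lambda>x s. \<eta> x s ^ 2)" "cont2 (\<lambda>x s. \<eta> x s * \<eta>s x s)" "cont2 (\<lambda>x s. \<eta>s x s ^ 2)"
  "cont2 (\<lambda>x s. \<eta> x s * \<eta>ss x s)" "cont2 (\<lambda>x s. \<eta>s x s * \<eta>ss x s)" "cont2 (\<lambda>x s. c)"
  unfolding cont2_def
  by (intro continuous_intros; use \<eta>_pos in force)+

lemma mom_has_integral:
  assumes "cont2 f" "s \<ge> 0"
  shows "((\<lambda>x. (x^4 * \<rho> x) * f x s) has_integral mom f s) {0..R0}"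
  unfolding mom_def
  by (intro integrable_integral integrable_continuous_real continuous_on_mult[OF weight_cont cont2_slice[OF assms]])

lemma mom_eqI:
  assumes "((\<lambda>x. (x^4 * \<rho> x) * f x s) has_integral I) {0..R0}"
  shows "mom f s = I"
  unfolding mom_def using assms by (rule integral_unique)

lemma mom_add:
  assumes "cont2 f" "cont2 g" "s \<ge> 0"
  shows "mom (\<lambda>x s. f x s + g x s) s = mom f s + mom g s"
  using has_integral_add[OF mom_has_integral[OF assms(1,3)] mom_has_integral[OF assms(2,3)]]
  by (intro mom_eqI) (simp add: algebra_simps)

lemma mom_cmult:
  assumes "cont2 f" "s \<ge> 0"
  shows "mom (\<lambda>x s. c s * f x s) s = c s * mom f s"
  using has_integral_mult_right[OF mom_has_integral[OF assms], of "c s"]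
  by (intro mom_eqI) (simp add: algebra_simps)

lemma mom_mono:
  assumes "cont2 f" "cont2 g" "s \<ge> 0" "\<And>x. x \<in> {0..R0} \<Longrightarrow> f x s \<le> g x s"
  shows "mom f s \<le> mom g s"
  by (rule has_integral_le[OF mom_has_integral[OF assms(1,3)] mom_has_integral[OF assms(2,3)]])
    (intro mult_left_mono assms(4) weight_nonneg)

lemma mom_const: "mom (\<lambda>x s. c s) s = c s * M"
  using mom_cmult[of "\<lambda>x s. 1" s c] by (simp add: M_def mom_def)

lemma mom_DERIV:
  assumes "\<And>x s. x \<in> {0..R0} \<Longrightarrow> s \<ge> 0 \<Longrightarrow> ((\<lambda>\<sigma>. f x \<sigma>) has_real_derivative f' x s) (at s)"
    and "cont2 f" "cont2 f'" "s \<ge> 0"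
  shows "(mom f has_real_derivative mom f' s) (at s within {0..})"
  using param_integral_DERIV[OF assms(1) weight_cont] assms(2-4)
  unfolding mom_def[abs_def] cont2_def by simp

lemma M_pos: "M > 0"
proof -
  have "M \<noteq> 0"
  proof
    assume "M = 0"
    then have "integral {0..R0} (\<lambda>x. x^4 * \<rho> x) = 0" by (simp add: M_def mom_def)
    then have "\<forall>x\<in>{0..R0}. x^4 * \<rho> x = 0"
      using integral_eq_0_iff[OF weight_cont R0_pos weight_nonneg] by blast
    moreover have "R0/2 \<in> {0..R0}" using R0_pos by simp
    ultimately have "(R0/2)^4 * \<rho> (R0/2) = 0" by blast
    then show False using rho_pos[rule_format, of "R0/2"] R0_pos by auto
  qed
  moreover have "M \<ge> 0"
    unfolding M_def mom_def using weight_nonneg by (intro integral_nonneg integrable_continuous_real) (auto intro: weight_cont)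
  ultimately show ?thesis by simp
qed

lemma N_DERIV: "s \<ge> 0 \<Longrightarrow> (N has_real_derivative 2 * n s) (at s within {0..})"
  and n_DERIV: "s \<ge> 0 \<Longrightarrow> (n has_real_derivative K s + mom (\<lambda>x s. \<eta> x s * \<eta>ss x s) s) (at s within {0..})"
  and K_DERIV: "s \<ge> 0 \<Longrightarrow> (K has_real_derivative 2 * mom (\<lambda>x s. \<eta>s x s * \<eta>ss x s) s) (at s within {0..})"
  and L_DERIV: "s \<ge> 0 \<Longrightarrow> (L has_real_derivative - mom (\<lambda>x s. \<eta>s x s / \<eta> x s ^ 2) s) (at s within {0..})"
proof -
  assume s: "s \<ge> 0"
  have "(N has_real_derivative mom (\<lambda>x s. 2 * (\<eta> x s * \<eta>s x s)) s) (at s within {0..})"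
    unfolding N_def using s
    by (intro mom_DERIV cont2_mono) (auto intro!: derivative_eq_intros partials simp: cont2_def continuous_intros)
  then show "(N has_real_derivative 2 * n s) (at s within {0..})"
    using mom_cmult[OF cont2_mono(4) s, of "\<lambda>_. 2"] by (simp add: n_def)
  have "(n has_real_derivative mom (\<lambda>x s. \<eta>s x s ^ 2 + \<eta> x s * \<eta>ss x s) s) (at s within {0..})"
    unfolding n_def using s
    by (intro mom_DERIV cont2_mono)
      (auto intro!: derivative_eq_intros partials simp: cont2_def continuous_intros power2_eq_square)
  then show "(n has_real_derivative K s + mom (\<lambda>x s. \<eta> x s * \<eta>ss x s) s) (at s within {0..})"
    using mom_add[OF cont2_mono(5,6) s] by (simp add: K_def)
  have "(K has_real_derivative mom (\<lambda>x s. 2 * (\<eta>s x s * \<eta>ss x s)) s) (at s within {0..})"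
    unfolding K_def using s
    by (intro mom_DERIV cont2_mono) (auto intro!: derivative_eq_intros partials simp: cont2_def continuous_intros)
  then show "(K has_real_derivative 2 * mom (\<lambda>x s. \<eta>s x s * \<eta>ss x s) s) (at s within {0..})"
    using mom_cmult[OF cont2_mono(7) s, of "\<lambda>_. 2"] by simp
  have "(L has_real_derivative mom (\<lambda>x s. (- 1) * (\<eta>s x s / \<eta> x s ^ 2)) s) (at s within {0..})"
    unfolding L_def
  proof (rule mom_DERIV)
    show "((\<lambda>s. 1 / \<eta> x s) has_real_derivative - 1 * (\<eta>s x s / \<eta> x s ^ 2)) (at s)"
      if "x \<in> {0..R0}" "s \<ge> 0" for x s
      using \<eta>_pos[OF that] by (auto intro!: derivative_eq_intros partials[OF that] simp: power2_eq_square)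
    show "cont2 (\<lambda>x s. (- 1) * (\<eta>s x s / \<eta> x s ^ 2))"
      using continuous_on_minus[OF cont2_mono(2)[unfolded cont2_def]] by (simp add: cont2_def)
  qed (use cont2_mono s in auto)
  then show "(L has_real_derivative - mom (\<lambda>x s. \<eta>s x s / \<eta> x s ^ 2) s) (at s within {0..})"
    using mom_cmult[OF cont2_mono(2) s, of "\<lambda>_. - 1"] by simp
qed

lemma PI_DERIV: "s \<ge> 0 \<Longrightarrow> (PI has_real_derivative PI' s) (at s within {0..})"
  unfolding PI_def[abs_def] PI'_def
proof (rule param_integral_DERIV[OF _ pweight_cont])
  show "((\<lambda>s. pint x s) has_real_derivative pint' x s) (at s)" if xs: "x \<in> {0..R0}" "s \<ge> 0" for x s
  proof -
    have 1: "((\<lambda>s. 3 * q x s powr (-1/3)) has_real_derivative - (q x s powr (-4/3) * qs x s)) (at s)"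
      using DERIV_cmult[OF q_powr_DERIV[OF xs, of "-1/3"], of 3] by simp
    have 2: "((\<lambda>s. 3 / \<eta> x s) has_real_derivative - (3 * \<eta>s x s / \<eta> x s ^ 2)) (at s)"
      using \<eta>_pos[OF xs] by (auto intro!: derivative_eq_intros partials[OF xs] simp: power2_eq_square)
    have 3: "((\<lambda>s. x * \<eta>x x s / \<eta> x s ^ 2) has_real_derivative
        x * \<eta>xs x s / \<eta> x s ^ 2 - 2 * x * \<eta>x x s * \<eta>s x s / \<eta> x s ^ 3) (at s)"
      using \<eta>_pos[OF xs]
      by (auto intro!: derivative_eq_intros partials[OF xs] simp: field_simps power2_eq_square power3_eq_cube)
    show ?thesis
      unfolding pint_def pint'_def using DERIV_add[OF DERIV_diff[OF 1 2] 3] by simp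
  qed
qed (use cont2_pint in \<open>auto simp: cont2_def\<close>)

lemma PI_has_integral: "s \<ge> 0 \<Longrightarrow> ((\<lambda>x. (x^2 * \<rho> x powr (4/3)) * pint x s) has_integral PI s) {0..R0}"
  and PI'_has_integral: "s \<ge> 0 \<Longrightarrow> ((\<lambda>x. (x^2 * \<rho> x powr (4/3)) * pint' x s) has_integral PI' s) {0..R0}"
  unfolding PI_def PI'_def using cont2_slice cont2_pint pweight_cont
  by (auto intro!: integrable_integral integrable_continuous_real continuous_on_mult)

lemma diss_cont: "s \<ge> 0 \<Longrightarrow> continuous_on {0..R0} (\<lambda>x. x^2 * q x s * B x s ^ 2)"
  using cont2_slice[OF cont2_q] cont2_slice[OF cont2_B] by (intro continuous_intros) auto

lemma diss_nonneg: "s \<ge> 0 \<Longrightarrow> diss s \<ge> 0"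
  unfolding diss_def using diss_cont[of s] q_pos
  by (intro integral_nonneg integrable_continuous_real) (auto simp: less_imp_le)

text \<open>For the test function \<open>\<eta>\<close> the quotient \<open>\<zeta> / \<eta>\<close>
  is constant, which removes the viscosity. The variation of the volume becomes
  \<open>3 * q\<close>, and since the internal energy is homogeneous of degree \<open>-1\<close> in
  \<open>\<eta>\<close>, the pressure term is \<open>PI\<close> itself.\<close>

lemma virial:
  assumes s: "s > 0"
  shows "mom (\<lambda>x s. \<eta> x s * \<eta>ss x s) s = - b / 2 * n s + \<bar>\<delta>\<bar> * (N s - L s) + PI s"
proof -
  have s0: "s \<ge> 0" using s by simp
  define a where "a = mom (\<lambda>x s. \<eta> x s * \<eta>ss x s) s"
  have W: "((\<lambda>x. - (x^4 * \<rho> x) * (\<eta> x s * (\<eta>ss x s + b / 2 * \<eta>s x s))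
      + \<bar>\<delta>\<bar> * ((x^4 * \<rho> x) * (\<eta> x s * (\<eta> x s - 1 / \<eta> x s ^ 2)))
      + (x^2 * \<rho> x powr (4/3)) * (q x s powr (-4/3) * (2 * \<eta> x s * \<eta> x s * j x s + \<eta> x s ^ 2 * (\<eta> x s + x * \<eta>x x s))
          - (3 * \<eta> x s / \<eta> x s ^ 2 + x * \<eta>x x s / \<eta> x s ^ 2 - 2 * x * \<eta> x s * \<eta>x x s / \<eta> x s ^ 3))
      + A s * (x^3 * B x s * \<eta> x s * (\<eta> x s * \<eta>x x s - \<eta> x s * \<eta>x x s))) has_integral 0) {0..R0}"
    by (rule weak_form[OF s]) (auto intro!: cont2_slice[OF cont2_base(1)] partials s0)
  have G: "((\<lambda>x. - ((x^4 * \<rho> x) * (\<eta> x s * \<eta>ss x s)) - b / 2 * ((x^4 * \<rho> x) * (\<eta> x s * \<eta>s x s))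
      + \<bar>\<delta>\<bar> * ((x^4 * \<rho> x) * \<eta> x s ^ 2 - (x^4 * \<rho> x) * (1 / \<eta> x s))
      + (x^2 * \<rho> x powr (4/3)) * pint x s) has_integral
      - a - b / 2 * n s + \<bar>\<delta>\<bar> * (N s - L s) + PI s) {0..R0}"
    unfolding a_def n_def N_def L_def
    by (intro has_integral_add has_integral_diff has_integral_neg has_integral_mult_right
        mom_has_integral cont2_mono PI_has_integral s0)
  have eq: "- (x^4 * \<rho> x) * (\<eta> x s * (\<eta>ss x s + b / 2 * \<eta>s x s))
      + \<bar>\<delta>\<bar> * ((x^4 * \<rho> x) * (\<eta> x s * (\<eta> x s - 1 / \<eta> x s ^ 2)))
      + (x^2 * \<rho> x powr (4/3)) * (q x s powr (-4/3) * (2 * \<eta> x s * \<eta> x s * j x s + \<eta> x s ^ 2 * (\<eta> x s + x * \<eta>x x s))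
          - (3 * \<eta> x s / \<eta> x s ^ 2 + x * \<eta>x x s / \<eta> x s ^ 2 - 2 * x * \<eta> x s * \<eta>x x s / \<eta> x s ^ 3))
      + A s * (x^3 * B x s * \<eta> x s * (\<eta> x s * \<eta>x x s - \<eta> x s * \<eta>x x s))
     = - ((x^4 * \<rho> x) * (\<eta> x s * \<eta>ss x s)) - b / 2 * ((x^4 * \<rho> x) * (\<eta> x s * \<eta>s x s))
      + \<bar>\<delta>\<bar> * ((x^4 * \<rho> x) * \<eta> x s ^ 2 - (x^4 * \<rho> x) * (1 / \<eta> x s))
      + (x^2 * \<rho> x powr (4/3)) * pint x s" if x: "x \<in> {0..R0}" for x
  proof -
    have e: "\<eta> x s > 0" and qp: "q x s > 0" using \<eta>_pos[OF x s0] q_pos[OF x s0] by auto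
    have "q x s powr (-1/3) = q x s powr (-4/3 + 1)" by simp
    also have "\<dots> = q x s powr (-4/3) * q x s" using qp by (subst powr_add) simp
    finally have q1: "q x s powr (-4/3) * q x s = q x s powr (-1/3)" ..
    have "2 * \<eta> x s * \<eta> x s * j x s + \<eta> x s ^ 2 * (\<eta> x s + x * \<eta>x x s) = 3 * q x s"
      by (simp add: q_def j_def algebra_simps power2_eq_square)
    then have P: "q x s powr (-4/3) * (2 * \<eta> x s * \<eta> x s * j x s + \<eta> x s ^ 2 * (\<eta> x s + x * \<eta>x x s))
          - (3 * \<eta> x s / \<eta> x s ^ 2 + x * \<eta>x x s / \<eta> x s ^ 2 - 2 * x * \<eta> x s * \<eta>x x s / \<eta> x s ^ 3) = pint x s"
      using q1 e by (simp add: pint_def field_simps power2_eq_square power3_eq_cube)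
    have G: "\<eta> x s * (\<eta> x s - 1 / \<eta> x s ^ 2) = \<eta> x s ^ 2 - 1 / \<eta> x s"
      using e by (simp add: field_simps power2_eq_square)
    show ?thesis unfolding P G by (simp add: algebra_simps)
  qed
  have "- a - b / 2 * n s + \<bar>\<delta>\<bar> * (N s - L s) + PI s = 0"
    by (rule has_integral_unique[OF G has_integral_eq[OF eq W]])
  then show ?thesis by (simp add: a_def)
qed

text \<open>For the test function \<open>\<eta>s\<close> the variation of the volume is
  \<open>qs\<close>, so the pressure term is the time derivative of \<open>PI\<close>, and
  \<open>B_eq'\<close> turns the viscous term into a square.\<close>

lemma power_balance:
  assumes s: "s > 0"
  shows "mom (\<lambda>x s. \<eta>s x s * \<eta>ss x s) s = - b / 2 * K s
    + \<bar>\<delta>\<bar> * (n s - mom (\<lambda>x s. \<eta>s x s / \<eta> x s ^ 2) s) - PI' s - A s * (3 / (4 * \<mu>) * diss s)"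
proof -
  have s0: "s \<ge> 0" using s by simp
  define a where "a = mom (\<lambda>x s. \<eta>s x s * \<eta>ss x s) s"
  define L' where "L' = mom (\<lambda>x s. \<eta>s x s / \<eta> x s ^ 2) s"
  have W: "((\<lambda>x. - (x^4 * \<rho> x) * (\<eta>s x s * (\<eta>ss x s + b / 2 * \<eta>s x s))
      + \<bar>\<delta>\<bar> * ((x^4 * \<rho> x) * (\<eta>s x s * (\<eta> x s - 1 / \<eta> x s ^ 2)))
      + (x^2 * \<rho> x powr (4/3)) * (q x s powr (-4/3) * (2 * \<eta> x s * \<eta>s x s * j x s + \<eta> x s ^ 2 * (\<eta>s x s + x * \<eta>xs x s))
          - (3 * \<eta>s x s / \<eta> x s ^ 2 + x * \<eta>xs x s / \<eta> x s ^ 2 - 2 * x * \<eta>s x s * \<eta>x x s / \<eta> x s ^ 3))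
      + A s * (x^3 * B x s * \<eta> x s * (\<eta>s x s * \<eta>x x s - \<eta> x s * \<eta>xs x s))) has_integral 0) {0..R0}"
    by (rule weak_form[OF s]) (auto intro!: cont2_slice[OF cont2_base(3)] partials s0)
  have D: "((\<lambda>x. x^2 * q x s * B x s ^ 2) has_integral diss s) {0..R0}"
    unfolding diss_def using diss_cont[OF s0] by (intro integrable_integral integrable_continuous_real)
  have G: "((\<lambda>x. - ((x^4 * \<rho> x) * (\<eta>s x s * \<eta>ss x s)) - b / 2 * ((x^4 * \<rho> x) * \<eta>s x s ^ 2)
      + \<bar>\<delta>\<bar> * ((x^4 * \<rho> x) * (\<eta> x s * \<eta>s x s) - (x^4 * \<rho> x) * (\<eta>s x s / \<eta> x s ^ 2))
      - (x^2 * \<rho> x powr (4/3)) * pint' x s - A s * (3 / (4 * \<mu>) * (x^2 * q x s * B x s ^ 2))) has_integral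
      - a - b / 2 * K s + \<bar>\<delta>\<bar> * (n s - L') - PI' s - A s * (3 / (4 * \<mu>) * diss s)) {0..R0}"
    unfolding a_def n_def K_def L'_def
    by (intro has_integral_add has_integral_diff has_integral_neg has_integral_mult_right
        mom_has_integral cont2_mono PI'_has_integral s0 D)
  have eq: "- (x^4 * \<rho> x) * (\<eta>s x s * (\<eta>ss x s + b / 2 * \<eta>s x s))
      + \<bar>\<delta>\<bar> * ((x^4 * \<rho> x) * (\<eta>s x s * (\<eta> x s - 1 / \<eta> x s ^ 2)))
      + (x^2 * \<rho> x powr (4/3)) * (q x s powr (-4/3) * (2 * \<eta> x s * \<eta>s x s * j x s + \<eta> x s ^ 2 * (\<eta>s x s + x * \<eta>xs x s))
          - (3 * \<eta>s x s / \<eta> x s ^ 2 + x * \<eta>xs x s / \<eta> x s ^ 2 - 2 * x * \<eta>s x s * \<eta>x x s / \<eta> x s ^ 3))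
      + A s * (x^3 * B x s * \<eta> x s * (\<eta>s x s * \<eta>x x s - \<eta> x s * \<eta>xs x s))
     = - ((x^4 * \<rho> x) * (\<eta>s x s * \<eta>ss x s)) - b / 2 * ((x^4 * \<rho> x) * \<eta>s x s ^ 2)
      + \<bar>\<delta>\<bar> * ((x^4 * \<rho> x) * (\<eta> x s * \<eta>s x s) - (x^4 * \<rho> x) * (\<eta>s x s / \<eta> x s ^ 2))
      - (x^2 * \<rho> x powr (4/3)) * pint' x s - A s * (3 / (4 * \<mu>) * (x^2 * q x s * B x s ^ 2))"
    if x: "x \<in> {0..R0}" for x
  proof -
    have P: "q x s powr (-4/3) * (2 * \<eta> x s * \<eta>s x s * j x s + \<eta> x s ^ 2 * (\<eta>s x s + x * \<eta>xs x s))
          - (3 * \<eta>s x s / \<eta> x s ^ 2 + x * \<eta>xs x s / \<eta> x s ^ 2 - 2 * x * \<eta>s x s * \<eta>x x s / \<eta> x s ^ 3) = - pint' x s"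
      by (simp add: pint'_def qs_def algebra_simps)
    have "x * (\<eta>s x s * \<eta>x x s - \<eta> x s * \<eta>xs x s) = - (3 / (4 * \<mu>) * (B x s * (\<eta> x s * j x s)))"
      using B_eq'[OF x s0] mu_pos by (simp add: field_simps)
    then have "x^2 * B x s * \<eta> x s * (x * (\<eta>s x s * \<eta>x x s - \<eta> x s * \<eta>xs x s))
        = x^2 * B x s * \<eta> x s * - (3 / (4 * \<mu>) * (B x s * (\<eta> x s * j x s)))" by simp
    then have V: "x^3 * B x s * \<eta> x s * (\<eta>s x s * \<eta>x x s - \<eta> x s * \<eta>xs x s) = - (3 / (4 * \<mu>) * (x^2 * q x s * B x s ^ 2))"
      by (simp add: q_def power2_eq_square power3_eq_cube mult_ac)
    show ?thesis unfolding P V by (simp add: algebra_simps power2_eq_square)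
  qed
  have "- a - b / 2 * K s + \<bar>\<delta>\<bar> * (n s - L') - PI' s - A s * (3 / (4 * \<mu>) * diss s) = 0"
    by (rule has_integral_unique[OF G has_integral_eq[OF eq W]])
  then show ?thesis by (simp add: a_def L'_def)
qed

text \<open>The term \<open>b * n\<close> in \<open>calE\<close> brings in \<open>b\<close> times
  the virial identity, which is added to the power balance. Because
  \<open>b * b = 2 * \<bar>\<delta>\<bar>\<close>, everything except the dissipation recombines to
  \<open>b * calE\<close>.\<close>

lemma calE_DERIV:
  assumes s: "s > 0"
  shows "(calE has_real_derivative b * calE s - A s * (3 / (4 * \<mu>) * diss s)) (at s within {0..})"
proof -
  have s0: "s \<ge> 0" using s by simp
  define X where "X = mom (\<lambda>x s. \<eta>s x s / \<eta> x s ^ 2) s"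
  have bb: "\<bar>\<delta>\<bar> = b * b / 2" using b_sq delta_neg by simp
  have "(calE has_real_derivative 2 * mom (\<lambda>x s. \<eta>s x s * \<eta>ss x s) s / 2
      + b * (K s + mom (\<lambda>x s. \<eta> x s * \<eta>ss x s) s) + \<bar>\<delta>\<bar> * (2 * n s) - \<bar>\<delta>\<bar> * (- X) + PI' s) (at s within {0..})"
    unfolding calE_def[abs_def] X_def
    by (intro DERIV_add DERIV_diff DERIV_cmult DERIV_cdivide N_DERIV n_DERIV K_DERIV L_DERIV PI_DERIV s0)
  then show ?thesis
    unfolding virial[OF s] power_balance[OF s] X_def[symmetric]
    by (rule DERIV_cong) (simp add: calE_def bb field_simps)
qed

lemma calE_cont: "continuous_on {0..} calE"
  unfolding calE_def[abs_def]
  by (intro continuous_intros; simp add: continuous_on_eq_continuous_within; 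
      blast intro: DERIV_continuous N_DERIV n_DERIV K_DERIV L_DERIV PI_DERIV)

lemma scaled_calE_DERIV:
  assumes s: "s > 0"
  shows "((\<lambda>s. exp (- b * s) * calE s) has_real_derivative
     - exp (- b * s) * (A s * (3 / (4 * \<mu>) * diss s))) (at s)"
proof -
  have "at s within {0..} = at s"
    using s by (intro at_within_interior) simp
  then have "(calE has_real_derivative b * calE s - A s * (3 / (4 * \<mu>) * diss s)) (at s)"
    using calE_DERIV[OF s] by simp
  then show ?thesis
    by (auto intro!: derivative_eq_intros simp: algebra_simps)
qed

lemma scaled_calE_cont: "continuous_on {0..} (\<lambda>s. exp (- b * s) * calE s)"
  by (intro continuous_intros calE_cont)

lemma scaled_calE_antimono:
  assumes "0 \<le> s" "s \<le> t"
  shows "exp (- b * t) * calE t \<le> exp (- b * s) * calE s"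
proof (rule DERIV_nonpos_imp_decreasing_open[OF assms(2), where f = "\<lambda>s. exp (- b * s) * calE s"])
  show "\<exists>y. ((\<lambda>s. exp (- b * s) * calE s) has_real_derivative y) (at z) \<and> y \<le> 0" if "s < z" "z < t" for z
    using scaled_calE_DERIV[of z] diss_nonneg[of z] that assms mu_pos
    by (intro exI[of _ "- exp (- b * z) * (A z * (3 / (4 * \<mu>) * diss z))"]) (auto simp: A_def)
  show "continuous_on {s..t} (\<lambda>s. exp (- b * s) * calE s)"
    using assms by (intro continuous_on_subset[OF scaled_calE_cont]) auto
qed

text \<open>With \<open>t\<^sup>3 = j / \<eta>\<close> the bound becomes \<open>3/t + t\<^sup>3 \<ge> 4\<close>.\<close>
lemma pint_nonneg:
  assumes xs: "x \<in> {0..R0}" "s \<ge> 0"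
  shows "pint x s \<ge> 0"
proof -
  have e: "\<eta> x s > 0" and jp: "j x s > 0" using \<eta>_pos[OF xs] j_pos[OF xs] by auto
  define t where "t = (j x s / \<eta> x s) powr (1/3)"
  have t: "t > 0" using e jp by (simp add: t_def)
  have "t ^ 3 = t powr 3" using t by (simp flip: powr_numeral)
  also have "\<dots> = j x s / \<eta> x s" using e jp by (simp add: t_def powr_powr)
  finally have jt: "j x s = t ^ 3 * \<eta> x s" using e by (simp add: field_simps)
  have "q x s = (t * \<eta> x s) ^ 3"
    by (simp add: q_def jt power2_eq_square power3_eq_cube)
  also have "\<dots> = (t * \<eta> x s) powr 3"
    using t e by (simp flip: powr_numeral)
  finally have "q x s powr (-1/3) = (t * \<eta> x s) powr (3 * (-1/3))"
    by (simp only: powr_powr)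
  then have q1: "q x s powr (-1/3) = 1 / (t * \<eta> x s)"
    using t e by (simp add: powr_minus_divide)
  have xe: "x * \<eta>x x s = (t ^ 3 - 1) * \<eta> x s"
    using jt by (simp add: j_def algebra_simps)
  have "pint x s = (t - 1)^2 * (t^2 + 2 * t + 3) / (t * \<eta> x s)"
    unfolding pint_def q1 xe using t e
    by (simp add: field_simps power2_eq_square power3_eq_cube)
  moreover have "t^2 + 2 * t + 3 \<ge> 0" using t by simp
  ultimately show ?thesis using t e by simp
qed

lemma PI_nonneg: "s \<ge> 0 \<Longrightarrow> PI s \<ge> 0"
  by (rule has_integral_nonneg[OF PI_has_integral]) (auto simp: pint_nonneg)

text \<open>Since \<open>b^2 = 2 * \<bar>\<delta>\<bar>\<close>, the quadratic terms are half the
  square of \<open>\<eta>s + b * \<eta>\<close>, which is the particle velocity up to a power of the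
  expansion factor and the label. With \<open>PI\<close> nonnegative, only gravity can make
  \<open>calE\<close> negative.\<close>

lemma calE_ge: 
  assumes s: "s \<ge> 0"
  shows "calE s \<ge> - \<bar>\<delta>\<bar> * L s"
proof -
  have c: "cont2 (\<lambda>x s. (\<eta>s x s + b * \<eta> x s)^2)"
    unfolding cont2_def by (intro continuous_intros)
  have "((\<lambda>x. (x^4 * \<rho> x) * \<eta>s x s ^ 2 + 2 * b * ((x^4 * \<rho> x) * (\<eta> x s * \<eta>s x s)) + b^2 * ((x^4 * \<rho> x) * \<eta> x s ^ 2))
      has_integral K s + 2 * b * n s + b^2 * N s) {0..R0}"
    unfolding K_def n_def N_def
    by (intro has_integral_add has_integral_mult_right mom_has_integral cont2_mono s)
  moreover have "(\<lambda>x. (x^4 * \<rho> x) * \<eta>s x s ^ 2 + 2 * b * ((x^4 * \<rho> x) * (\<eta> x s * \<eta>s x s)) + b^2 * ((x^4 * \<rho> x) * \<eta> x s ^ 2))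
     = (\<lambda>x. (x^4 * \<rho> x) * (\<eta>s x s + b * \<eta> x s)^2)"
    by (simp add: fun_eq_iff algebra_simps power2_eq_square)
  ultimately have "mom (\<lambda>x s. (\<eta>s x s + b * \<eta> x s)^2) s = K s + 2 * b * n s + b^2 * N s"
    by (intro mom_eqI) simp
  moreover have "mom (\<lambda>x s. (\<eta>s x s + b * \<eta> x s)^2) s \<ge> 0"
    by (rule has_integral_nonneg[OF mom_has_integral[OF c s]]) (simp add: weight_nonneg)
  moreover have "b^2 = 2 * \<bar>\<delta>\<bar>" using b_sq delta_neg by (simp add: power2_eq_square)
  ultimately show ?thesis using PI_nonneg[OF s] by (simp add: calE_def algebra_simps)
qed

section \<open>Consequences of negative energy\<close>

lemma negative_energy_escapes:
  assumes s0: "s0 \<ge> 0" and neg: "calE s0 < 0"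
  shows "\<exists>S\<ge>0. \<forall>s>S. \<exists>x\<in>{0..R0}. \<bar>\<phi> x s\<bar> \<ge> 1/2"
proof -
  define c where "c = - calE s0"
  have c: "c > 0" using neg by (simp add: c_def)
  \<comment> \<open>\<open>- calE s\<close> is at least \<open>(1 + b * (s - s0)) * c\<close>. At
    \<open>S\<close> its linear part reaches \<open>2 * \<bar>\<delta>\<bar> * M\<close>, the most
    that gravity can contribute while \<open>1 / \<eta> \<le> 2\<close>.\<close>
  define S where "S = s0 + 2 * \<bar>\<delta>\<bar> * M / (b * c)"
  have "\<exists>x\<in>{0..R0}. \<bar>\<phi> x s\<bar> \<ge> 1/2" if s: "s > S" for s
  proof (rule ccontr)
    assume "\<not> ?thesis"
    then have small: "\<bar>\<phi> x s\<bar> < 1/2" if "x \<in> {0..R0}" for x using that by force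
    have "2 * \<bar>\<delta>\<bar> * M / (b * c) \<ge> 0" using c b_pos M_pos by simp
    then have ss: "s \<ge> s0" "s \<ge> 0" using s s0 by (auto simp: S_def)
    have "L s \<le> mom (\<lambda>x s. 2) s"
      unfolding L_def
    proof (rule mom_mono[OF cont2_mono(1) cont2_mono(8) ss(2)])
      show "1 / \<eta> x s \<le> 2" if "x \<in> {0..R0}" for x
        using small[OF that] \<eta>_pos[OF that ss(2)] by (simp add: \<eta>_def field_simps abs_less_iff)
    qed
    then have "L s \<le> 2 * M" using mom_const[of "\<lambda>_. 2"] by simp
    then have "\<bar>\<delta>\<bar> * L s \<le> \<bar>\<delta>\<bar> * (2 * M)" by (intro mult_left_mono) auto
    then have lower: "calE s \<ge> - (2 * \<bar>\<delta>\<bar> * M)" using calE_ge[OF ss(2)] by simp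
    have "exp (- b * s) * calE s \<le> exp (- b * s0) * calE s0"
      by (rule scaled_calE_antimono[OF s0 ss(1)])
    then have "exp (b * s) * (exp (- b * s) * calE s) \<le> exp (b * s) * (exp (- b * s0) * calE s0)"
      by (intro mult_left_mono) auto
    then have "calE s \<le> - exp (b * (s - s0)) * c"
      by (simp add: c_def mult.assoc[symmetric] exp_add[symmetric] algebra_simps)
    moreover have "exp (b * (s - s0)) * c \<ge> (1 + b * (s - s0)) * c"
      using c by (intro mult_right_mono exp_ge_add_one_self) auto
    ultimately have "(b * (s - s0)) * c < 2 * \<bar>\<delta>\<bar> * M"
      using lower c by (simp add: algebra_simps)
    then have "s - s0 < 2 * \<bar>\<delta>\<bar> * M / (b * c)"
      using b_pos c by (simp add: field_simps)
    then show False using s by (simp add: S_def)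
  qed
  moreover have "S \<ge> 0" using s0 c b_pos M_pos by (simp add: S_def)
  ultimately show ?thesis by blast
qed

lemma energy_eq:
  assumes s: "s \<ge> 0"
  shows "energy a0 \<delta> R0 \<rho> \<phi> s = inverse (alpha_bar a0 \<delta> s) * calE s"
proof -
  have "((\<lambda>x. 1/2 * ((x^4 * \<rho> x) * \<eta>s x s ^ 2) + b * ((x^4 * \<rho> x) * (\<eta> x s * \<eta>s x s))
      + \<bar>\<delta>\<bar> * ((x^4 * \<rho> x) * \<eta> x s ^ 2) - \<bar>\<delta>\<bar> * ((x^4 * \<rho> x) * (1 / \<eta> x s))) has_integral
      1/2 * K s + b * n s + \<bar>\<delta>\<bar> * N s - \<bar>\<delta>\<bar> * L s) {0..R0}"
    unfolding K_def n_def N_def L_def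
    by (intro has_integral_add has_integral_diff has_integral_mult_right mom_has_integral cont2_mono s)
  moreover have "(\<lambda>x. 1/2 * ((x^4 * \<rho> x) * \<eta>s x s ^ 2) + b * ((x^4 * \<rho> x) * (\<eta> x s * \<eta>s x s))
      + \<bar>\<delta>\<bar> * ((x^4 * \<rho> x) * \<eta> x s ^ 2) - \<bar>\<delta>\<bar> * ((x^4 * \<rho> x) * (1 / \<eta> x s)))
    = (\<lambda>x. x^4 * \<rho> x * (1/2 * (pds \<phi> x s)^2 + sqrt (2 * \<bar>\<delta>\<bar>) * (1 + \<phi> x s) * pds \<phi> x s
         - \<delta> * (1 + \<phi> x s)^2 + \<delta> / (1 + \<phi> x s)))"
    using delta_neg by (simp add: fun_eq_iff \<eta>_def \<eta>s_def b_def algebra_simps)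
  ultimately have 1: "integral {0..R0} (\<lambda>x. x^4 * \<rho> x * (1/2 * (pds \<phi> x s)^2
      + sqrt (2 * \<bar>\<delta>\<bar>) * (1 + \<phi> x s) * pds \<phi> x s - \<delta> * (1 + \<phi> x s)^2 + \<delta> / (1 + \<phi> x s)))
      = 1/2 * K s + b * n s + \<bar>\<delta>\<bar> * N s - \<bar>\<delta>\<bar> * L s"
    by (intro integral_unique) simp
  have 2: "integral {0..R0} (\<lambda>x. x^2 * \<rho> x powr (4/3) *
        (3 / ((1 + \<phi> x s)^2 * (1 + \<phi> x s + x * pdx \<phi> x s)) powr (1/3)
         - 3 / (1 + \<phi> x s) + x * pdx \<phi> x s / (1 + \<phi> x s)^2)) = PI s"
    unfolding PI_def pint_def q_def j_def \<eta>_def \<eta>x_def by (simp add: powr_minus_divide)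
  show ?thesis unfolding energy_def 1 2 calE_def by (simp add: algebra_simps)
qed

end


section \<open>Nonpositive energy\<close>

context perturbed_star begin

section \<open>Enclosed mass and the first-order system for the profile\<close>

definition "m x = integral {0..x} (\<lambda>y. y^2 * \<rho> y)"

lemma m_integrand_cont: "continuous_on {0..R0} (\<lambda>y. y^2 * \<rho> y)"
  by (intro continuous_intros rho_cont)

lemma m_DERIV: "x \<in> {0<..<R0} \<Longrightarrow> (m has_real_derivative x^2 * w x ^ 3) (at x)"
  using integral_has_real_derivative[OF m_integrand_cont, of x] at_within_Icc_at[of 0 x R0] rho_w[of x]
  unfolding m_def[abs_def] by auto

lemma m_cont: "continuous_on {0..R0} m"
  unfolding m_def[abs_def] by (intro indefinite_integral_continuous_1 integrable_continuous_real m_integrand_cont)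

lemma m_bound:
  obtains k where "k \<ge> 0" "\<And>x. x \<in> {0..R0} \<Longrightarrow> 0 \<le> m x \<and> m x \<le> k * x^3"
proof -
  have "compact (\<rho> ` {0..R0})" using rho_cont by (rule compact_continuous_image) simp
  then obtain k where k: "k > 0" "\<And>x. x \<in> {0..R0} \<Longrightarrow> norm (\<rho> x) \<le> k"
    using compact_imp_bounded[of "\<rho> ` {0..R0}"] by (auto simp: bounded_pos)
  have "0 \<le> m x \<and> m x \<le> k * x^3" if x: "x \<in> {0..R0}" for x
  proof
    have I: "(\<lambda>y. y^2 * \<rho> y) integrable_on {0..x}"
      using x by (intro integrable_continuous_real continuous_on_subset[OF m_integrand_cont]) auto
    show "0 \<le> m x" unfolding m_def using x rho_nonneg by (intro integral_nonneg[OF I]) auto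
    have "m x \<le> integral {0..x} (\<lambda>y. x^2 * k)"
      unfolding m_def
    proof (rule integral_le[OF I])
      show "y^2 * \<rho> y \<le> x^2 * k" if "y \<in> {0..x}" for y
        using that x k(2)[of y] rho_nonneg[of y] by (intro mult_mono power_mono) auto
    qed auto
    then show "m x \<le> k * x^3" using x by (simp add: power2_eq_square power3_eq_cube mult_ac)
  qed
  then show ?thesis using k(1) by (intro that[of k]) auto
qed

text \<open>The equation says that \<open>4 x\<^sup>2 w' + m + \<delta> x\<^sup>3\<close> is a constant \<open>C\<close>. If \<open>C \<noteq> 0\<close> then \<open>w\<close> would blow up like \<open>- C / (4 x)\<close> at \<open>0\<close>.\<close>
lemma w_slope:
  assumes x: "x \<in> {0<..<R0}"
  shows "deriv w x = (- \<delta> * x - m x / x^2) / 4"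
proof -
  define g where "g x = 4 * x^2 * deriv w x + m x + \<delta> * x^3" for x
  have dg: "(g has_real_derivative 0) (at x)" if x: "x \<in> {0<..<R0}" for x
  proof -
    have "deriv w differentiable (at x)" using rho_C2 x unfolding w_def[abs_def] by blast
    then have d2: "(deriv w has_real_derivative deriv (deriv w) x) (at x)"
      by (simp add: DERIV_deriv_iff_real_differentiable)
    have "deriv (deriv w) x + 2 / x * deriv w x + 1/4 * \<rho> x + 3/4 * \<delta> = 0"
      using rho_ode x unfolding w_def[abs_def] by blast
    then have "4 * x^2 * (deriv (deriv w) x + 2 / x * deriv w x + 1/4 * w x ^ 3 + 3/4 * \<delta>) = 0"
      using rho_w[of x] x by simp
    then have z: "4 * x^2 * deriv (deriv w) x + 8 * x * deriv w x + x^2 * w x ^ 3 + 3 * \<delta> * x^2 = 0"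
      using x by (simp add: field_simps power2_eq_square)
    show ?thesis
      unfolding g_def
      by (rule DERIV_cong, (rule derivative_intros d2 m_DERIV x)+) (use z in \<open>simp add: algebra_simps\<close>)
  qed
  have "\<exists>C. \<forall>x\<in>{0<..<R0}. g x = C"
    by (rule has_field_derivative_zero_constant) (auto intro!: has_field_derivative_at_within[where s = "{0<..<R0}"] dg)
  then obtain C where C: "\<And>x. x \<in> {0<..<R0} \<Longrightarrow> g x = C" by blast
  have dw: "deriv w x = (C - m x - \<delta> * x^3) / (4 * x^2)" if "x \<in> {0<..<R0}" for x
    using C[OF that] that by (simp add: g_def field_simps)
  obtain k where k: "k \<ge> 0" "\<And>x. x \<in> {0..R0} \<Longrightarrow> 0 \<le> m x \<and> m x \<le> k * x^3" using m_bound by blast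
  have "compact (w ` {0..R0})" using w_cont by (rule compact_continuous_image) simp
  then obtain W where W: "W > 0" "\<And>x. x \<in> {0..R0} \<Longrightarrow> norm (w x) \<le> W"
    using compact_imp_bounded[of "w ` {0..R0}"] by (auto simp: bounded_pos)
  \<comment> \<open>\<open>h\<close> removes the singular part of \<open>w\<close>: its derivative
    is bounded, so \<open>h\<close> is bounded near the centre, and so is the difference
    \<open>C / (4 * x)\<close> of \<open>h\<close> and \<open>w\<close>.\<close>
  define h where "h x = w x + C / (4 * x)" for x
  define x0 where "x0 = R0 / 2"
  define l where "l = (k + \<bar>\<delta>\<bar>) * R0 / 4"
  have dh: "(h has_real_derivative (- m x - \<delta> * x^3) / (4 * x^2)) (at x)" if x: "x \<in> {0<..<R0}" for x
    unfolding h_def using x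
    by (auto intro!: derivative_eq_intros w_DERIV simp: dw field_simps power2_eq_square)
  have bd: "\<bar>(- m x - \<delta> * x^3) / (4 * x^2)\<bar> \<le> l" if x: "x \<in> {0<..<R0}" for x
  proof -
    have "\<bar>- m x - \<delta> * x^3\<bar> \<le> \<bar>m x\<bar> + \<bar>\<delta> * x^3\<bar>" by linarith
    also have "\<dots> \<le> k * x^3 + \<bar>\<delta>\<bar> * x^3" using k(2)[of x] x by (auto simp: abs_mult)
    finally have "\<bar>- m x - \<delta> * x^3\<bar> \<le> (k + \<bar>\<delta>\<bar>) * x * x^2"
      by (simp add: algebra_simps power2_eq_square power3_eq_cube)
    then have "\<bar>- m x - \<delta> * x^3\<bar> / (4 * x^2) \<le> (k + \<bar>\<delta>\<bar>) * x * x^2 / (4 * x^2)"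
      by (rule divide_right_mono) simp
    then have "\<bar>(- m x - \<delta> * x^3) / (4 * x^2)\<bar> \<le> (k + \<bar>\<delta>\<bar>) * x * x^2 / (4 * x^2)"
      by (simp only: abs_divide abs_mult abs_power2 abs_numeral)
    also have "\<dots> = (k + \<bar>\<delta>\<bar>) * x / 4" using x by (simp add: field_simps)
    also have "\<dots> \<le> l" unfolding l_def using x k(1) by (intro divide_right_mono mult_left_mono) auto
    finally show ?thesis .
  qed
  define Z where "Z = W + \<bar>h x0\<bar> + l * R0"
  have Zb: "\<bar>C\<bar> \<le> 4 * Z * x" if x: "x \<in> {0<..x0}" for x
  proof -
    have "norm (h x - h x0) \<le> l * norm (x - x0)"
      by (rule field_differentiable_bound[of "{0<..<R0}" h])
        (use dh bd x R0_pos in \<open>auto simp: x0_def intro!: has_field_derivative_at_within[where s = "{0<..<R0}"]\<close>)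
    also have "l * norm (x - x0) \<le> l * R0"
      using x k(1) R0_pos by (intro mult_left_mono) (auto simp: l_def x0_def)
    finally have "\<bar>C / (4 * x)\<bar> \<le> Z"
      using W(2)[of x] x R0_pos by (auto simp: h_def Z_def x0_def)
    then show ?thesis using x by (simp add: abs_divide field_simps)
  qed
  have "C = 0"
  proof (rule ccontr)
    assume "C \<noteq> 0"
    have Z: "Z > 0" using W(1) k(1) R0_pos by (auto simp: Z_def l_def intro!: add_pos_nonneg)
    \<comment> \<open>At this point the bound \<open>Zb\<close> becomes
      \<open>\<bar>C\<bar> \<le> \<bar>C\<bar> / 2\<close>.\<close>
    define y where "y = min x0 (\<bar>C\<bar> / (8 * Z))"
    have "y \<in> {0<..x0}" using \<open>C \<noteq> 0\<close> Z R0_pos by (auto simp: y_def x0_def)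
    then have "\<bar>C\<bar> \<le> 4 * Z * y" by (rule Zb)
    also have "\<dots> \<le> 4 * Z * (\<bar>C\<bar> / (8 * Z))" using Z by (intro mult_left_mono) (auto simp: y_def)
    also have "\<dots> = \<bar>C\<bar> / 2" using Z by simp
    finally show False using \<open>C \<noteq> 0\<close> by simp
  qed
  then show ?thesis using dw[OF x] x by (simp add: field_simps power2_eq_square power3_eq_cube)
qed

lemma m_strict_mono:
  assumes "x \<in> {0..R0}" "y \<in> {0..R0}" "x < y"
  shows "m x < m y"
proof (rule DERIV_pos_imp_increasing_open[OF assms(3)])
  show "\<exists>d. (m has_real_derivative d) (at z) \<and> 0 < d" if "x < z" "z < y" for z
    using m_DERIV[of z] w_pos[of z] that assms by (intro exI[of _ "z^2 * w z ^ 3"]) auto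
qed (use assms in \<open>auto intro: continuous_on_subset[OF m_cont]\<close>)

text \<open>This is the scaling symmetry of the cubic equation. The total mass stays
  \<open>m R0\<close> for every \<open>c\<close>, so \<open>c\<close> is free to prescribe the
  central value \<open>1 / c\<close>.\<close>

lemma lane_emden_scaled:
  assumes c: "c > 0"
  shows "lane_emden (- \<delta> / c^3) (1 / c) (c * R0) (\<lambda>r. w (r / c) / c) (\<lambda>r. m (r / c))"
  unfolding lane_emden_def
proof (intro conjI ballI)
  have i: "(\<lambda>r. r / c) ` {0..c * R0} \<subseteq> {0..R0}"
    using c by (auto simp: field_simps)
  have dc: "continuous_on {0..c * R0} (\<lambda>r. r / c)" using c by (intro continuous_intros) auto
  show "continuous_on {0..c * R0} (\<lambda>r. w (r / c) / c)"
    using c by (intro continuous_on_divide continuous_on_compose2[OF w_cont dc i] continuous_on_const) auto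
  show "continuous_on {0..c * R0} (\<lambda>r. m (r / c))"
    by (rule continuous_on_compose2[OF m_cont dc i])
  show "w (r / c) / c > 0" if "r \<in> {0..<c * R0}" for r
    using that c by (auto intro!: w_pos simp: field_simps)
  fix r assume r: "r \<in> {0<..<c * R0}"
  then have rc: "r / c \<in> {0<..<R0}" using c by (auto simp: field_simps)
  have d: "((\<lambda>r. r / c) has_real_derivative 1 / c) (at r)" using c by (auto intro!: derivative_eq_intros)
  have "((\<lambda>r. w (r / c) / c) has_real_derivative (- \<delta> * (r / c) - m (r / c) / (r / c)^2) / 4 * (1 / c) / c) (at r)"
    using DERIV_chain2[OF w_DERIV[OF rc] d] w_slope[OF rc] by (intro DERIV_cdivide) simp
  then show "((\<lambda>r. w (r / c) / c) has_real_derivative (- \<delta> / c^3 * r - m (r / c) / r^2) / 4) (at r)"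
    by (rule DERIV_cong) (use c r in \<open>simp add: field_simps power2_eq_square power3_eq_cube\<close>)
  have "((\<lambda>r. m (r / c)) has_real_derivative (r / c)^2 * w (r / c) ^ 3 * (1 / c)) (at r)"
    by (rule DERIV_chain2[OF m_DERIV[OF rc] d])
  then show "((\<lambda>r. m (r / c)) has_real_derivative r^2 * (w (r / c) / c) ^ 3) (at r)"
    by (rule DERIV_cong) (use c in \<open>simp add: field_simps power2_eq_square power3_eq_cube\<close>)
qed (use c R0_pos w_0 w_R0 in \<open>auto simp: m_def\<close>)

section \<open>Motions without dissipation\<close>

lemma separated_rate:
  assumes s: "s > 0" and B0: "\<And>x. x \<in> {0..R0} \<Longrightarrow> B x s = 0" and x: "x \<in> {0..R0}"
  shows "\<eta>s x s / \<eta> x s = \<eta>s 0 s / \<eta> 0 s"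
proof (cases "x = 0")
  case False
  have s0: "s \<ge> 0" using s by simp
  have "\<eta>s x s / \<eta> x s = \<eta>s 0 s / \<eta> 0 s"
  proof (rule DERIV_isconst_end[where f = "\<lambda>y. \<eta>s y s / \<eta> y s"])
    show "0 < x" using False x by simp
    show "continuous_on {0..x} (\<lambda>y. \<eta>s y s / \<eta> y s)"
      using x by (intro continuous_on_divide continuous_on_subset[OF cont2_slice[OF cont2_base(3) s0]]
          continuous_on_subset[OF cont2_slice[OF cont2_base(1) s0]]) (use \<eta>_pos[OF _ s0] in force)+
    fix y assume y: "0 < y" "y < x"
    then have yi: "y \<in> {0..R0}" using x by simp
    have "\<eta>xs y s * \<eta> y s - \<eta>s y s * \<eta>x y s = 0"
      using B_eq'[OF yi s0] B0[OF yi] y mu_pos by simp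
    then show "((\<lambda>y. \<eta>s y s / \<eta> y s) has_real_derivative 0) (at y)"
      using \<eta>_pos[OF yi s0] DERIV_divide[OF partials(3)[OF yi s0] partials(1)[OF yi s0]] by simp
  qed
  then show ?thesis .
qed simp

text \<open>The time derivative of \<open>\<eta>s / \<eta>\<close> is
  \<open>\<eta>ss / \<eta> - (\<eta>s / \<eta>)^2\<close>. As \<open>\<eta>s / \<eta>\<close> does
  not depend on \<open>x\<close> for all positive times, neither does
  \<open>\<eta>ss / \<eta>\<close>.\<close>

lemma separated_acceleration:
  assumes B0: "\<And>x s. x \<in> {0..R0} \<Longrightarrow> s > 0 \<Longrightarrow> B x s = 0" and x: "x \<in> {0..R0}" and s: "s > 0"
  shows "\<eta>ss x s / \<eta> x s = \<eta>ss 0 s / \<eta> 0 s"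
proof -
  have z: "0 \<in> {0..R0}" using R0_pos by simp
  have s0: "s \<ge> 0" using s by simp
  have D: "((\<lambda>s. \<eta>s y s / \<eta> y s) has_real_derivative \<eta>ss y s / \<eta> y s - (\<eta>s y s / \<eta> y s)^2) (at s)"
    if y: "y \<in> {0..R0}" for y
    using \<eta>_pos[OF y s0] DERIV_divide[OF partials(4)[OF y s0] partials(2)[OF y s0]]
    by (simp add: diff_divide_distrib power2_eq_square)
  have "((\<lambda>s. \<eta>s x s / \<eta> x s) has_real_derivative \<eta>ss 0 s / \<eta> 0 s - (\<eta>s 0 s / \<eta> 0 s)^2) (at s)"
    by (rule has_field_derivative_transform_within_open[OF D[OF z] open_greaterThan])
      (use s separated_rate[OF _ B0 x] in auto)
  from DERIV_unique[OF this D[OF x]] show ?thesis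
    using separated_rate[OF s B0 x] s by simp
qed

text \<open>Cube root of the deformed density \<open>\<rho> / q\<close>, still as a function of the
  Lagrangian label.\<close>

definition "v s x = w x * q x s powr (-1/3)"

lemma v_cont: "s \<ge> 0 \<Longrightarrow> continuous_on {0..R0} (v s)"
  unfolding v_def[abs_def]
  by (intro continuous_intros w_cont continuous_on_powr cont2_slice[OF cont2_q]) (use q_pos in force)+

lemma v_cubed:
  assumes "x \<in> {0..R0}" "s \<ge> 0"
  shows "v s x ^ 3 = w x ^ 3 / q x s"
proof -
  have "(q x s powr (-1/3)) ^ 3 = (q x s powr (-1/3)) powr 3"
    using powr_realpow[of "q x s powr (-1/3)" 3] q_pos[OF assms] by simp
  also have "\<dots> = q x s powr (-1/3 * 3)" by (rule powr_powr)
  also have "\<dots> = 1 / q x s" using q_pos[OF assms] by (simp add: powr_minus_divide)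
  finally show ?thesis by (simp only: v_def power_mult_distrib times_divide_eq_right mult_1_right)
qed

text \<open>Without stress, \<open>\<eta>s\<close> and \<open>\<eta>ss\<close> are multiples of
  \<open>\<eta>\<close> that are constant in space. The inertial terms then have the same form as
  the \<open>\<delta>\<close> term and merely shift its coefficient to \<open>\<kappa>\<close>. The
  factor \<open>j\<close> is the chain rule for the radius \<open>x * \<eta>\<close>.\<close>

lemma v_DERIV:
  assumes B0: "\<And>x s. x \<in> {0..R0} \<Longrightarrow> s > 0 \<Longrightarrow> B x s = 0" and s: "s > 0"
  obtains \<kappa> where "\<And>x. x \<in> {0<..<R0} \<Longrightarrow>
    (v s has_real_derivative j x s * ((\<kappa> * (x * \<eta> x s) - m x / (x * \<eta> x s)^2) / 4)) (at x)"
proof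
  define l where "l = \<eta>s 0 s / \<eta> 0 s"
  define \<Lambda> where "\<Lambda> = \<eta>ss 0 s / \<eta> 0 s"
  define \<kappa> where "\<kappa> = \<bar>\<delta>\<bar> - \<Lambda> - b / 2 * l"
  have s0: "s \<ge> 0" using s by simp
  fix x assume x: "x \<in> {0<..<R0}"
  then have xi: "x \<in> {0..R0}" by simp
  obtain P' B' where dP: "((\<lambda>y. (\<rho> y / q y s) powr (4/3)) has_real_derivative P') (at x)"
    and dp: "((\<lambda>y. \<rho> y powr (4/3)) has_real_derivative 4 * w x ^ 3 * deriv w x) (at x)"
    and dB: "((\<lambda>y. B y s) has_real_derivative B') (at x)"
    using spatial_DERIVs[OF x s0] .
  have "((\<lambda>y. B y s) has_real_derivative 0) (at x)"
    by (rule has_field_derivative_transform_within_open[OF DERIV_const open_greaterThanLessThan x])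
      (use B0 s in auto)
  then have B': "B' = 0" using DERIV_unique[OF dB] by simp
  have e: "\<eta> x s > 0" "j x s > 0" "q x s > 0" using \<eta>_pos[OF xi s0] j_pos[OF xi s0] q_pos[OF xi s0] by auto
  have es: "\<eta>s x s = l * \<eta> x s" and ess: "\<eta>ss x s = \<Lambda> * \<eta> x s"
    using separated_rate[OF s B0 xi] separated_acceleration[OF B0 xi s] s e
    by (auto simp: l_def \<Lambda>_def field_simps)
  have z: "\<eta>xs x s * \<eta> x s - \<eta>s x s * \<eta>x x s = 0"
    using B_eq'[OF xi s0] B0[OF xi s] x mu_pos by simp
  have wp: "w x > 0" using x by (intro w_pos) simp
  have rw: "\<rho> x = w x ^ 3" by (rule rho_w[OF xi])
  have slope: "4 * deriv w x = - \<delta> * x - m x / x^2" using w_slope[OF x] by simp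
  have w4: "4 * w x ^ 3 * deriv w x = w x ^ 3 * (- \<delta> * x - m x / x^2)"
    unfolding slope[symmetric] by simp
  have P': "P' = w x ^ 3 * (x * \<kappa> / \<eta> x s - m x / (x^2 * \<eta> x s ^ 4))"
    unfolding eqn'[OF x s dP dp dB] w4 z B' unfolding es ess rw \<kappa>_def using e x delta_neg
    by (simp add: field_simps power2_eq_square power4_eq_xxxx)
  \<comment> \<open>The equation controls the gradient of the pressure, so \<open>v\<close> is
    differentiated as its fourth root.\<close>
  have v4: "v s y = ((\<rho> y / q y s) powr (4/3)) powr (1/4)" if "y \<in> {0<..<R0}" for y
  proof -
    have yi: "y \<in> {0..R0}" using that by simp
    have "(w y ^ 4) powr (1/4) = w y"
      using w_pos[of y] that by (simp add: powr_powr flip: powr_numeral)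
    then show ?thesis
      using pressure_eq[OF yi s0] w_nonneg[of y] q_pos[OF yi s0]
      by (simp add: v_def powr_mult powr_powr)
  qed
  have vp: "v s x > 0" using wp e by (simp add: v_def)
  have qq: "v s x ^ 3 = w x ^ 3 / q x s" by (rule v_cubed[OF xi s0])
  have Pp: "(\<rho> x / q x s) powr (4/3) > 0" using rw wp e by simp
  have "v s x = ((\<rho> x / q x s) powr (4/3)) powr (1/4)" by (rule v4[OF x])
  then have v44: "(\<rho> x / q x s) powr (4/3) = v s x ^ 4"
    using Pp by (simp add: powr_powr flip: powr_numeral)
  have "((\<lambda>y. ((\<rho> y / q y s) powr (4/3)) powr (1/4)) has_real_derivative
     ((\<rho> x / q x s) powr (4/3)) powr (1/4) * (0 * ln ((\<rho> x / q x s) powr (4/3))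
       + P' * (1/4) / ((\<rho> x / q x s) powr (4/3)))) (at x)"
    by (rule DERIV_powr[OF dP Pp DERIV_const])
  then have "((\<lambda>y. ((\<rho> y / q y s) powr (4/3)) powr (1/4)) has_real_derivative
     v s x * (P' * (1/4) / v s x ^ 4)) (at x)"
    unfolding v4[OF x, symmetric] unfolding v44 by simp
  then have D: "(v s has_real_derivative v s x * (P' * (1/4) / v s x ^ 4)) (at x)"
    by (rule has_field_derivative_transform_within_open[OF _ open_greaterThanLessThan x])
      (simp add: v4)
  have "v s x * (P' * (1/4) / v s x ^ 4) = P' / (4 * v s x ^ 3)"
    using vp by (simp add: field_simps power3_eq_cube power4_eq_xxxx)
  also have "\<dots> = j x s * ((\<kappa> * (x * \<eta> x s) - m x / (x * \<eta> x s)^2) / 4)"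
    unfolding qq P' using wp e x by (simp add: q_def field_simps power2_eq_square power4_eq_xxxx)
  finally show "(v s has_real_derivative j x s * ((\<kappa> * (x * \<eta> x s) - m x / (x * \<eta> x s)^2) / 4)) (at x)"
    by (rule DERIV_cong[OF D])
qed

text \<open>In the Eulerian radius \<open>r = x \<eta>\<close> the deformed profile solves a Lane-Emden equation with the same total mass as \<open>\<rho>\<close>,
  so it is a mere rescaling of \<open>\<rho>\<close>.\<close>
lemma inviscid_homogeneous:
  assumes B0: "\<And>x s. x \<in> {0..R0} \<Longrightarrow> s > 0 \<Longrightarrow> B x s = 0" and s: "s > 0" and x: "x \<in> {0..R0}"
  shows "\<eta> x s = \<eta> 0 s"
proof -
  have s0: "s \<ge> 0" using s by simp
  have zi: "0 \<in> {0..R0}" and Ri: "R0 \<in> {0..R0}" using R0_pos by auto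
  \<comment> \<open>This value matches the centres: at the origin \<open>q = c ^ 3\<close>, so the
    deformed profile starts at \<open>1 / c\<close>, as does \<open>\<rho>\<close> rescaled by
    \<open>c\<close>.\<close>
  define c where "c = \<eta> 0 s"
  have c: "c > 0" using \<eta>_pos[OF zi s0] by (simp add: c_def)
  obtain \<kappa> where dv: "\<And>x. x \<in> {0<..<R0} \<Longrightarrow>
    (v s has_real_derivative j x s * ((\<kappa> * (x * \<eta> x s) - m x / (x * \<eta> x s)^2) / 4)) (at x)"
    using v_DERIV[OF B0 s] by blast
  define r where "r x = x * \<eta> x s" for x
  have dr: "(r has_real_derivative j x s) (at x)" if "x \<in> {0..R0}" for x
    unfolding r_def j_def by (rule DERIV_cong, rule DERIV_mult[OF DERIV_ident partials(1)[OF that s0]]) simp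
  have cr: "continuous_on {0..R0} r"
    unfolding r_def[abs_def] using cont2_slice[OF cont2_base(1) s0] by (intro continuous_intros)
  have rmono: "r x < r y" if "x \<in> {0..R0}" "y \<in> {0..R0}" "x < y" for x y
  proof (rule DERIV_pos_imp_increasing_open[OF that(3)])
    show "\<exists>d. (r has_real_derivative d) (at z) \<and> 0 < d" if "x < z" "z < y" for z
      using dr[of z] j_pos[of z s] s0 that \<open>x \<in> _\<close> \<open>y \<in> _\<close> by (intro exI[of _ "j z s"]) auto
  qed (use that in \<open>auto intro: continuous_on_subset[OF cr]\<close>)
  have inj: "inj_on r {0..R0}"
    by (rule linorder_inj_onI) (use rmono in \<open>auto dest: less_imp_neq\<close>)
  define R2 where "R2 = r R0"
  have r0: "r 0 = 0" by (simp add: r_def)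
  have R2: "R2 > 0" using rmono[OF zi Ri R0_pos] by (simp add: R2_def r0)
  have img: "r ` {0..R0} = {0..R2}"
  proof
    show "r ` {0..R0} \<subseteq> {0..R2}"
    proof
      fix y assume "y \<in> r ` {0..R0}"
      then obtain x where x: "x \<in> {0..R0}" "y = r x" by blast
      have "r 0 \<le> r x" using rmono[OF zi x(1)] x(1) by (cases "x = 0") auto
      moreover have "r x \<le> r R0" using rmono[OF x(1) Ri] x(1) by (cases "x = R0") auto
      ultimately show "y \<in> {0..R2}" using x by (simp add: r0 R2_def)
    qed
    show "{0..R2} \<subseteq> r ` {0..R0}"
    proof
      fix y assume "y \<in> {0..R2}"
      then obtain x where "0 \<le> x" "x \<le> R0" "r x = y"
        using IVT'[of r 0 y R0] cr R0_pos by (auto simp: r0 R2_def)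
      then show "y \<in> r ` {0..R0}" by force
    qed
  qed
  define X where "X = inv_into {0..R0} r"
  have Xr: "X (r x) = x" if "x \<in> {0..R0}" for x
    unfolding X_def using inv_into_f_f[OF inj that] .
  have rX: "r (X y) = y" and Xi: "X y \<in> {0..R0}" if "y \<in> {0..R2}" for y
    using that f_inv_into_f[of y r "{0..R0}"] inv_into_into[of y r "{0..R0}"] img by (auto simp: X_def)
  have cX: "continuous_on {0..R2} X"
    unfolding img[symmetric] by (rule continuous_on_inv[OF cr compact_Icc]) (use Xr in blast)
  have X0: "X 0 = 0" "X R2 = R0" using Xr[OF zi] Xr[OF Ri] by (auto simp: r0 R2_def)
  have Xint: "X y \<in> {0<..<R0}" if "y \<in> {0<..<R2}" for y
  proof -
    have "X y \<noteq> 0" "X y \<noteq> R0" using rX[of y] that r0 R2_def by auto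
    then show ?thesis using Xi[of y] that by auto
  qed
  have dX: "(X has_real_derivative inverse (j (X y) s)) (at y)" if y: "y \<in> {0<..<R2}" for y
  proof (rule DERIV_inverse_function[where f = r and a = 0 and b = R2])
    have Xy: "X y \<in> {0..R0}" using Xint[OF y] by auto
    show "(r has_real_derivative j (X y) s) (at (X y))" by (rule dr[OF Xy])
    show "j (X y) s \<noteq> 0" using j_pos[OF Xy s0] by simp
    show "isCont X y" using cX y by (intro continuous_on_interior[OF cX]) auto
  qed (use y rX in auto)
  have Ximg: "X ` {0..R2} \<subseteq> {0..R0}" using Xi by auto
  have LE2: "lane_emden \<kappa> (1 / c) R2 (\<lambda>y. v s (X y)) (\<lambda>y. m (X y))"
    unfolding lane_emden_def
  proof (intro conjI ballI)
    show "continuous_on {0..R2} (\<lambda>y. v s (X y))"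
      by (rule continuous_on_compose2[OF v_cont[OF s0] cX Ximg])
    show "continuous_on {0..R2} (\<lambda>y. m (X y))"
      by (rule continuous_on_compose2[OF m_cont cX Ximg])
    have "q 0 s = c ^ 3" by (simp add: q_def j_def c_def power2_eq_square power3_eq_cube)
    then have "q 0 s powr (-1/3) = (c powr 3) powr (-1/3)" using c by (simp flip: powr_numeral)
    also have "\<dots> = c powr (-1)" by (simp only: powr_powr) simp
    finally show "v s (X 0) = 1 / c" using c by (simp add: X0 v_def w_0 powr_minus_divide)
    show "v s (X R2) = 0" by (simp add: X0 v_def w_R0)
    show "0 < v s (X y)" if "y \<in> {0..<R2}" for y
    proof -
      have "X y \<noteq> R0" using rX[of y] that R2_def by auto
      then have "X y \<in> {0..<R0}" using Xi[of y] that by auto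
      then show ?thesis using w_pos[of "X y"] q_pos[of "X y" s] s0 by (auto simp: v_def)
    qed
    fix y assume y: "y \<in> {0<..<R2}"
    have Xy: "X y \<in> {0<..<R0}" by (rule Xint[OF y])
    then have Xy': "X y \<in> {0..R0}" by simp
    have jp: "j (X y) s > 0" by (rule j_pos[OF Xy' s0])
    have re: "X y * \<eta> (X y) s = y" using rX[of y] y by (simp add: r_def)
    show "((\<lambda>y. v s (X y)) has_real_derivative (\<kappa> * y - m (X y) / y^2) / 4) (at y)"
      by (rule DERIV_cong[OF DERIV_chain2[OF dv[OF Xy] dX[OF y]]]) (use jp in \<open>simp add: re\<close>)
    have vq: "v s (X y) ^ 3 = w (X y) ^ 3 / q (X y) s" by (rule v_cubed[OF Xy' s0])
    have "X y ^ 2 * w (X y) ^ 3 * inverse (j (X y) s) = y^2 * v s (X y) ^ 3"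
      unfolding vq q_def using \<eta>_pos[OF Xy' s0] jp
      by (subst re[symmetric]) (simp add: field_simps power2_eq_square)
    then show "((\<lambda>y. m (X y)) has_real_derivative y^2 * v s (X y) ^ 3) (at y)"
      using DERIV_chain2[OF m_DERIV[OF Xy] dX[OF y]] by simp
  qed (use R2 c in \<open>auto simp: X0 m_def\<close>)
  have mass: "m (c * R0 / c) = m (X R2)" using c by (simp add: X0)
  note same = lane_emden_same_mass[OF lane_emden_scaled[OF c] LE2 mass]
  have "r x \<in> {0..R2}" using img x by blast
  then have mm: "m (r x / c) = m x" using same(2)[of "r x"] same(1) Xr[OF x] by simp
  have "r x / c \<in> {0..R0}"
    using \<open>r x \<in> {0..R2}\<close> same(1) c by (auto simp: field_simps)
  \<comment> \<open>A label is determined by the mass it encloses, since \<open>m\<close> is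
    strictly increasing.\<close>
  then have "r x / c = x"
    using mm x m_strict_mono[of "r x / c" x] m_strict_mono[of x "r x / c"] by (cases "r x / c" x rule: linorder_cases) auto
  then show ?thesis using c by (cases "x = 0") (auto simp: r_def c_def field_simps)
qed

text \<open>The equation is used only at positive times, so its consequences reach the initial data
  by continuity.\<close>

lemma equal_at_initial_time:
  assumes "cont2 f" "x \<in> {0..R0}" "\<And>s. s > 0 \<Longrightarrow> f x s = f 0 s"
  shows "f x 0 = f 0 0"
proof -
  have z: "0 \<in> {0..R0}" using R0_pos by simp
  have "f x 0 - f 0 0 = 0"
  proof (rule continuous_constant_on_closure[where S = "{0<..}" and f = "\<lambda>s. f x s - f 0 s"])
    show "continuous_on (closure {0::real<..}) (\<lambda>s. f x s - f 0 s)"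
      using cont2_slice_time[OF assms(1,2)] cont2_slice_time[OF assms(1) z]
      by (auto intro: continuous_intros)
  qed (use assms(3) in auto)
  then show ?thesis by simp
qed

section \<open>Rigidity at zero energy\<close>

lemma zero_energy_homogeneous:
  assumes E0: "\<And>s. s \<ge> 0 \<Longrightarrow> calE s = 0" and x: "x \<in> {0..R0}"
  shows "\<eta> x 0 = \<eta> 0 0" and "\<eta>s x 0 = \<eta>s 0 0"
proof -
  have B0: "B x s = 0" if x: "x \<in> {0..R0}" and s: "s > 0" for x s
  proof -
    have s0: "s \<ge> 0" using s by simp
    have "((\<lambda>s. exp (- b * s) * calE s) has_real_derivative 0) (at s)"
      by (rule has_field_derivative_transform_within_open[OF DERIV_const open_greaterThan, of s 0])
        (use s E0 in auto)
    then have "exp (- b * s) * (A s * (3 / (4 * \<mu>) * diss s)) = 0"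
      using DERIV_unique[OF scaled_calE_DERIV[OF s]] by fastforce
    then have "integral {0..R0} (\<lambda>x. x^2 * q x s * B x s ^ 2) = 0"
      using mu_pos a0_pos by (simp add: A_def diss_def)
    then have "\<forall>x\<in>{0..R0}. x^2 * q x s * B x s ^ 2 = 0"
      using integral_eq_0_iff[OF diss_cont[OF s0] R0_pos] q_pos[OF _ s0] by (auto simp: less_imp_le)
    then have "x = 0 \<or> B x s = 0" using x q_pos[OF x s0] by auto
    \<comment> \<open>The weight \<open>x^2\<close> of the dissipation gives no information at the
      centre, where \<open>B\<close> vanishes by its formula.\<close>
    moreover have "B 0 s = 0" by (simp add: B_eq j_def)
    ultimately show ?thesis by auto
  qed
  have e: "\<eta> x s = \<eta> 0 s" if "s > 0" for s
    by (rule inviscid_homogeneous[OF B0 that x])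
  have es: "\<eta>s x s = \<eta>s 0 s" if "s > 0" for s
    using separated_rate[OF that B0 x] e[OF that] \<eta>_pos[OF x, of s] that by simp
  show "\<eta> x 0 = \<eta> 0 0" by (rule equal_at_initial_time[OF cont2_base(1) x e])
  show "\<eta>s x 0 = \<eta>s 0 0" by (rule equal_at_initial_time[OF cont2_base(3) x es])
qed

lemma nonpositive_energy_escapes:
  assumes "calE 0 \<le> 0" and inhom: "\<not> (\<exists>c0 c1. \<forall>x\<in>{0..R0}. \<phi> x 0 = c0 \<and> pds \<phi> x 0 = c1)"
  shows "\<exists>S\<ge>0. \<forall>s>S. \<exists>x\<in>{0..R0}. \<bar>\<phi> x s\<bar> \<ge> 1/2"
proof (rule ccontr)
  assume no: "\<not> ?thesis"
  have E0: "calE s = 0" if s: "s \<ge> 0" for s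
  proof -
    have "exp (- b * s) * calE s \<le> exp (- b * 0) * calE 0" by (rule scaled_calE_antimono[OF order_refl s])
    then have "exp (- b * s) * calE s \<le> 0" using assms(1) by simp
    then have "calE s \<le> 0" by (simp add: mult_le_0_iff not_le)
    moreover have "\<not> calE s < 0" using negative_energy_escapes[OF s] no by blast
    ultimately show ?thesis by simp
  qed
  have "\<forall>x\<in>{0..R0}. \<phi> x 0 = \<phi> 0 0 \<and> pds \<phi> x 0 = pds \<phi> 0 0"
  proof
    fix x assume x: "x \<in> {0..R0}"
    have "\<eta> x 0 = \<eta> 0 0" by (rule zero_energy_homogeneous(1)[OF E0 x])
    moreover have "\<eta>s x 0 = \<eta>s 0 0" by (rule zero_energy_homogeneous(2)[OF E0 x])
    ultimately show "\<phi> x 0 = \<phi> 0 0 \<and> pds \<phi> x 0 = pds \<phi> 0 0"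
      by (simp only: \<eta>_def \<eta>s_def) simp
  qed
  then show False using inhom by blast
qed

end


section \<open>Homogeneous data\<close>

context perturbed_star begin

section \<open>Deviation from the homogeneous motion with the same moment of inertia\<close>

definition "P1 = mom \<eta>"
definition "Q1 = mom \<eta>s"
definition "\<xi> s = sqrt (N s / M)"
text \<open>The homogeneous motion \<open>\<xi>\<close> has rate \<open>n / (M * \<xi>)\<close> and
  hence kinetic energy \<open>n ^ 2 / (2 * N)\<close>.\<close>

definition "kin_excess s = K s / 2 - n s ^ 2 / (2 * N s)"
definition "grav_excess s = L s - M / \<xi> s"
text \<open>The bracket is \<open>calE\<close> evaluated on the homogeneous motion
  \<open>\<xi>\<close>: the values of \<open>N\<close> and \<open>n\<close> agree, and
  \<open>PI\<close> is zero there.\<close>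

definition "H s = calE s - (n s ^ 2 / (2 * N s) + b * n s + \<bar>\<delta>\<bar> * N s - \<bar>\<delta>\<bar> * M / \<xi> s)"
text \<open>The weighted integral of \<open>(\<eta> / \<xi> - 1)^2\<close>, expanded with
  \<open>M * \<xi> ^ 2 = N\<close>.\<close>

definition "Y s = 2 * M - 2 * P1 s / \<xi> s"

text \<open>A single quadratic identity with free coefficients; suitable choices give the
  Cauchy-Schwarz bound for the kinetic excess, the sign of \<open>Y\<close>, and the estimate of its
  derivative.\<close>

lemma mom_square:
  assumes s: "s \<ge> 0"
  shows "mom (\<lambda>x s. (\<alpha> * \<eta> x s + \<beta> * \<eta>s x s + \<gamma>)^2) s
    = \<alpha>^2 * N s + \<beta>^2 * K s + \<gamma>^2 * M + 2 * \<alpha> * \<beta> * n s + 2 * \<alpha> * \<gamma> * P1 s + 2 * \<beta> * \<gamma> * Q1 s"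
    (is "?l = ?r")
    and "0 \<le> \<alpha>^2 * N s + \<beta>^2 * K s + \<gamma>^2 * M + 2 * \<alpha> * \<beta> * n s + 2 * \<alpha> * \<gamma> * P1 s + 2 * \<beta> * \<gamma> * Q1 s"
proof -
  have "M = mom (\<lambda>x s. 1) s" by (simp add: M_def mom_def)
  then have I: "((\<lambda>x. \<alpha>^2 * ((x^4 * \<rho> x) * \<eta> x s ^ 2) + \<beta>^2 * ((x^4 * \<rho> x) * \<eta>s x s ^ 2) + \<gamma>^2 * ((x^4 * \<rho> x) * 1)
      + 2 * \<alpha> * \<beta> * ((x^4 * \<rho> x) * (\<eta> x s * \<eta>s x s)) + 2 * \<alpha> * \<gamma> * ((x^4 * \<rho> x) * \<eta> x s)
      + 2 * \<beta> * \<gamma> * ((x^4 * \<rho> x) * \<eta>s x s)) has_integral ?r) {0..R0}"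
    unfolding N_def K_def n_def P1_def Q1_def
    by (simp only:) (intro has_integral_add has_integral_mult_right mom_has_integral cont2_mono cont2_base s)
  have e: "(\<lambda>x. \<alpha>^2 * ((x^4 * \<rho> x) * \<eta> x s ^ 2) + \<beta>^2 * ((x^4 * \<rho> x) * \<eta>s x s ^ 2) + \<gamma>^2 * ((x^4 * \<rho> x) * 1)
      + 2 * \<alpha> * \<beta> * ((x^4 * \<rho> x) * (\<eta> x s * \<eta>s x s)) + 2 * \<alpha> * \<gamma> * ((x^4 * \<rho> x) * \<eta> x s)
      + 2 * \<beta> * \<gamma> * ((x^4 * \<rho> x) * \<eta>s x s)) = (\<lambda>x. (x^4 * \<rho> x) * (\<alpha> * \<eta> x s + \<beta> * \<eta>s x s + \<gamma>)^2)"
    by (simp add: fun_eq_iff algebra_simps power2_eq_square)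
  show l: "?l = ?r"
    by (rule mom_eqI) (rule I[unfolded e])
  show "0 \<le> ?r"
    by (rule has_integral_nonneg[OF I[unfolded e]]) (simp add: weight_nonneg)
qed

lemma N_lower:
  assumes "s \<ge> 0" "e > 0" "\<And>x. x \<in> {0..R0} \<Longrightarrow> \<eta> x s \<ge> e"
  shows "N s \<ge> e^2 * M"
proof -
  have "mom (\<lambda>x s. e^2) s \<le> N s"
    unfolding N_def using assms by (intro mom_mono cont2_mono power_mono) auto
  then show ?thesis using mom_const[of "\<lambda>_. e^2"] by simp
qed

lemma N_pos: assumes s: "s \<ge> 0" shows "N s > 0"
proof -
  obtain y where y: "y \<in> {0..R0}" "\<And>x. x \<in> {0..R0} \<Longrightarrow> \<eta> y s \<le> \<eta> x s"
    using continuous_attains_inf[OF compact_Icc, of 0 R0 "\<lambda>x. \<eta> x s"] cont2_slice[OF cont2_base(1) s] R0_pos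
    by auto
  have "\<eta> y s > 0" by (rule \<eta>_pos[OF y(1) s])
  then have "0 < (\<eta> y s)^2 * M" "(\<eta> y s)^2 * M \<le> N s" using N_lower[OF s _ y(2)] M_pos by auto
  then show ?thesis by simp
qed

lemma \<xi>_pos: "s \<ge> 0 \<Longrightarrow> \<xi> s > 0"
  using N_pos M_pos by (simp add: \<xi>_def)

lemma \<xi>_sq: "s \<ge> 0 \<Longrightarrow> M * \<xi> s ^ 2 = N s"
  using N_pos[of s] M_pos by (simp add: \<xi>_def)

lemma \<xi>_DERIV:
  assumes s: "s \<ge> 0"
  shows "(\<xi> has_real_derivative n s / (M * \<xi> s)) (at s within {0..})"
proof -
  have "((\<lambda>s. N s / M) has_real_derivative 2 * n s / M) (at s within {0..})"
    by (intro DERIV_cdivide N_DERIV s)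
  moreover have "N s / M > 0" using N_pos[OF s] M_pos by simp
  ultimately have "((\<lambda>s. sqrt (N s / M)) has_real_derivative
      inverse (sqrt (N s / M)) / 2 * (2 * n s / M)) (at s within {0..})"
    by (intro DERIV_chain2[OF DERIV_real_sqrt])
  then have "(\<xi> has_real_derivative inverse (\<xi> s) / 2 * (2 * n s / M)) (at s within {0..})"
    unfolding \<xi>_def[abs_def] .
  then show ?thesis
    by (rule DERIV_cong) (use \<xi>_pos[OF s] M_pos in \<open>simp add: field_simps\<close>)
qed

lemma H_eq: "H s = kin_excess s + PI s - \<bar>\<delta>\<bar> * grav_excess s"
  by (simp add: H_def kin_excess_def grav_excess_def calE_def algebra_simps)

text \<open>Cauchy-Schwarz: twice the excess is the integral of the square of
  \<open>\<eta>s - n / N * \<eta>\<close>.\<close>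

lemma kin_excess_nonneg: assumes s: "s \<ge> 0" shows "kin_excess s \<ge> 0"
  using mom_square(2)[OF s, of "- n s / N s" 1 0] N_pos[OF s]
  by (simp add: kin_excess_def field_simps power2_eq_square)

lemma Y_eq: assumes s: "s \<ge> 0" shows "mom (\<lambda>x s'. (1 / \<xi> s * \<eta> x s' + 0 * \<eta>s x s' + - 1)^2) s = Y s"
  unfolding mom_square(1)[OF s] using \<xi>_sq[OF s, symmetric] \<xi>_pos[OF s]
  by (simp add: Y_def field_simps power2_eq_square)

lemma Y_nonneg: "s \<ge> 0 \<Longrightarrow> Y s \<ge> 0"
  using mom_square(2)[of s "1 / \<xi> s" 0 "- 1"] Y_eq[of s] mom_square(1)[of s "1 / \<xi> s" 0 "- 1"] by simp

text \<open>The bracket at the end equals \<open>M \<xi> (\<xi>'' + b/2 \<xi>' - |\<delta>| \<xi> + |\<delta>| \<xi>\<^sup>-\<^sup>2)\<close>, which vanishes for homogeneous motions.\<close>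
lemma H_DERIV:
  assumes s: "s > 0"
  shows "(H has_real_derivative b * H s - A s * (3 / (4 * \<mu>) * diss s)
    - (n s / N s + b) * (2 * kin_excess s + PI s - \<bar>\<delta>\<bar> * grav_excess s)) (at s within {0..})"
proof -
  have s0: "s \<ge> 0" using s by simp
  define n' where "n' = K s + mom (\<lambda>x s. \<eta> x s * \<eta>ss x s) s"
  define u where "u = \<xi> s"
  have u: "u > 0" "N s = M * u^2" using \<xi>_pos[OF s0] \<xi>_sq[OF s0] by (auto simp: u_def)
  have Np: "N s \<noteq> 0" using N_pos[OF s0] by simp
  have d: "\<bar>\<delta>\<bar> = b * b / 2" using b_sq delta_neg by simp
  have dn: "(n has_real_derivative n') (at s within {0..})" unfolding n'_def by (rule n_DERIV[OF s0])
  have "(H has_real_derivative b * calE s - A s * (3 / (4 * \<mu>) * diss s)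
    - ((2 * n s * n' * (2 * N s) - n s ^ 2 * (2 * (2 * n s))) / (2 * N s * (2 * N s)) + b * n' + \<bar>\<delta>\<bar> * (2 * n s)
       - (- (\<bar>\<delta>\<bar> * M * (n s / (M * \<xi> s))) / (\<xi> s * \<xi> s)))) (at s within {0..})"
  proof -
    have 1: "((\<lambda>s. n s ^ 2 / (2 * N s)) has_real_derivative
      (2 * n s * n' * (2 * N s) - n s ^ 2 * (2 * (2 * n s))) / (2 * N s * (2 * N s))) (at s within {0..})"
      using DERIV_divide[OF DERIV_power[OF dn, of 2] DERIV_cmult[OF N_DERIV[OF s0], of 2]] Np
      by (simp add: mult_ac)
    have 2: "((\<lambda>s. \<bar>\<delta>\<bar> * M / \<xi> s) has_real_derivative - (\<bar>\<delta>\<bar> * M * (n s / (M * \<xi> s))) / (\<xi> s * \<xi> s)) (at s within {0..})"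
      using DERIV_divide[OF DERIV_const \<xi>_DERIV[OF s0], of "\<bar>\<delta>\<bar> * M"] \<xi>_pos[OF s0] by simp
    show ?thesis unfolding H_def[abs_def]
      by (intro DERIV_diff DERIV_add calE_DERIV s 1 2 DERIV_cmult dn N_DERIV s0)
  qed
  moreover have "n' = (2 * kin_excess s + PI s - \<bar>\<delta>\<bar> * grav_excess s) + n s ^ 2 / N s - b / 2 * n s + \<bar>\<delta>\<bar> * N s - \<bar>\<delta>\<bar> * (M / u)"
    unfolding n'_def virial[OF s] kin_excess_def grav_excess_def u_def[symmetric] by (simp add: algebra_simps)
  moreover have "b * calE s = b * H s + b * (n s ^ 2 / (2 * N s) + b * n s + \<bar>\<delta>\<bar> * N s - \<bar>\<delta>\<bar> * (M / u))"
    unfolding H_def u_def[symmetric] by (simp add: algebra_simps)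
  ultimately have D: "(H has_real_derivative b * H s + b * (n s ^ 2 / (2 * N s) + b * n s + \<bar>\<delta>\<bar> * N s - \<bar>\<delta>\<bar> * (M / u))
    - A s * (3 / (4 * \<mu>) * diss s)
    - ((2 * n s * n' * (2 * N s) - n s ^ 2 * (2 * (2 * n s))) / (2 * N s * (2 * N s)) + b * n' + \<bar>\<delta>\<bar> * (2 * n s)
       - (- (\<bar>\<delta>\<bar> * M * (n s / (M * u))) / (u * u)))) (at s within {0..})"
    and n': "n' = (2 * kin_excess s + PI s - \<bar>\<delta>\<bar> * grav_excess s) + n s ^ 2 / N s - b / 2 * n s + \<bar>\<delta>\<bar> * N s - \<bar>\<delta>\<bar> * (M / u)"
    unfolding u_def by simp_all
  define Z where "Z = 2 * kin_excess s + PI s - \<bar>\<delta>\<bar> * grav_excess s"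
  show ?thesis
    by (rule DERIV_cong[OF D]) (unfold n' Z_def[symmetric], use u M_pos in \<open>simp add: d field_simps power2_eq_square\<close>)
qed

text \<open>As \<open>(\<eta> / \<xi>)' = (\<eta>s - n / N * \<eta>) / \<xi>\<close>, the derivative
  of \<open>Y\<close> is twice the integral of this times \<open>\<eta> / \<xi> - 1\<close>. The
  bound is \<open>2 * a * b \<le> a^2 + b^2\<close>, obtained from \<open>mom_square\<close> for the
  difference of the two factors.\<close>

lemma Y_DERIV:
  assumes s: "s \<ge> 0"
  shows "(Y has_real_derivative - 2 * Q1 s / \<xi> s + 2 * P1 s * n s / (N s * \<xi> s)) (at s within {0..})"
    (is "(Y has_real_derivative ?D) _")
    and "- 2 * Q1 s / \<xi> s + 2 * P1 s * n s / (N s * \<xi> s) \<le> Y s + 2 * kin_excess s / \<xi> s ^ 2"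
proof -
  define u where "u = \<xi> s"
  have u: "u > 0" "N s = M * u^2" using \<xi>_pos[OF s] \<xi>_sq[OF s] by (auto simp: u_def)
  have dP: "(P1 has_real_derivative Q1 s) (at s within {0..})"
    unfolding P1_def Q1_def using s by (intro mom_DERIV cont2_base) (auto intro: partials)
  have "(Y has_real_derivative 0 - (2 * Q1 s * \<xi> s - 2 * P1 s * (n s / (M * \<xi> s))) / (\<xi> s * \<xi> s)) (at s within {0..})"
    unfolding Y_def[abs_def]
    by (intro DERIV_diff DERIV_const DERIV_divide DERIV_cmult dP \<xi>_DERIV s) (use \<xi>_pos[OF s] in simp)
  then show "(Y has_real_derivative ?D) (at s within {0..})"
    by (rule DERIV_cong) (unfold u_def[symmetric], use u M_pos in \<open>simp add: field_simps power2_eq_square\<close>)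
  have "0 \<le> (1 / u + n s / (N s * u))^2 * N s + (- 1 / u)^2 * K s + (- 1)^2 * M
    + 2 * (1 / u + n s / (N s * u)) * (- 1 / u) * n s + 2 * (1 / u + n s / (N s * u)) * (- 1) * P1 s
    + 2 * (- 1 / u) * (- 1) * Q1 s"
    by (rule mom_square(2)[OF s])
  also have "\<dots> = Y s + 2 * kin_excess s / u ^ 2 - ?D"
    unfolding Y_def kin_excess_def u_def[symmetric] u(2) using u(1) M_pos
    by (simp add: field_simps power2_eq_square)
  finally show "?D \<le> Y s + 2 * kin_excess s / \<xi> s ^ 2" by (simp add: u_def)
qed

lemma grav_excess_bounds:
  assumes s: "s \<ge> 0" and e: "e > 0" "\<And>x. x \<in> {0..R0} \<Longrightarrow> \<eta> x s \<ge> e"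
  shows "0 \<le> grav_excess s" and "grav_excess s \<le> 2 / e * Y s" and "\<xi> s \<ge> e"
proof -
  define u where "u = \<xi> s"
  have u: "u > 0" "N s = M * u^2" using \<xi>_pos[OF s] \<xi>_sq[OF s] by (auto simp: u_def)
  have "e^2 \<le> u^2" using N_lower[OF s e] M_pos u by simp
  then have eu: "e \<le> u" by (rule power2_le_imp_le) (use u(1) in simp)
  then show "\<xi> s \<ge> e" by (simp add: u_def)
  \<comment> \<open>The added multiple of \<open>\<eta>^2 / u^2 - 1\<close> integrates to zero
    because \<open>N = M * u^2\<close>. It cancels the first-order part of \<open>1 / \<eta>\<close>
    at \<open>u\<close>, leaving the perfect square in \<open>pt\<close>.\<close>
  have "((\<lambda>x. (x^4 * \<rho> x) * (1 / \<eta> x s) - 1 / u * ((x^4 * \<rho> x) * 1)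
        + 1 / (2 * u) * (1 / u^2 * ((x^4 * \<rho> x) * \<eta> x s ^ 2) - (x^4 * \<rho> x) * 1))
      has_integral L s - 1 / u * mom (\<lambda>x s. 1) s + 1 / (2 * u) * (1 / u^2 * N s - mom (\<lambda>x s. 1) s)) {0..R0}"
    unfolding L_def N_def
    by (intro has_integral_add has_integral_diff has_integral_mult_right mom_has_integral cont2_mono s)
  moreover have "L s - 1 / u * mom (\<lambda>x s. 1) s + 1 / (2 * u) * (1 / u^2 * N s - mom (\<lambda>x s. 1) s) = grav_excess s"
    using mom_const[of "\<lambda>_. 1" s] u by (simp add: grav_excess_def u_def[symmetric])
  ultimately have I: "((\<lambda>x. (x^4 * \<rho> x) * (1 / \<eta> x s) - 1 / u * ((x^4 * \<rho> x) * 1)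
        + 1 / (2 * u) * (1 / u^2 * ((x^4 * \<rho> x) * \<eta> x s ^ 2) - (x^4 * \<rho> x) * 1)) has_integral grav_excess s) {0..R0}"
    by simp
  have J: "((\<lambda>x. 2 / e * ((x^4 * \<rho> x) * (1 / u * \<eta> x s + 0 * \<eta>s x s + - 1)^2)) has_integral 2 / e * Y s) {0..R0}"
  proof -
    have "cont2 (\<lambda>x s'. (1 / \<xi> s * \<eta> x s' + 0 * \<eta>s x s' + - 1)^2)"
      unfolding cont2_def by (intro continuous_intros)
    from has_integral_mult_right[OF mom_has_integral[OF this s], of "2 / e"] show ?thesis
      unfolding Y_eq[OF s] u_def .
  qed
  have pt: "(x^4 * \<rho> x) * (1 / \<eta> x s) - 1 / u * ((x^4 * \<rho> x) * 1)
        + 1 / (2 * u) * (1 / u^2 * ((x^4 * \<rho> x) * \<eta> x s ^ 2) - (x^4 * \<rho> x) * 1)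
      = (1 / (2 * u) + 1 / \<eta> x s) * ((x^4 * \<rho> x) * (1 / u * \<eta> x s + 0 * \<eta>s x s + - 1)^2)"
    if x: "x \<in> {0..R0}" for x
    using u(1) \<eta>_pos[OF x s] by (simp add: field_simps power2_eq_square)
  have nn: "(x^4 * \<rho> x) * (1 / u * \<eta> x s + 0 * \<eta>s x s + - 1)^2 \<ge> 0" if "x \<in> {0..R0}" for x
    using weight_nonneg[OF that] by simp
  have co: "0 \<le> 1 / (2 * u) + 1 / \<eta> x s" "1 / (2 * u) + 1 / \<eta> x s \<le> 2 / e" if x: "x \<in> {0..R0}" for x
  proof -
    show "0 \<le> 1 / (2 * u) + 1 / \<eta> x s" using u(1) \<eta>_pos[OF x s] by simp
    have "1 / (2 * u) \<le> 1 / e" using u(1) eu e(1) by (intro divide_left_mono) auto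
    moreover have "1 / \<eta> x s \<le> 1 / e" using e(1) e(2)[OF x] by (intro divide_left_mono) auto
    ultimately show "1 / (2 * u) + 1 / \<eta> x s \<le> 2 / e" by simp
  qed
  show "0 \<le> grav_excess s"
    by (rule has_integral_nonneg[OF I]) (unfold pt, intro mult_nonneg_nonneg co nn)
  show "grav_excess s \<le> 2 / e * Y s"
    by (rule has_integral_le[OF I J]) (unfold pt, intro mult_right_mono co nn)
qed

lemma homogeneous_slice:
  assumes s: "s \<ge> 0" and "\<forall>x\<in>{0..R0}. \<eta> x s = c" and "\<forall>x\<in>{0..R0}. \<eta>s x s = c'"
  shows "N s = c^2 * M" "n s = c * c' * M" "K s = c'^2 * M" "L s = M / c" "P1 s = c * M" "PI s = 0"
    "diss s = 0"
proof -
  have h: "\<eta> x s = c" and h': "\<eta>s x s = c'" if "x \<in> {0..R0}" for x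
    using assms that by auto
  have cg: "mom f s = mom g s" if "\<And>x. x \<in> {0..R0} \<Longrightarrow> f x s = g x s" for f g
    unfolding mom_def using that by (intro integral_cong) simp
  have c: "mom (\<lambda>x s. k) s = k * M" for k using mom_const[of "\<lambda>_. k"] by simp
  show "N s = c^2 * M" unfolding N_def by (subst cg[of _ "\<lambda>x s. c^2"]) (auto simp: h c)
  show "n s = c * c' * M" unfolding n_def by (subst cg[of _ "\<lambda>x s. c * c'"]) (auto simp: h h' c)
  show "K s = c'^2 * M" unfolding K_def by (subst cg[of _ "\<lambda>x s. c'^2"]) (auto simp: h' c)
  show "L s = M / c" unfolding L_def by (subst cg[of _ "\<lambda>x s. 1 / c"]) (auto simp: h c)
  show "P1 s = c * M" unfolding P1_def by (subst cg[of _ "\<lambda>x s. c"]) (auto simp: h c)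
  have zi: "0 \<in> {0..R0}" using R0_pos by simp
  have cp: "c > 0" using \<eta>_pos[OF zi s] h[OF zi] by simp
  \<comment> \<open>Spatial derivatives are computed in the open interval only. At the ends the
    integrands vanish anyway, through the factor \<open>x\<close>, \<open>\<rho> R0 = 0\<close> or
    the boundary condition.\<close>
  have ex: "\<eta>x x s = 0" "\<eta>xs x s = 0" if x: "x \<in> {0<..<R0}" for x
  proof -
    have xi: "x \<in> {0..R0}" using x by simp
    have "((\<lambda>y. \<eta> y s) has_real_derivative 0) (at x)"
      by (rule has_field_derivative_transform_within_open[OF DERIV_const open_greaterThanLessThan x])
        (simp add: h)
    then show "\<eta>x x s = 0" using DERIV_unique[OF partials(1)[OF xi s]] by simp
    have "((\<lambda>y. \<eta>s y s) has_real_derivative 0) (at x)"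
      by (rule has_field_derivative_transform_within_open[OF DERIV_const open_greaterThanLessThan x])
        (simp add: h')
    then show "\<eta>xs x s = 0" using DERIV_unique[OF partials(3)[OF xi s]] by simp
  qed
  have "PI s = integral {0..R0} (\<lambda>x. 0)"
    unfolding PI_def
  proof (rule integral_cong)
    fix x assume x: "x \<in> {0..R0}"
    show "(x^2 * \<rho> x powr (4/3)) * pint x s = 0"
    proof (cases "x = 0 \<or> x = R0")
      case False
      then have x': "x \<in> {0<..<R0}" using x by auto
      have "q x s = c ^ 3" using ex[OF x'] h[OF x] by (simp add: q_def j_def power2_eq_square power3_eq_cube)
      also have "\<dots> = c powr 3" using cp by (simp flip: powr_numeral)
      finally have "q x s powr (-1/3) = c powr (3 * (-1/3))" by (simp only: powr_powr)
      also have "\<dots> = 1 / c" using cp by (simp add: powr_minus_divide)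
      finally show ?thesis using ex[OF x'] h[OF x] by (simp add: pint_def)
    qed (use rho_R0 in auto)
  qed
  then show "PI s = 0" by simp
  have "diss s = integral {0..R0} (\<lambda>x. 0)"
    unfolding diss_def
  proof (rule integral_cong)
    fix x assume x: "x \<in> {0..R0}"
    show "x^2 * q x s * B x s ^ 2 = 0"
    proof (cases "x = 0 \<or> x = R0")
      case False
      then have x': "x \<in> {0<..<R0}" using x by auto
      show ?thesis using ex[OF x'] by (simp add: B_eq j_def)
    qed (use bc s in \<open>auto simp: B_def\<close>)
  qed
  then show "diss s = 0" by simp
qed

text \<open>Gronwall's inequality for \<open>H + \<Lambda> Y\<close>. The variance \<open>Y\<close> is added because \<open>H\<close>, the excess of the energy over that of
  the homogeneous motion with the same moment of inertia, need not be positive.\<close>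
lemma homogeneous_data_unique:
  assumes h0: "\<And>x. x \<in> {0..R0} \<Longrightarrow> \<eta> x 0 = c" and h1: "\<And>x. x \<in> {0..R0} \<Longrightarrow> \<eta>s x 0 = c'"
    and T: "T > 0" and x: "x \<in> {0<..<R0}"
  shows "\<eta> x T = \<xi> T"
proof -
  have T0: "T \<ge> 0" using T by simp
  have zi: "0 \<in> {0..R0}" using R0_pos by simp
  have "continuous_on ({0..T} \<times> {0..R0}) (\<lambda>z. \<eta> (snd z) (fst z))"
    using c\<eta>(1) by (rule continuous_on_subset) auto
  moreover have "({0..T} \<times> {0..R0}) \<noteq> {}" using R0_pos T by auto
  ultimately obtain z where z: "z \<in> {0..T} \<times> {0..R0}"
    "\<forall>y\<in>{0..T} \<times> {0..R0}. \<eta> (snd z) (fst z) \<le> \<eta> (snd y) (fst y)"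
    using continuous_attains_inf[of "{0..T} \<times> {0..R0}"] compact_Times[OF compact_Icc compact_Icc] by blast
  \<comment> \<open>Positive minimum of \<open>\<eta>\<close> on the compact slab up to
    \<open>T\<close>; the constants below depend on it, and so on \<open>T\<close>.\<close>
  define e where "e = \<eta> (snd z) (fst z)"
  have e: "e > 0" using z(1) by (auto simp: e_def intro!: \<eta>_pos)
  have el: "\<eta> x s \<ge> e" if "x \<in> {0..R0}" "s \<in> {0..T}" for x s
    using z(2) that by (force simp: e_def)
  have cN: "continuous_on {0..} N" and cn: "continuous_on {0..} n"
    using N_DERIV n_DERIV by (force intro!: DERIV_continuous simp: continuous_on_eq_continuous_within)+
  have c\<xi>: "continuous_on {0..} \<xi>"
    using \<xi>_DERIV by (force intro!: DERIV_continuous simp: continuous_on_eq_continuous_within)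
  have cY: "continuous_on {0..} Y"
    using Y_DERIV(1) by (force intro!: DERIV_continuous simp: continuous_on_eq_continuous_within)
  have cH: "continuous_on {0..} H"
    unfolding H_def[abs_def]
    by (intro continuous_intros calE_cont cn cN c\<xi>) (use N_pos \<xi>_pos in force)+
  have "continuous_on {0..T} (\<lambda>s. n s / N s + b)"
    using N_pos by (intro continuous_intros continuous_on_subset[OF cn] continuous_on_subset[OF cN]) force+
  then have "compact ((\<lambda>s. n s / N s + b) ` {0..T})" by (rule compact_continuous_image) simp
  then obtain C2 where C2: "C2 > 0" "\<And>s. s \<in> {0..T} \<Longrightarrow> \<bar>n s / N s + b\<bar> \<le> C2"
    using compact_imp_bounded[of "(\<lambda>s. n s / N s + b) ` {0..T}"] by (auto simp: bounded_pos)
  define C1 where "C1 = \<bar>\<delta>\<bar> * (2 / e)"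
  \<comment> \<open>\<open>C1 * Y\<close> covers the negative gravitational part of
    \<open>H\<close>; the extra \<open>1\<close> leaves a full \<open>Y\<close> in the lower bound
    \<open>Glow\<close>.\<close>
  define \<Lambda> where "\<Lambda> = C1 + 1"
  \<comment> \<open>Chosen to dominate the coefficients of \<open>kin_excess\<close>,
    \<open>PI\<close> and \<open>Y\<close> in the estimate of the derivative of
    \<open>G\<close>.\<close>
  define C where "C = b + 2 * C2 + 2 * \<Lambda> / e^2 + C2 * C1 + \<Lambda>"
  define G where "G s = H s + \<Lambda> * Y s" for s
  have C1: "C1 \<ge> 0" and \<Lambda>: "\<Lambda> > 0" using e by (auto simp: C1_def \<Lambda>_def intro: add_nonneg_pos)
  have Cp: "C2 * C1 \<ge> 0" "2 * \<Lambda> / e^2 \<ge> 0" using C1 C2(1) \<Lambda> e by auto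
  have q: "0 \<le> \<bar>\<delta>\<bar> * grav_excess s" "\<bar>\<delta>\<bar> * grav_excess s \<le> C1 * Y s" "\<xi> s \<ge> e" if s: "s \<in> {0..T}" for s
  proof -
    have s0: "s \<ge> 0" using s by simp
    note g = grav_excess_bounds[OF s0 e el[OF _ s]]
    show "0 \<le> \<bar>\<delta>\<bar> * grav_excess s" using g(1) by simp
    show "\<bar>\<delta>\<bar> * grav_excess s \<le> C1 * Y s"
      using mult_left_mono[OF g(2), of "\<bar>\<delta>\<bar>"] by (simp add: C1_def)
    show "\<xi> s \<ge> e" by (rule g(3))
  qed
  have Glow: "kin_excess s + PI s + Y s \<le> G s" if s: "s \<in> {0..T}" for s
    using q[OF s] by (simp add: G_def H_eq \<Lambda>_def algebra_simps)
  have dG: "\<exists>D. (G has_real_derivative D) (at s) \<and> D \<le> C * G s" if s: "0 < s" "s < T" for s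
  proof -
    have s0: "s \<ge> 0" and sT: "s \<in> {0..T}" using s by auto
    have at: "at s within {0..} = at s" using s by (intro at_within_interior) simp
    define dH where "dH = b * H s - A s * (3 / (4 * \<mu>) * diss s) - (n s / N s + b) * (2 * kin_excess s + PI s - \<bar>\<delta>\<bar> * grav_excess s)"
    define dY where "dY = - 2 * Q1 s / \<xi> s + 2 * P1 s * n s / (N s * \<xi> s)"
    have "(G has_real_derivative dH + \<Lambda> * dY) (at s)"
      unfolding G_def[abs_def] dH_def dY_def
      using DERIV_add[OF H_DERIV[OF s(1)] DERIV_cmult[OF Y_DERIV(1)[OF s0]]] at by simp
    moreover have "dH + \<Lambda> * dY \<le> C * G s"
    proof -
      note k0 = kin_excess_nonneg[OF s0] and p0 = PI_nonneg[OF s0] and y0 = Y_nonneg[OF s0]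
      have 1: "b * H s \<le> b * (kin_excess s + PI s)"
        using q[OF sT] b_pos by (intro mult_left_mono) (auto simp: H_eq)
      have 2: "0 \<le> A s * (3 / (4 * \<mu>) * diss s)"
        using diss_nonneg[OF s0] mu_pos by (simp add: A_def)
      have "\<bar>2 * kin_excess s + PI s - \<bar>\<delta>\<bar> * grav_excess s\<bar> \<le> 2 * kin_excess s + PI s + C1 * Y s"
        using q[OF sT] k0 p0 by linarith
      then have "\<bar>n s / N s + b\<bar> * \<bar>2 * kin_excess s + PI s - \<bar>\<delta>\<bar> * grav_excess s\<bar> \<le> C2 * (2 * kin_excess s + PI s + C1 * Y s)"
        using C2(1) by (intro mult_mono C2(2)[OF sT]) auto
      then have 3: "- ((n s / N s + b) * (2 * kin_excess s + PI s - \<bar>\<delta>\<bar> * grav_excess s)) \<le> C2 * (2 * kin_excess s + PI s + C1 * Y s)"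
        unfolding abs_mult[symmetric] by linarith
      have "2 * kin_excess s / \<xi> s ^ 2 \<le> 2 * kin_excess s / e ^ 2"
        using k0 e q(3)[OF sT] by (intro divide_left_mono power_mono) auto
      then have "dY \<le> Y s + 2 * kin_excess s / e^2"
        using Y_DERIV(2)[OF s0] by (simp add: dY_def)
      then have 4: "\<Lambda> * dY \<le> \<Lambda> * (Y s + 2 * kin_excess s / e^2)"
        using \<Lambda> by (intro mult_left_mono) auto
      have "dH + \<Lambda> * dY \<le> b * (kin_excess s + PI s) + C2 * (2 * kin_excess s + PI s + C1 * Y s) + \<Lambda> * (Y s + 2 * kin_excess s / e^2)"
        unfolding dH_def using 1 2 3 4 by linarith
      also have "\<dots> = (b + 2 * C2 + 2 * \<Lambda> / e^2) * kin_excess s + (b + C2) * PI s + (C2 * C1 + \<Lambda>) * Y s"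
        by (simp add: algebra_simps)
      also have "\<dots> \<le> C * kin_excess s + C * PI s + C * Y s"
        using b_pos C2(1) \<Lambda> Cp k0 p0 y0 by (intro add_mono mult_right_mono) (auto simp: C_def)
      also have "\<dots> = C * (kin_excess s + PI s + Y s)" by (simp add: algebra_simps)
      also have "\<dots> \<le> C * G s"
        using Glow[OF sT] b_pos C2(1) \<Lambda> Cp by (intro mult_left_mono) (auto simp: C_def)
      finally show ?thesis .
    qed
    ultimately show ?thesis by blast
  qed
  have "exp (- C * T) * G T \<le> exp (- C * 0) * G 0"
  proof (rule DERIV_nonpos_imp_decreasing_open[OF T0, where f = "\<lambda>s. exp (- C * s) * G s"])
    fix s assume s: "0 < s" "s < T"
    obtain D where D: "(G has_real_derivative D) (at s)" "D \<le> C * G s" using dG[OF s] by blast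
    have "((\<lambda>s. exp (- C * s) * G s) has_real_derivative exp (- C * s) * (D - C * G s)) (at s)"
      using D(1) by (auto intro!: derivative_eq_intros simp: algebra_simps)
    moreover have "exp (- C * s) * (D - C * G s) \<le> 0" using D(2) by (simp add: mult_le_0_iff)
    ultimately show "\<exists>y. ((\<lambda>s. exp (- C * s) * G s) has_real_derivative y) (at s) \<and> y \<le> 0" by blast
  next
    show "continuous_on {0..T} (\<lambda>s. exp (- C * s) * G s)"
      unfolding G_def by (intro continuous_intros continuous_on_subset[OF cH] continuous_on_subset[OF cY]) auto
  qed
  moreover have "G 0 = 0"
  proof -
    have "\<forall>x\<in>{0..R0}. \<eta> x 0 = c" "\<forall>x\<in>{0..R0}. \<eta>s x 0 = c'" using h0 h1 by auto
    note hs = homogeneous_slice[OF order_refl this]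
    have c: "c > 0" using \<eta>_pos[OF zi order_refl] h0[OF zi] by simp
    have "\<xi> 0 = c" using hs(1) M_pos c by (simp add: \<xi>_def)
    then show ?thesis
      using c M_pos hs by (simp add: G_def H_eq kin_excess_def grav_excess_def Y_def power2_eq_square)
  qed
  ultimately have "exp (- C * T) * G T \<le> 0" by simp
  then have "G T \<le> 0" by (simp add: mult_le_0_iff not_le)
  then have "Y T = 0"
    using Glow[of T] kin_excess_nonneg[OF T0] PI_nonneg[OF T0] Y_nonneg[OF T0] T by auto
  then have I: "integral {0..R0} (\<lambda>x. (x^4 * \<rho> x) * (1 / \<xi> T * \<eta> x T + 0 * \<eta>s x T + - 1)^2) = 0"
    using Y_eq[OF T0] by (simp add: mom_def)
  have "continuous_on {0..R0} (\<lambda>x. (x^4 * \<rho> x) * (1 / \<xi> T * \<eta> x T + 0 * \<eta>s x T + - 1)^2)"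
    by (intro continuous_intros rho_cont cont2_slice[OF cont2_base(1) T0] cont2_slice[OF cont2_base(3) T0])
  from integral_eq_0_iff[OF this R0_pos] I
  have Z: "\<forall>x\<in>{0..R0}. (x^4 * \<rho> x) * (1 / \<xi> T * \<eta> x T + 0 * \<eta>s x T + - 1)^2 = 0"
    using weight_nonneg by simp
  have "(x^4 * \<rho> x) * (1 / \<xi> T * \<eta> x T + 0 * \<eta>s x T + - 1)^2 = 0"
    by (rule bspec[OF Z]) (use x in simp)
  moreover have "\<rho> x > 0" using rho_pos x by auto
  ultimately have "1 / \<xi> T * \<eta> x T = 1" using x by simp
  then show ?thesis using \<xi>_pos[OF T0] by (simp add: field_simps)
qed

text \<open>\<open>\<xi>\<close> does not depend on \<open>x\<close>, so agreement with it in the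
  open interval extends to the end points by continuity, and agreement for all positive times passes
  to the time derivative.\<close>

lemma homogeneous_data_persist:
  assumes h0: "\<And>x. x \<in> {0..R0} \<Longrightarrow> \<eta> x 0 = c" and h1: "\<And>x. x \<in> {0..R0} \<Longrightarrow> \<eta>s x 0 = c'"
    and s: "s \<ge> 0" and x: "x \<in> {0..R0}"
  shows "\<eta> x s = \<eta> 0 s" and "\<eta>s x s = \<eta>s 0 s"
proof -
  have zi: "0 \<in> {0..R0}" using R0_pos by simp
  have pos: "\<eta> x s = \<xi> s" if s: "s > 0" and x: "x \<in> {0..R0}" for x s
  proof -
    have cl: "closure {0<..<R0} = {0..R0}" using R0_pos by simp
    show ?thesis
      by (rule continuous_constant_on_closure[where S = "{0<..<R0}" and f = "\<lambda>x. \<eta> x s"])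
        (use cont2_slice[OF cont2_base(1)] homogeneous_data_unique[OF h0 h1] s x in \<open>auto simp: cl\<close>)
  qed
  show "\<eta> x s = \<eta> 0 s"
    using pos[of s x] pos[of s 0] h0[OF x] h0[OF zi] s x zi by (cases "s = 0") auto
  show "\<eta>s x s = \<eta>s 0 s"
  proof (cases "s = 0")
    case False
    then have sp: "s > 0" using s by simp
    have "((\<lambda>\<sigma>. \<eta> x \<sigma>) has_real_derivative \<eta>s 0 s) (at s)"
      by (rule has_field_derivative_transform_within_open[OF partials(2)[OF zi s] open_greaterThan])
        (use sp pos x zi in auto)
    then show ?thesis using DERIV_unique[OF partials(2)[OF x s]] by simp
  qed (use h1 x zi in auto)
qed

section \<open>The ordinary differential equation of homogeneous motions\<close>

lemma homogeneous_data_escapes: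
  assumes h0: "\<And>x. x \<in> {0..R0} \<Longrightarrow> \<phi> x 0 = c0" and h1: "\<And>x. x \<in> {0..R0} \<Longrightarrow> pds \<phi> x 0 = c1"
    and off: "c1 \<noteq> - sqrt (2 * \<bar>\<delta>\<bar>) * (1 + c0) + sqrt (2 * \<bar>\<delta>\<bar>) * (1 + c0) powr (-1/2)"
  shows "\<exists>S\<ge>0. \<forall>s>S. \<exists>x\<in>{0..R0}. \<bar>\<phi> x s\<bar> \<ge> 1/2"
proof -
  have zi: "0 \<in> {0..R0}" using R0_pos by simp
  have h0': "\<eta> x 0 = 1 + c0" if "x \<in> {0..R0}" for x using h0[OF that] by (simp add: \<eta>_def)
  have h1': "\<eta>s x 0 = c1" if "x \<in> {0..R0}" for x using h1[OF that] by (simp add: \<eta>s_def)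
  define h where "h s = \<eta> 0 s" for s
  define D where "D s = \<eta>s 0 s + b * h s" for s
  have hp: "h s > 0" if "s \<ge> 0" for s using \<eta>_pos[OF zi that] by (simp add: h_def)
  have slice: "calE s = M * (D s ^ 2 / 2 - \<bar>\<delta>\<bar> / h s)" "diss s = 0" if s: "s \<ge> 0" for s
  proof -
    have p1: "\<forall>x\<in>{0..R0}. \<eta> x s = h s"
      unfolding h_def by (rule ballI, rule homogeneous_data_persist(1)[OF h0' h1' s])
    have p2: "\<forall>x\<in>{0..R0}. \<eta>s x s = \<eta>s 0 s"
      by (rule ballI, rule homogeneous_data_persist(2)[OF h0' h1' s])
    note hs = homogeneous_slice[OF s p1 p2]
    have d: "\<bar>\<delta>\<bar> = b * b / 2" using b_sq delta_neg by simp
    show "diss s = 0" by (rule hs(7))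
    show "calE s = M * (D s ^ 2 / 2 - \<bar>\<delta>\<bar> / h s)"
      unfolding calE_def hs D_def h_def[symmetric] d using hp[OF s]
      by (simp add: field_simps power2_eq_square)
  qed
  define e0 where "e0 = D 0 ^ 2 / 2 - \<bar>\<delta>\<bar> / h 0"
  have E: "calE s = exp (b * s) * (M * e0)" if s: "s \<ge> 0" for s
  proof (cases "s = 0")
    case False
    have "exp (- b * s) * calE s = exp (- b * 0) * calE 0"
    proof (rule DERIV_isconst_end[where f = "\<lambda>s. exp (- b * s) * calE s"])
      show "0 < s" using False s by simp
      show "continuous_on {0..s} (\<lambda>s. exp (- b * s) * calE s)"
        by (rule continuous_on_subset[OF scaled_calE_cont]) auto
      show "((\<lambda>s. exp (- b * s) * calE s) has_real_derivative 0) (at y)" if "0 < y" "y < s" for y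
        using scaled_calE_DERIV[OF that(1)] slice(2)[of y] that by simp
    qed
    then have "exp (b * s) * (exp (- b * s) * calE s) = exp (b * s) * (M * e0)"
      using slice(1)[OF order_refl] by (simp add: e0_def)
    then show ?thesis by (simp add: mult.assoc[symmetric] exp_add[symmetric])
  qed (simp add: slice(1) e0_def)
  have ode: "D s ^ 2 = 2 * \<bar>\<delta>\<bar> / h s + 2 * e0 * exp (b * s)" if s: "s \<ge> 0" for s
  proof -
    have "M * (D s ^ 2 / 2 - \<bar>\<delta>\<bar> / h s) = M * (e0 * exp (b * s))"
      using E[OF s] slice(1)[OF s] by (simp add: mult_ac)
    then have "D s ^ 2 / 2 - \<bar>\<delta>\<bar> / h s = e0 * exp (b * s)" using M_pos by simp
    then show ?thesis by simp
  qed
  show ?thesis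
  proof (cases "e0 < 0")
    case True
    then have "calE 0 < 0" using E[OF order_refl] M_pos by (simp add: mult_pos_neg)
    then show ?thesis using negative_energy_escapes[OF order_refl] by blast
  next
    case False
    then have e0: "e0 \<ge> 0" by simp
    \<comment> \<open>For \<open>e0 \<ge> 0\<close> the gravitational term keeps
      \<open>D s ^ 2\<close> strictly positive, so \<open>D\<close> never changes sign and the
      motion stays ingoing or outgoing.\<close>
    have D0: "D s \<noteq> 0" if s: "s \<ge> 0" for s
    proof
      assume "D s = 0"
      then have "0 = 2 * \<bar>\<delta>\<bar> / h s + 2 * e0 * exp (b * s)" using ode[OF s] by simp
      moreover have "2 * \<bar>\<delta>\<bar> / h s > 0" using hp[OF s] delta_neg by (intro divide_pos_pos) auto
      ultimately show False using e0 by (smt (verit) exp_gt_zero mult_nonneg_nonneg)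
    qed
    have cD: "continuous_on {0..} D"
      unfolding D_def[abs_def] h_def using cont2_slice_time[OF cont2_base(1) zi] cont2_slice_time[OF cont2_base(3) zi]
      by (intro continuous_intros)
    \<comment> \<open>\<open>X\<close> is proportional to the physical radius of the star, and
      \<open>D\<close> is its velocity up to a power of the expansion factor.\<close>
    define X where "X s = exp (b * s) * h s" for s
    have dX: "(X has_real_derivative exp (b * s) * D s) (at s)" if s: "s \<ge> 0" for s
      unfolding X_def D_def h_def using partials(2)[OF zi s]
      by (auto intro!: derivative_eq_intros simp: algebra_simps)
    have cX: "continuous_on {0..} X"
      by (rule DERIV_continuous_on, rule has_field_derivative_at_within, rule dX) simp
    show ?thesis
    proof (cases "D 0 < 0")
      \<comment> \<open>Ingoing motion contradicts the positivity of \<open>\<eta>\<close> for all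
        times: \<open>X\<close> decreases at rate at least \<open>d\<close>.\<close>
      case True
      have Dn: "D s < 0" if s: "s \<ge> 0" for s
      proof (rule ccontr)
        assume "\<not> D s < 0"
        then obtain y where "0 \<le> y" "y \<le> s" "D y = 0"
          using IVT'[of D 0 0 s] True s continuous_on_subset[OF cD, of "{0..s}"] by auto
        then show False using D0 by blast
      qed
      define d where "d = sqrt (2 * \<bar>\<delta>\<bar> / h 0)"
      have "2 * \<bar>\<delta>\<bar> / h 0 > 0" using hp[of 0] delta_neg by (intro divide_pos_pos) auto
      then have d: "d > 0" by (simp add: d_def)
      have Xdec: "X s \<le> X 0" if s: "s \<ge> 0" for s
      proof (rule DERIV_nonpos_imp_decreasing_open[OF s, where f = X])
        show "\<exists>y. (X has_real_derivative y) (at z) \<and> y \<le> 0" if "0 < z" "z < s" for z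
          using dX[of z] Dn[of z] that by (intro exI[of _ "exp (b * z) * D z"]) (auto simp: mult_le_0_iff)
      qed (auto intro: continuous_on_subset[OF cX])
      have Dd: "exp (b * s) * D s \<le> - d" if s: "s \<ge> 0" for s
      proof -
        have e1: "exp (b * s) \<ge> 1" using b_pos s by simp
        have "h s \<le> exp (b * s) * h s" using e1 hp[OF s] by simp
        also have "\<dots> \<le> h 0" using Xdec[OF s] by (simp add: X_def)
        finally have "2 * \<bar>\<delta>\<bar> / h 0 \<le> 2 * \<bar>\<delta>\<bar> / h s" using hp[OF s] hp[of 0] by (intro divide_left_mono) auto
        also have "\<dots> \<le> D s ^ 2" using ode[OF s] e0 by simp
        finally have "d \<le> sqrt (D s ^ 2)" unfolding d_def by (rule real_sqrt_le_mono)
        then have "D s \<le> - d" using Dn[OF s] by simp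
        moreover have "exp (b * s) * D s \<le> 1 * D s"
          using e1 Dn[OF s] by (intro mult_right_mono_neg) auto
        ultimately show ?thesis by simp
      qed
      \<comment> \<open>By this time the linear bound has forced
        \<open>X s \<le> X 0 - d * s = - d\<close>.\<close>
      define s where "s = h 0 / d + 1"
      have s: "s \<ge> 0" using hp[of 0] d by (simp add: s_def)
      have "X s + d * s \<le> X 0 + d * 0"
      proof (rule DERIV_nonpos_imp_decreasing_open[OF s, where f = "\<lambda>s. X s + d * s"])
        show "\<exists>y. ((\<lambda>s. X s + d * s) has_real_derivative y) (at z) \<and> y \<le> 0" if "0 < z" "z < s" for z
          using dX[of z] Dd[of z] that
          by (intro exI[of _ "exp (b * z) * D z + d"]) (auto intro!: derivative_eq_intros)
        show "continuous_on {0..s} (\<lambda>s. X s + d * s)"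
          by (intro continuous_intros continuous_on_subset[OF cX]) auto
      qed
      moreover have "X s > 0" using hp[OF s] by (simp add: X_def)
      moreover have "d * s = h 0 + d" using d by (simp add: s_def field_simps)
      ultimately show ?thesis using d by (simp add: X_def)
    next
      case False
      then have D0p: "D 0 > 0" using D0[of 0] by auto
      have Dp: "D s > 0" if s: "s \<ge> 0" for s
      proof (rule ccontr)
        assume "\<not> D s > 0"
        then obtain y where "0 \<le> y" "y \<le> s" "D y = 0"
          using IVT2'[of D s 0 0] D0p s continuous_on_subset[OF cD, of "{0..s}"] by auto
        then show False using D0 by blast
      qed
      \<comment> \<open>For \<open>e0 = 0\<close> the positive root of \<open>D 0 ^ 2\<close> is the
        escape velocity, which \<open>off\<close> excludes.\<close>
      have "e0 \<noteq> 0"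
      proof
        assume "e0 = 0"
        then have "D 0 ^ 2 = 2 * \<bar>\<delta>\<bar> / h 0" using ode[of 0] by simp
        then have "D 0 = sqrt (2 * \<bar>\<delta>\<bar> / h 0)" using D0p by (simp add: real_sqrt_unique)
        moreover have "h 0 = 1 + c0" "D 0 = c1 + b * (1 + c0)"
          using h0'[OF zi] h1'[OF zi] by (auto simp: h_def D_def)
        moreover have "sqrt (2 * \<bar>\<delta>\<bar> / (1 + c0)) = sqrt (2 * \<bar>\<delta>\<bar>) * (1 + c0) powr (-1/2)"
          using hp[of 0] \<open>h 0 = 1 + c0\<close> by (simp add: real_sqrt_divide powr_minus_divide powr_half_sqrt)
        ultimately show False using off by (simp add: b_def)
      qed
      then have e0p: "e0 > 0" using e0 by simp
      define d where "d = sqrt (2 * e0)"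
      have d: "d > 0" using e0p by (simp add: d_def)
      have Dd: "D s \<ge> d * exp (b * s / 2)" if s: "s \<ge> 0" for s
      proof (rule power2_le_imp_le)
        have "(d * exp (b * s / 2))^2 = 2 * e0 * exp (b * s)"
          using e0p by (simp add: d_def power_mult_distrib exp_double[symmetric] power2_eq_square[of "exp _"] exp_add[symmetric])
        also have "\<dots> \<le> D s ^ 2" using ode[OF s] hp[OF s] by simp
        finally show "(d * exp (b * s / 2))^2 \<le> D s ^ 2" .
      qed (use Dp[OF s] in simp)
      \<comment> \<open>Below, \<open>h s \<ge> d * s / 3\<close>, and this exceeds
        \<open>3/2\<close> beyond \<open>S\<close>.\<close>
      define S where "S = 9 / (2 * d)"
      have "\<bar>\<phi> 0 s\<bar> \<ge> 1/2" if sS: "s > S" for s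
      proof -
        have S: "S > 0" using d by (simp add: S_def)
        have s: "s \<ge> 0" using sS S by simp
        \<comment> \<open>Makes \<open>k * exp (3 * b * s / 2)\<close> an antiderivative of
          \<open>d * exp (3 * b * s / 2)\<close>, the lower bound for the derivative of
          \<open>X\<close>.\<close>
        define k where "k = 2 * d / (3 * b)"
        have "X 0 - k * exp (3 * b * 0 / 2) \<le> X s - k * exp (3 * b * s / 2)"
        proof (rule DERIV_nonneg_imp_increasing_open[OF s, where f = "\<lambda>s. X s - k * exp (3 * b * s / 2)"])
          fix z assume z: "0 < z" "z < s"
          have "((\<lambda>s. X s - k * exp (3 * b * s / 2)) has_real_derivative
              exp (b * z) * D z - d * exp (3 * b * z / 2)) (at z)"
            using dX[of z] z b_pos by (auto intro!: derivative_eq_intros simp: k_def field_simps)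
          moreover have "exp (b * z) * (d * exp (b * z / 2)) \<le> exp (b * z) * D z"
            using Dd[of z] z by (intro mult_left_mono) auto
          moreover have "exp (b * z) * (d * exp (b * z / 2)) = d * exp (3 * b * z / 2)"
            by (simp add: mult.left_commute[of "exp (b * z)"] exp_add[symmetric])
          ultimately show "\<exists>y. ((\<lambda>s. X s - k * exp (3 * b * s / 2)) has_real_derivative y) (at z) \<and> 0 \<le> y"
            by (intro exI[of _ "exp (b * z) * D z - d * exp (3 * b * z / 2)"]) simp
        next
          show "continuous_on {0..s} (\<lambda>s. X s - k * exp (3 * b * s / 2))"
            by (intro continuous_intros continuous_on_subset[OF cX]) auto
        qed
        then have "k * exp (3 * b * s / 2) - k \<le> X s" using hp[of 0] by (simp add: X_def)
        moreover have "k * 1 \<le> k * exp (b * s)"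
          using d b_pos s by (intro mult_left_mono) (auto simp: k_def)
        moreover have "k * exp (3 * b * s / 2) = exp (b * s) * (k * exp (b * s / 2))"
          by (simp add: mult.left_commute[of "exp (b * s)"] exp_add[symmetric])
        moreover have "exp (b * s) * (k * (exp (b * s / 2) - 1)) = exp (b * s) * (k * exp (b * s / 2)) - k * exp (b * s)"
          by (simp add: algebra_simps)
        ultimately have "exp (b * s) * (k * (exp (b * s / 2) - 1)) \<le> X s"
          by linarith
        then have "exp (b * s) * (k * (exp (b * s / 2) - 1)) \<le> exp (b * s) * h s"
          by (simp only: X_def)
        then have "k * (exp (b * s / 2) - 1) \<le> h s" by simp
        moreover have "k * (b * s / 2) \<le> k * (exp (b * s / 2) - 1)"
        proof (rule mult_left_mono)
          show "b * s / 2 \<le> exp (b * s / 2) - 1" using exp_ge_add_one_self[of "b * s / 2"] by linarith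
          show "0 \<le> k" using d b_pos by (simp add: k_def)
        qed
        moreover have "k * (b * s / 2) = d * s / 3" using b_pos by (simp add: k_def)
        moreover have "d * s > 9 / 2" using sS d by (simp add: S_def field_simps)
        ultimately have "h s \<ge> 3/2" by linarith
        then show ?thesis by (simp add: h_def \<eta>_def)
      qed
      moreover have "S \<ge> 0" using d by (simp add: S_def)
      ultimately show ?thesis using zi by blast
    qed
  qed
qed

end


section \<open>Self-similar time and the theorem\<close>

text \<open>The power \<open>-3/2\<close> undoes the power \<open>2/3\<close> in
  \<open>alpha_t\<close> and leaves the reciprocal of an affine function, so self-similar time grows
  logarithmically.\<close>

lemma ss_time_eq:
  assumes a0: "a0 > 0" and "\<delta> \<noteq> 0" and t: "t \<ge> 0"
    and k: "k = 3/2 * a0 powr (1/2) * sqrt (2 * \<bar>\<delta>\<bar> / a0)"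
  shows "ss_time a0 \<delta> t = ln (1 + k * t / a0 powr (3/2)) / k"
proof -
  define u where "u = a0 powr (3/2)"
  have u: "u > 0" using a0 by (simp add: u_def)
  have k0: "k > 0" using assms by (simp add: k)
  have pos: "u + k * \<sigma> > 0" if "\<sigma> \<ge> 0" for \<sigma>
    using u k0 that by (intro add_pos_nonneg) auto
  have al: "alpha_t a0 \<delta> \<sigma> powr (-3/2) = 1 / (u + k * \<sigma>)" if "\<sigma> \<ge> 0" for \<sigma>
  proof -
    have "alpha_t a0 \<delta> \<sigma> powr (-3/2) = (u + k * \<sigma>) powr (2/3 * (-3/2))"
      unfolding alpha_t_def u_def k by (simp only: powr_powr)
    then show ?thesis using pos[OF that] by (simp add: powr_minus_divide)
  qed
  have "((\<lambda>\<sigma>. 1 / (u + k * \<sigma>)) has_integral ln (1 + k * t / u) / k - ln (1 + k * 0 / u) / k) {0..t}"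
  proof (rule fundamental_theorem_of_calculus[OF t])
    fix \<sigma> assume \<sigma>: "\<sigma> \<in> {0..t}"
    have e: "1 + k * \<sigma> / u = (u + k * \<sigma>) / u" using u by (simp add: field_simps)
    have "((\<lambda>\<sigma>. ln (1 + k * \<sigma> / u) / k) has_real_derivative 1 / ((u + k * \<sigma>) / u) * (k / u) / k) (at \<sigma>)"
      using pos[of \<sigma>] u \<sigma> k0 by (auto intro!: derivative_eq_intros simp: e)
    then have "((\<lambda>\<sigma>. ln (1 + k * \<sigma> / u) / k) has_real_derivative 1 / (u + k * \<sigma>)) (at \<sigma>)"
      by (rule DERIV_cong) (use u k0 in simp)
    then show "((\<lambda>\<sigma>. ln (1 + k * \<sigma> / u) / k) has_vector_derivative 1 / (u + k * \<sigma>)) (at \<sigma> within {0..t})"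
      by (simp add: has_real_derivative_iff_has_vector_derivative has_vector_derivative_at_within)
  qed
  then have "((\<lambda>\<sigma>. alpha_t a0 \<delta> \<sigma> powr (-3/2)) has_integral ln (1 + k * t / u) / k - ln (1 + k * 0 / u) / k) {0..t}"
    by (rule has_integral_eq[rotated]) (use al in auto)
  then show ?thesis unfolding ss_time_def u_def by (intro integral_unique) simp
qed

lemma ss_time_unbounded:
  assumes a0: "a0 > 0" and "\<delta> \<noteq> 0" and S: "S \<ge> 0"
  obtains T where "T > 0" "\<And>t. t > T \<Longrightarrow> ss_time a0 \<delta> t > S"
proof -
  define k where "k = 3/2 * a0 powr (1/2) * sqrt (2 * \<bar>\<delta>\<bar> / a0)"
  define u where "u = a0 powr (3/2)"
  have u: "u > 0" using a0 by (simp add: u_def)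
  have k: "k > 0" using assms by (simp add: k_def)
  have "ss_time a0 \<delta> t > S" if t: "t > u * exp (k * S) / k" for t
  proof -
    have "u * exp (k * S) / k > 0" using u k by simp
    then have t0: "t \<ge> 0" using t by simp
    have "exp (k * S) < 1 + k * t / u" using t u k by (simp add: field_simps)
    then have "ln (exp (k * S)) < ln (1 + k * t / u)" using t0 u k by (subst ln_less_cancel_iff) (auto intro: add_pos_nonneg)
    then have "S < ln (1 + k * t / u) / k" using k by (simp add: field_simps)
    then show ?thesis using ss_time_eq[OF a0 assms(2) t0 k_def] by (simp add: u_def)
  qed
  then show ?thesis using that[of "u * exp (k * S) / k"] u k by simp
qed

theorem theorem1p1:
  fixes \<mu> \<delta> a0 R0 :: real
    and \<rho> :: "real \<Rightarrow> real"
    and \<phi> :: "real \<Rightarrow> real \<Rightarrow> real"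
  assumes mu_pos: "\<mu> > 0" and delta_neg: "\<delta> < 0" and a0_pos: "a0 > 0"
    and R0_pos: "R0 > 0"
    \<comment> \<open>Lane-Emden type steady profile rho-bar with first zero R0\<close>
    and rho_cont: "continuous_on {0..R0} \<rho>"
    and rho_0: "\<rho> 0 = 1"
    and rho_d0: "(\<rho> has_real_derivative 0) (at 0 within {0..R0})"
    and rho_pos: "\<forall>y\<in>{0..<R0}. \<rho> y > 0"
    and rho_R0: "\<rho> R0 = 0"
    and rho_C2: "\<forall>y\<in>{0<..<R0}. (\<lambda>z. \<rho> z powr (1/3)) differentiable (at y)
                   \<and> deriv (\<lambda>z. \<rho> z powr (1/3)) differentiable (at y)"
    and rho_ode: "\<forall>y\<in>{0<..<R0}.
                    deriv (deriv (\<lambda>z. \<rho> z powr (1/3))) y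
                    + 2 / y * deriv (\<lambda>z. \<rho> z powr (1/3)) y + 1/4 * \<rho> y + 3/4 * \<delta> = 0"
    \<comment> \<open>phi is a global smooth solution (smooth up to the boundary)\<close>
    and phi_smooth: "\<exists>U. {0..R0} \<times> {0..} \<subseteq> U \<and> smooth2_on U (\<lambda>(x, s). \<phi> x s)"
    and phi_gt: "\<forall>x\<in>{0..R0}. \<forall>s\<ge>0. \<phi> x s > -1"
    and jac_pos: "\<forall>x\<in>{0..R0}. \<forall>s\<ge>0. 1 + \<phi> x s + x * pdx \<phi> x s > 0"
    and eqn: "\<forall>x\<in>{0<..<R0}. \<forall>s>0. pert_lhs a0 \<delta> \<rho> \<phi> x s = pert_rhs \<mu> a0 \<delta> \<phi> x s"
    and bc: "\<forall>s\<ge>0. Bbar \<mu> \<phi> R0 s = 0"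
    \<comment> \<open>case (1) homogeneous initial data off the zero-energy curve, or case (2)\<close>
    and cases:
      "(\<exists>c0 c1. (\<forall>x\<in>{0..R0}. \<phi> x 0 = c0 \<and> pds \<phi> x 0 = c1)
              \<and> c1 \<noteq> - sqrt (2 * \<bar>\<delta>\<bar>) * (1 + c0) + sqrt (2 * \<bar>\<delta>\<bar>) * (1 + c0) powr (-1/2))
       \<or> (energy a0 \<delta> R0 \<rho> \<phi> 0 \<le> 0
          \<and> \<not> (\<exists>c0 c1. \<forall>x\<in>{0..R0}. \<phi> x 0 = c0 \<and> pds \<phi> x 0 = c1))"
  shows "\<forall>\<epsilon>0. 0 < \<epsilon>0 \<and> \<epsilon>0 < 0.5 \<longrightarrow>
           (\<exists>T>0. \<forall>t>T. let s = ss_time a0 \<delta> t in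
              max (Sup ((\<lambda>x. \<bar>\<phi> x s\<bar>) ` {0..R0})) (Sup ((\<lambda>x. \<bar>x * pdx \<phi> x s\<bar>) ` {0..R0}))
                > \<epsilon>0)"
proof -
  interpret perturbed_star \<mu> \<delta> a0 R0 \<rho> \<phi>
    by unfold_locales (fact assms)+
  \<comment> \<open>The bound 1/2 exceeds every admissible \<open>\<epsilon>0\<close>, so one time
    \<open>S\<close> serves them all.\<close>
  have "\<exists>S\<ge>0. \<forall>s>S. \<exists>x\<in>{0..R0}. \<bar>\<phi> x s\<bar> \<ge> 1/2"
    using cases
  proof (elim disjE exE conjE)
    fix c0 c1 assume "\<forall>x\<in>{0..R0}. \<phi> x 0 = c0 \<and> pds \<phi> x 0 = c1"
      and "c1 \<noteq> - sqrt (2 * \<bar>\<delta>\<bar>) * (1 + c0) + sqrt (2 * \<bar>\<delta>\<bar>) * (1 + c0) powr (-1/2)"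
    then show ?thesis by (intro homogeneous_data_escapes[of c0 c1]) auto
  next
    assume "energy a0 \<delta> R0 \<rho> \<phi> 0 \<le> 0"
    then have "calE 0 \<le> 0"
      using a0_pos by (simp add: energy_eq alpha_bar_def mult_le_0_iff)
    moreover assume "\<not> (\<exists>c0 c1. \<forall>x\<in>{0..R0}. \<phi> x 0 = c0 \<and> pds \<phi> x 0 = c1)"
    ultimately show ?thesis by (rule nonpositive_energy_escapes)
  qed
  then obtain S where S: "S \<ge> 0" "\<And>s. s > S \<Longrightarrow> \<exists>x\<in>{0..R0}. \<bar>\<phi> x s\<bar> \<ge> 1/2" by blast
  obtain T where T: "T > 0" "\<And>t. t > T \<Longrightarrow> ss_time a0 \<delta> t > S"
    using ss_time_unbounded[OF a0_pos _ S(1), of \<delta>] delta_neg by auto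
  show ?thesis
  proof (intro allI impI exI[of _ T] conjI)
    fix \<epsilon>0 t :: real assume \<epsilon>: "0 < \<epsilon>0 \<and> \<epsilon>0 < 0.5" and "t > T"
    define s where "s = ss_time a0 \<delta> t"
    have s: "s > S" using T(2)[OF \<open>t > T\<close>] by (simp add: s_def)
    obtain x where x: "x \<in> {0..R0}" "\<bar>\<phi> x s\<bar> \<ge> 1/2" using S(2)[OF s] by blast
    have "s \<ge> 0" using s S(1) by simp
    then have "continuous_on {0..R0} (\<lambda>x. \<eta> x s - 1)"
      by (intro continuous_intros cont2_slice[OF cont2_base(1)])
    then have "continuous_on {0..R0} (\<lambda>x. \<bar>\<phi> x s\<bar>)"
      unfolding \<eta>_def by (intro continuous_intros) simp
    then have "compact ((\<lambda>x. \<bar>\<phi> x s\<bar>) ` {0..R0})"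
      by (rule compact_continuous_image) simp
    \<comment> \<open>\<open>Sup\<close> of a real set is an upper bound only if the set is bounded
      above; this is where continuity of the slice enters.\<close>
    then have "bdd_above ((\<lambda>x. \<bar>\<phi> x s\<bar>) ` {0..R0})"
      by (intro bounded_imp_bdd_above compact_imp_bounded)
    then have "\<bar>\<phi> x s\<bar> \<le> Sup ((\<lambda>x. \<bar>\<phi> x s\<bar>) ` {0..R0})"
      using x(1) by (intro cSup_upper) auto
    then have "\<epsilon>0 < Sup ((\<lambda>x. \<bar>\<phi> x s\<bar>) ` {0..R0})" using x(2) \<epsilon> by linarith
    then show "let s = ss_time a0 \<delta> t in
        \<epsilon>0 < max (Sup ((\<lambda>x. \<bar>\<phi> x s\<bar>) ` {0..R0})) (Sup ((\<lambda>x. \<bar>x * pdx \<phi> x s\<bar>) ` {0..R0}))"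
      by (simp add: s_def Let_def)
  qed (rule T(1))
qed

end
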